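(* Let $K$ be a field. (a) Suppose that for each matroid the toric ideal of its base ring over $K$ is generated by symmetric exchange relations. Then for each discrete polymatroid the toric ideal of its base ring over $K$ is generated by symmetric exchange relations. (b) Let $P\subset\mathbb{Z}_+^n$ be a discrete polymatroid whose set of bases $B$ satisfies the strong exchange property. Then (i) $B$ is sortable, and hence $I_B$ has a quadratic Gröbner basis (with respect to some monomial order) and $K[B]$ is Koszul; (ii) $I_B$ is generated by symmetric exchange relations.
   Context: $[n]=\{1,\dots,n\}$; $\mathbb{Z}_+^n$ is the set of integer vectors with nonnegative entries; $\varepsilon_1,\dots,\varepsilon_n$ are the canonical basis vectors. For $u\in\mathbb{Z}_+^n$, $u(i)$ is its $i$th entry and $|u|=\sum_i u(i)$ its modulus. $u\le v$ is the componentwise order; $u<v$ means $u\le v$, $u\neq v$; $u\vee v$ is the componentwise maximum. A discrete polymatroid on $[n]$ is a nonempty finite set $P\subset\mathbb{Z}_+^n$ such that (D1) if $u\in P$, $v\in\mathbb{Z}_+^n$ and $v\le u$, then $v\in P$; (D2) if $u,v\in P$ with $|v|>|u|$, then there is $w\in P$ with $u<w\le u\vee v$. A base of $P$ is a vector $u\in P$ with $u<v$ for no $v\in P$; all bases have the same modulus, called the rank of $P$. Identifying $F\subset[n]$ with $\sum_{i\in F}\varepsilon_i$, a matroid on $[n]$ is a discrete polymatroid consisting of $(0,1)$-vectors. Base ring and toric ideal: let $B$ be the set of bases of $P$. For $u\in\mathbb{Z}_+^n$ let $t^u=t_1^{u(1)}\cdots t_n^{u(n)}$. The base ring is $K[B]=K[t^us: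 u\in B]\subset K[t_1,\dots,t_n,s]$. The toric ideal $I_B$ is the kernel of the $K$-algebra homomorphism $K[x_u: u\in B]\to K[B]$, $x_u\mapsto t^us$, where the $x_u$ are indeterminates of degree 1. Symmetric exchange relation: if $u,v\in B$ with $u(i)>v(i)$ and $u(j)<v(j)$, and $u-\varepsilon_i+\varepsilon_j$ and $v-\varepsilon_j+\varepsilon_i$ both belong to $B$, then $x_ux_v-x_{u-\varepsilon_i+\varepsilon_j}x_{v-\varepsilon_j+\varepsilon_i}\in I_B$ is called a symmetric exchange relation. Strong exchange property for $B$: for all $u,v\in B$ with $u\ne v$ and all $i,j$ with $u(i)>v(i)$ and $u(j)<v(j)$ one has $u-\varepsilon_i+\varepsilon_j\in B$. Sortability: let $d$ be the common modulus of the elements of $B$. For $u,v\in B$ write $t^ut^v=t_{i_1}t_{i_2}\cdots t_{i_{2d}}$ with $i_1\le i_2\le\cdots\le i_{2d}$ and define $\operatorname{sort}(u,v)=(u',v')$ by $t^{u'}=\prod_{j=1}^d t_{i_{2j-1}}$ and $t^{v'}=\prod_{j=1}^d t_{i_{2j}}$. $B$ is sortable if $\operatorname{sort}(u,v)\in B\times B$ for all $u,v\in B$. A quadratic Gröbner basis is a Gröbner basis consisting of quadratic polynomials. Koszul means that the residue field $K$ has a linear resolution over the standard graded $K$-algebra $K[B]$ (generators in degree 1). *)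

theory Defs
  imports
    "HOL-Library.Poly_Mapping"
    "HOL-Library.Multiset"
    "HOL-Algebra.Ideal"
    "HOL-Algebra.RingHom"
    "HOL-Algebra.Generated_Rings"
    "Jordan_Normal_Form.Matrix"
begin

section \<open>Discrete polymatroids\<close>

text \<open>
  An integer vector with nonnegative entries is a finitely supported function from indices to
  natural numbers; those of \<open>\<int>\<^sub>+\<^sup>n\<close> are supported in \<open>[n] = {1..n}\<close>.
  The order instance that \<^theory>\<open>HOL-Library.Poly_Mapping\<close> puts on this type is lexicographic
  and is not used; the componentwise order is \<open>vle\<close>.
\<close>

type_synonym expvec = "nat \<Rightarrow>\<^sub>0 nat"

definition lattice_vectors :: "nat \<Rightarrow> expvec set" where
  "lattice_vectors n = {u. Poly_Mapping.keys u \<subseteq> {1..n}}"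

abbreviation unit_vector :: "nat \<Rightarrow> expvec" (\<open>\<epsilon>\<close>) where
  "\<epsilon> i \<equiv> Poly_Mapping.single i 1"

definition modulus :: "('x \<Rightarrow>\<^sub>0 nat) \<Rightarrow> nat" where
  "modulus u = (\<Sum>i\<in>Poly_Mapping.keys u. Poly_Mapping.lookup u i)"

definition vle :: "expvec \<Rightarrow> expvec \<Rightarrow> bool" where
  "vle u v \<longleftrightarrow> (\<forall>i. Poly_Mapping.lookup u i \<le> Poly_Mapping.lookup v i)"

definition vless :: "expvec \<Rightarrow> expvec \<Rightarrow> bool" where
  "vless u v \<longleftrightarrow> vle u v \<and> u \<noteq> v"

definition discrete_polymatroid :: "nat \<Rightarrow> expvec set \<Rightarrow> bool" where
  "discrete_polymatroid n P \<longleftrightarrow>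
     P \<noteq> {} \<and> finite P \<and> P \<subseteq> lattice_vectors n \<and>
     (\<forall>u\<in>P. \<forall>v\<in>lattice_vectors n. vle v u \<longrightarrow> v \<in> P) \<and>
     (\<forall>u\<in>P. \<forall>v\<in>P. modulus v > modulus u \<longrightarrow>
        (\<exists>w\<in>P. vless u w \<and>
           (\<forall>i. Poly_Mapping.lookup w i \<le> max (Poly_Mapping.lookup u i) (Poly_Mapping.lookup v i))))"

definition matroid :: "nat \<Rightarrow> expvec set \<Rightarrow> bool" where
  "matroid n M \<longleftrightarrow>
     discrete_polymatroid n M \<and> (\<forall>u\<in>M. \<forall>i. Poly_Mapping.lookup u i \<in> {0, 1})"

definition bases :: "expvec set \<Rightarrow> expvec set" where
  "bases P = {u\<in>P. \<not> (\<exists>v\<in>P. vless u v)}"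

text \<open>
  The indices below range over all natural numbers; the inequalities force them into the supports
  of \<open>u\<close> and \<open>v\<close>, hence into \<open>[n]\<close>. Subtraction of vectors is truncated, which is harmless
  because the entry from which 1 is subtracted is positive.
\<close>

definition strong_exchange_property :: "expvec set \<Rightarrow> bool" where
  "strong_exchange_property B \<longleftrightarrow>
     (\<forall>u\<in>B. \<forall>v\<in>B. u \<noteq> v \<longrightarrow>
        (\<forall>i j. Poly_Mapping.lookup u i > Poly_Mapping.lookup v i \<and>
               Poly_Mapping.lookup u j < Poly_Mapping.lookup v j \<longrightarrow>
               u - \<epsilon> i + \<epsilon> j \<in> B))"


section \<open>Sortability\<close>

text \<open>The sequence \<open>i\<^sub>1 \<le> i\<^sub>2 \<le> \<dots>\<close> with \<open>t\<^sup>w = t\<^bsub>i\<^sub>1\<^esub> t\<^bsub>i\<^sub>2\<^esub> \<dots>\<close>\<close>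

definition index_list :: "expvec \<Rightarrow> nat list" where
  "index_list w = sorted_list_of_multiset
     (\<Sum>i\<in>Poly_Mapping.keys w. replicate_mset (Poly_Mapping.lookup w i) i)"

text \<open>Lists are indexed from 0, so \<open>i\<^bsub>2j-1\<^esub>\<close> and \<open>i\<^bsub>2j\<^esub>\<close> for \<open>j = 1, \<dots>, d\<close> are the entries at
  \<open>2 * j\<close> and \<open>2 * j + 1\<close> for \<open>j < d\<close>. The pair is meaningful when \<open>u\<close> and \<open>v\<close> both have
  modulus \<open>d\<close>.\<close>

definition sort_pair :: "expvec \<Rightarrow> expvec \<Rightarrow> expvec \<times> expvec" where
  "sort_pair u v =
     (let d = modulus u; xs = index_list (u + v)
      in (\<Sum>j<d. \<epsilon> (xs ! (2 * j)), \<Sum>j<d. \<epsilon> (xs ! (2 * j + 1))))"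

definition sortable :: "expvec set \<Rightarrow> bool" where
  "sortable B \<longleftrightarrow> (\<forall>u\<in>B. \<forall>v\<in>B. sort_pair u v \<in> B \<times> B)"


section \<open>Base ring and toric ideal\<close>

text \<open>
  A polynomial is a finitely supported function from monomials to coefficients, a monomial a
  finitely supported function from variables to exponents.

  In \<open>ts_poly\<close> the variable with index \<open>i \<ge> 1\<close> is \<open>t\<^sub>i\<close> and the variable with index 0 is \<open>s\<close>, so
  the vector \<open>u\<close>, supported in \<open>{1..n}\<close>, is the exponent of \<open>t\<^sup>u\<close>, and \<open>u + \<epsilon> 0\<close> that of
  \<open>t\<^sup>u s\<close>. In \<open>x_poly\<close> the variables are the \<open>x\<^sub>u\<close>, indexed by the vectors \<open>u\<close> themselves.
\<close>

type_synonym 'a ts_poly = "expvec \<Rightarrow>\<^sub>0 'a"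
type_synonym xmonom = "expvec \<Rightarrow>\<^sub>0 nat"
type_synonym 'a x_poly = "xmonom \<Rightarrow>\<^sub>0 'a"

definition ring_on :: "'r::comm_ring_1 set \<Rightarrow> 'r ring" where
  "ring_on A = \<lparr>carrier = A, monoid.mult = (*), one = 1, ring.zero = 0, add = (+)\<rparr>"

definition xmonoms :: "expvec set \<Rightarrow> xmonom set" where
  "xmonoms B = {m. Poly_Mapping.keys m \<subseteq> B}"

definition x_ring :: "expvec set \<Rightarrow> 'a::field x_poly ring" where
  "x_ring B = ring_on {p. Poly_Mapping.keys p \<subseteq> xmonoms B}"

definition xvar :: "expvec \<Rightarrow> 'a::field x_poly" where
  "xvar u = Poly_Mapping.single (Poly_Mapping.single u 1) 1"

definition tu_s :: "expvec \<Rightarrow> 'a::field ts_poly" where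
  "tu_s u = Poly_Mapping.single (u + \<epsilon> 0) 1"

text \<open>The \<open>K\<close>-subalgebra generated by the \<open>t\<^sup>u s\<close>: the subring generated by these and the
  constants.\<close>

definition base_ring :: "expvec set \<Rightarrow> 'a::field ts_poly ring" where
  "base_ring B =
     ring_on (generate_ring (ring_on UNIV) (range (Poly_Mapping.single 0) \<union> tu_s ` B))"

text \<open>The \<open>K\<close>-algebra homomorphism determined by \<open>x\<^sub>u \<mapsto> t\<^sup>u s\<close>\<close>

definition toric_map :: "'a::field x_poly \<Rightarrow> 'a ts_poly" where
  "toric_map p = (\<Sum>m\<in>Poly_Mapping.keys p.
     Poly_Mapping.single 0 (Poly_Mapping.lookup p m) *
     (\<Prod>u\<in>Poly_Mapping.keys m. tu_s u ^ Poly_Mapping.lookup m u))"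

definition toric_ideal :: "expvec set \<Rightarrow> 'a::field x_poly set" where
  "toric_ideal B = a_kernel (x_ring B) (base_ring B) toric_map"

definition symmetric_exchange_relations :: "expvec set \<Rightarrow> 'a::field x_poly set" where
  "symmetric_exchange_relations B =
     {xvar u * xvar v - xvar (u - \<epsilon> i + \<epsilon> j) * xvar (v - \<epsilon> j + \<epsilon> i) | u v i j.
        u \<in> B \<and> v \<in> B \<and>
        Poly_Mapping.lookup u i > Poly_Mapping.lookup v i \<and>
        Poly_Mapping.lookup u j < Poly_Mapping.lookup v j \<and>
        u - \<epsilon> i + \<epsilon> j \<in> B \<and> v - \<epsilon> j + \<epsilon> i \<in> B}"


section \<open>Groebner bases\<close>

definition monomial_order :: "expvec set \<Rightarrow> xmonom rel \<Rightarrow> bool" where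
  "monomial_order B r \<longleftrightarrow>
     linear_order_on (xmonoms B) r \<and>
     (\<forall>m\<in>xmonoms B. (0, m) \<in> r) \<and>
     (\<forall>l\<in>xmonoms B. \<forall>m\<in>xmonoms B. \<forall>m'\<in>xmonoms B. (m, m') \<in> r \<longrightarrow> (m + l, m' + l) \<in> r)"

definition initial_monomial :: "xmonom rel \<Rightarrow> 'a::field x_poly \<Rightarrow> 'a x_poly" where
  "initial_monomial r f = Poly_Mapping.single
     (THE m. m \<in> Poly_Mapping.keys f \<and> (\<forall>m'\<in>Poly_Mapping.keys f. (m', m) \<in> r)) 1"

definition groebner_basis ::
    "expvec set \<Rightarrow> xmonom rel \<Rightarrow> 'a::field x_poly set \<Rightarrow> 'a x_poly set \<Rightarrow> bool" where
  "groebner_basis B r I G \<longleftrightarrow>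
     finite G \<and> G \<subseteq> I - {0} \<and>
     Idl\<^bsub>x_ring B\<^esub> (initial_monomial r ` G) = Idl\<^bsub>x_ring B\<^esub> (initial_monomial r ` (I - {0}))"

definition quadratic :: "'a::field x_poly \<Rightarrow> bool" where
  "quadratic p \<longleftrightarrow> p \<noteq> 0 \<and> (\<forall>m\<in>Poly_Mapping.keys p. modulus m = 2)"


section \<open>Koszulness of the base ring\<close>

text \<open>The grading in which every \<open>t\<^sup>u s\<close> has degree 1 is the grading by the exponent of \<open>s\<close>.\<close>

definition base_ring_degree :: "expvec set \<Rightarrow> nat \<Rightarrow> 'a::field ts_poly set" where
  "base_ring_degree B k =
     {f \<in> carrier (base_ring B). \<forall>m\<in>Poly_Mapping.keys f. Poly_Mapping.lookup m 0 = k}"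

definition free_module :: "expvec set \<Rightarrow> nat \<Rightarrow> 'a::field ts_poly vec set" where
  "free_module B b = {f \<in> carrier_vec b. set\<^sub>v f \<subseteq> carrier (base_ring B)}"

text \<open>
  The residue field \<open>K\<close> is a module over \<open>R = K[B]\<close> through the constant coefficient, so
  a map from the free module \<open>R\<^sup>b\<close> to \<open>K\<close> is given by the images \<open>e\<close> of the basis elements.
\<close>

definition augmentation :: "'a::field vec \<Rightarrow> 'a ts_poly vec \<Rightarrow> 'a" where
  "augmentation e f = map_vec (\<lambda>p. Poly_Mapping.lookup p 0) f \<bullet> e"

text \<open>
  A linear resolution \<open>\<dots> \<rightarrow> R(-2)\<^bsup>b 2\<^esup> \<rightarrow> R(-1)\<^bsup>b 1\<^esup> \<rightarrow> R\<^bsup>b 0\<^esup> \<rightarrow> K \<rightarrow> 0\<close>. A homogeneous map of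
  degree 0 from \<open>R(-i-1)\<^bsup>b (i+1)\<^esup>\<close> to \<open>R(-i)\<^bsup>b i\<^esup>\<close> is a matrix \<open>A i\<close> with entries in the degree 1
  part of \<open>R\<close>; the last three conjuncts express exactness at \<open>K\<close>, at \<open>R\<^bsup>b 0\<^esup>\<close> and at the
  remaining places.
\<close>

definition linear_resolution ::
    "expvec set \<Rightarrow> (nat \<Rightarrow> nat) \<Rightarrow> 'a::field vec \<Rightarrow> (nat \<Rightarrow> 'a ts_poly mat) \<Rightarrow> bool" where
  "linear_resolution B b e A \<longleftrightarrow>
     e \<in> carrier_vec (b 0) \<and>
     (\<forall>i. A i \<in> carrier_mat (b i) (b (Suc i)) \<and> elements_mat (A i) \<subseteq> base_ring_degree B 1) \<and>
     augmentation e ` free_module B (b 0) = UNIV \<and>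
     {f \<in> free_module B (b 0). augmentation e f = 0} = (\<lambda>g. A 0 *\<^sub>v g) ` free_module B (b 1) \<and>
     (\<forall>i. {f \<in> free_module B (b (Suc i)). A i *\<^sub>v f = 0\<^sub>v (b i)} =
          (\<lambda>g. A (Suc i) *\<^sub>v g) ` free_module B (b (Suc (Suc i))))"

definition koszul_base_ring :: "'a::field itself \<Rightarrow> expvec set \<Rightarrow> bool" where
  "koszul_base_ring K B \<longleftrightarrow>
     (\<exists>b (e :: 'a vec) A. linear_resolution B b e A)"

end

theory Submission
  imports Defs
begin

text \<open>
  The toric ideal is spanned by the differences of monomials with the same image.

  For (a), replace every index of a polymatroid by many copies; the sets of copies whose counts lie
  in the polymatroid form a matroid. The factors of two monomials with the same image lift to
  consecutive blocks of copies, so the difference lifts to the toric ideal of the matroid.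
  Forgetting the copies maps an exchange of the matroid to an exchange in the polymatroid that may
  violate the inequalities of a symmetric exchange relation; then the symmetric exchange property of
  the bases supplies a detour through a third pair of bases.

  For (b), a pair of bases is moved step by step to its sorted pair by symmetric exchanges, all
  available by the strong exchange property. The sum of the squares of all block sums strictly
  decreases under sorting, and a monomial with pairwise sorted factors is determined by its image.
  So the sorting relations form a quadratic Groebner basis. For the Koszul property, the leading
  terms of the cycles are, inductively, the multiples of single variables times generators, as in
  Schreyer's construction of a resolution over the polynomial ring modulo a quadratic monomial
  ideal; hence each syzygy module is generated by linear elements.
\<close>

section \<open>Monomials and the toric map\<close>

text \<open>In (a) the delicate exchanges have a gap of at least 2 at one index and equality or the
  wrong sign at the other: then neither the exchange nor its inverse is a symmetric exchange
  relation.

  In (b) the resolution is built over \<open>K[B]\<close> itself and not over the polynomial ring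
  modulo the initial ideal, so its order has to cope with multiplication in \<open>K[B]\<close>,
  where a product of standard monomials may have to be sorted again. What saves the argument is that
  sorting never raises a monomial: leading terms computed as if no sorting were needed are upper
  bounds, and where a bound is attained, the computation modulo the initial ideal applies. The
  resolution is linear because, modulo a quadratic monomial ideal, the colon ideal of some variables
  by a further variable is again generated by variables. All this happens in one multidegree at a
  time, where each module is a finite-dimensional space and each word names at most one basis
  element.\<close>

abbreviation lookup where "lookup \<equiv> Poly_Mapping.lookup"
abbreviation keys where "keys \<equiv> Poly_Mapping.keys"
abbreviation single where "single \<equiv> Poly_Mapping.single"

lemma poly_mapping_sum_single: "p = (\<Sum>m\<in>keys p. single m (lookup p m))"
  by (rule poly_mapping_eqI) (auto simp: lookup_sum lookup_single when_def in_keys_iff)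

lemma keys_plus_nat: "keys (m + m' :: 'x \<Rightarrow>\<^sub>0 nat) = keys m \<union> keys m'"
  by (auto simp: in_keys_iff lookup_add)

lemma exponent_induct [case_names zero add]:
  fixes m :: "'x \<Rightarrow>\<^sub>0 nat"
  assumes "P 0" "\<And>m u. P m \<Longrightarrow> P (m + single u 1)"
  shows "P m"
proof (induction "\<Sum>u\<in>keys m. lookup m u" arbitrary: m rule: less_induct)
  case less
  show ?case
  proof (cases "m = 0")
    case False
    then obtain u where u: "u \<in> keys m"
      by (metis keys_zero poly_mapping_eqI lookup_zero in_keys_iff)
    define m' where "m' = m - single u 1"
    have m: "m = m' + single u 1"
      using u by (intro poly_mapping_eqI)
        (auto simp: m'_def lookup_add lookup_minus lookup_single when_def in_keys_iff)
    have "(\<Sum>v\<in>keys m'. lookup m' v) = (\<Sum>v\<in>keys m. lookup m' v)"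
      by (rule sum.mono_neutral_left) (auto simp: m keys_plus_nat in_keys_iff)
    also have "\<dots> < (\<Sum>v\<in>keys m. lookup m v)"
      by (rule sum_strict_mono_ex1) (use u in \<open>auto simp: m lookup_add intro!: bexI[of _ u]\<close>)
    finally have "P m'" by (rule less)
    then show ?thesis unfolding m by (rule assms)
  qed (simp add: assms)
qed

text \<open>The additive extension of \<open>f\<close> to the free commutative monoid. The inner sum
  stands for a multiple of \<open>f u\<close>, because the target is only a commutative
  monoid.\<close>

definition lin_ext :: "('x \<Rightarrow> 'm::comm_monoid_add) \<Rightarrow> ('x \<Rightarrow>\<^sub>0 nat) \<Rightarrow> 'm" where
  "lin_ext f m = (\<Sum>u\<in>keys m. \<Sum>i<lookup m u. f u)"

lemma lin_ext_0 [simp]: "lin_ext f 0 = 0"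
  by (simp add: lin_ext_def)

lemma lin_ext_single [simp]: "lin_ext f (single u (Suc 0)) = f u"
  by (simp add: lin_ext_def)

lemma lin_ext_add:
  fixes f :: "'x \<Rightarrow> 'm::comm_monoid_add"
  shows "lin_ext f (m + m') = lin_ext f m + lin_ext f m'"
proof -
  have split: "(\<Sum>i<a + b. c) = (\<Sum>i<a. c) + (\<Sum>i<b. c)" for a b :: nat and c :: 'm
    by (induction b) (auto simp: add_ac)
  show ?thesis
    unfolding lin_ext_def by (rule setsum_keys_plus_distrib) (auto simp: split)
qed

text \<open>Additive maps are determined by their values on single variables; identities such as
  \<open>blk_vsum\<close> reduce to this.\<close>

lemma lin_ext_unique:
  assumes "h 0 = 0" "\<And>m m'. h (m + m') = h m + h m'"
  shows "h m = lin_ext (\<lambda>u. h (single u 1)) m"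
  by (induction m rule: exponent_induct) (auto simp: assms lin_ext_add)

lemma lookup_lin_ext: "lookup (lin_ext f m) i = lin_ext (\<lambda>u. lookup (f u) i) m"
  using lin_ext_unique[of "\<lambda>m. lookup (lin_ext f m) i" m] by (simp add: lin_ext_add lookup_add)

lemma modulus_eq: "modulus m = lin_ext (\<lambda>_. 1) m"
  by (simp add: modulus_def lin_ext_def)

lemma modulus_0 [simp]: "modulus 0 = 0"
  and modulus_add: "modulus (m + m') = modulus m + modulus m'"
  and modulus_single [simp]: "modulus (single u (Suc 0)) = 1"
  by (auto simp: modulus_eq lin_ext_add)

lemma xmonoms_0 [simp]: "0 \<in> xmonoms B"
  by (simp add: xmonoms_def)

lemma xmonoms_add [simp]: "m + m' \<in> xmonoms B \<longleftrightarrow> m \<in> xmonoms B \<and> m' \<in> xmonoms B"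
  by (auto simp: xmonoms_def keys_plus_nat)

lemma xmonoms_single [simp]: "single u (Suc 0) \<in> xmonoms B \<longleftrightarrow> u \<in> B"
  by (auto simp: xmonoms_def)

text \<open>Coefficients are added up along the fibres of \<open>h\<close>. For additive
  \<open>h\<close> this is the induced homomorphism of monoid algebras (\<open>push_mult\<close>);
  the toric map and the forgetting of copies both have this form.\<close>

definition push :: "('m \<Rightarrow> 'n) \<Rightarrow> ('m \<Rightarrow>\<^sub>0 'a) \<Rightarrow> ('n \<Rightarrow>\<^sub>0 'a::comm_monoid_add)" where
  "push h p = (\<Sum>m\<in>keys p. single (h m) (lookup p m))"

lemma push_0 [simp]: "push h 0 = 0"
  by (simp add: push_def)

lemma push_single [simp]: "push h (single m c) = single (h m) c"
  by (simp add: push_def)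

lemma push_add: "push h (p + q) = push h p + push h q"
  unfolding push_def by (rule setsum_keys_plus_distrib) (auto simp: single_add)

lemma push_sum: "push h (sum f A) = (\<Sum>x\<in>A. push h (f x))"
  by (induction A rule: infinite_finite_induct) (auto simp: push_add)

lemma push_diff: "push h (p - q) = push h p - push h (q :: 'm \<Rightarrow>\<^sub>0 'a::ab_group_add)"
  by (metis add_diff_cancel diff_add_cancel push_add)

lemma push_mult:
  fixes h :: "'m::comm_monoid_add \<Rightarrow> 'n::comm_monoid_add" and p q :: "'m \<Rightarrow>\<^sub>0 'a::comm_ring_1"
  assumes "\<And>m m'. h (m + m') = h m + h m'"
  shows "push h (p * q) = push h p * push h q"
proof -
  have *: "push h (single m c * q) = single (h m) c * push h q" for m c
    by (subst (1 2) poly_mapping_sum_single[of q])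
      (simp add: sum_distrib_left push_sum mult_single assms)
  show ?thesis
    by (subst (1 2) poly_mapping_sum_single[of p])
      (simp add: sum_distrib_right push_sum *)
qed

lemma lookup_push: "lookup (push h p) w = (\<Sum>m | m \<in> keys p \<and> h m = w. lookup p m)"
  by (simp add: push_def lookup_sum lookup_single when_def sum.If_cases Int_def conj_commute
      flip: sum.inter_filter)

lemma keys_push: "keys (push h p) \<subseteq> h ` keys p"
proof
  fix w assume "w \<in> keys (push h p)"
  then have "(\<Sum>m | m \<in> keys p \<and> h m = w. lookup p m) \<noteq> 0"
    by (simp add: in_keys_iff lookup_push)
  then have "{m. m \<in> keys p \<and> h m = w} \<noteq> {}"
    by (metis sum.empty)
  then show "w \<in> h ` keys p" by auto
qed

text \<open>The exponent of the image of \<open>m\<close> under the toric map. Monomials with the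
  same value form a fibre.\<close>

definition fibre_sum :: "xmonom \<Rightarrow> expvec" where
  "fibre_sum m = lin_ext (\<lambda>u. u + \<epsilon> 0) m"

lemma fibre_sum_0 [simp]: "fibre_sum 0 = 0"
  and fibre_sum_add: "fibre_sum (m + m') = fibre_sum m + fibre_sum m'"
  and fibre_sum_single [simp]: "fibre_sum (single u (Suc 0)) = u + \<epsilon> 0"
  by (auto simp: fibre_sum_def lin_ext_add)

lemma toric_map_eq: "toric_map p = push fibre_sum p"
proof -
  have single_sum: "single (sum f A) (1::'a) = (\<Prod>x\<in>A. single (f x) 1)" if "finite A" for f :: "'x \<Rightarrow> expvec" and A
    using that by (induction A rule: finite_induct) (simp_all, metis mult_single mult_1)
  have "tu_s u ^ k = (\<Prod>i<k. single (u + \<epsilon> 0) (1::'a))" for u k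
    by (simp add: tu_s_def)
  then have "tu_s u ^ k = single (\<Sum>i<k. u + \<epsilon> 0) (1::'a)" for u k
    by (simp add: single_sum del: prod_constant sum_constant)
  then have "(\<Prod>u\<in>keys m. tu_s u ^ lookup m u) = single (fibre_sum m) (1::'a)" for m
    by (simp add: fibre_sum_def lin_ext_def single_sum[symmetric])
  then show ?thesis
    by (simp add: toric_map_def push_def mult_single)
qed

section \<open>Ideals\<close>

lemma ring_on_simps [simp]:
  "carrier (ring_on A) = A" "\<zero>\<^bsub>ring_on A\<^esub> = 0" "\<one>\<^bsub>ring_on A\<^esub> = 1"
  "x \<oplus>\<^bsub>ring_on A\<^esub> y = x + y" "x \<otimes>\<^bsub>ring_on A\<^esub> y = x * y"
  by (simp_all add: ring_on_def)

lemma cring_ring_on: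
  assumes "0 \<in> A" "1 \<in> A" "\<And>x y. x \<in> A \<Longrightarrow> y \<in> A \<Longrightarrow> x + y \<in> A"
    "\<And>x y. x \<in> A \<Longrightarrow> y \<in> A \<Longrightarrow> x * y \<in> A" "\<And>x. x \<in> A \<Longrightarrow> - x \<in> A"
  shows "cring (ring_on A)"
proof (rule cringI)
  show "abelian_group (ring_on A)"
    by (rule abelian_groupI) (use assms in \<open>auto simp: algebra_simps intro: bexI[of _ "- _"]\<close>)
  show "Group.comm_monoid (ring_on A)"
    by (rule comm_monoidI) (use assms in \<open>auto simp: algebra_simps\<close>)
qed (use assms in \<open>auto simp: algebra_simps\<close>)

lemma a_inv_ring_on:
  assumes "cring (ring_on A)" "x \<in> A" "- x \<in> A"
  shows "\<ominus>\<^bsub>ring_on A\<^esub> x = - x"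
proof -
  interpret cring "ring_on A" by fact
  show ?thesis by (rule minus_equality) (use assms in auto)
qed

lemma ideal_ring_onI:
  assumes cr: "cring (ring_on A)" and neg: "\<And>x. x \<in> A \<Longrightarrow> - x \<in> A"
    and "I \<subseteq> A" "0 \<in> I" "\<And>x y. x \<in> I \<Longrightarrow> y \<in> I \<Longrightarrow> x + y \<in> I"
    and mult: "\<And>a x. a \<in> A \<Longrightarrow> x \<in> I \<Longrightarrow> a * x \<in> I"
  shows "ideal I (ring_on A)"
proof (rule idealI)
  interpret cring "ring_on A" by fact
  show "ring (ring_on A)" by (rule ring_axioms)
  have neg1: "- 1 \<in> A"
    using one_closed neg by auto
  show "subgroup I (add_monoid (ring_on A))"
  proof (rule add.subgroupI)
    fix x assume "x \<in> I"
    then show "\<ominus>\<^bsub>ring_on A\<^esub> x \<in> I"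
      using a_inv_ring_on[OF cr, of x] mult[OF neg1, of x] neg \<open>I \<subseteq> A\<close> by auto
  qed (use assms in auto)
next
  fix a x assume "a \<in> I" "x \<in> carrier (ring_on A)"
  then show "x \<otimes>\<^bsub>ring_on A\<^esub> a \<in> I" "a \<otimes>\<^bsub>ring_on A\<^esub> x \<in> I"
    using mult[of x a] by (auto simp: mult.commute)
qed

definition x_polys :: "expvec set \<Rightarrow> 'a::field x_poly set" where
  "x_polys B = {p. keys p \<subseteq> xmonoms B}"

lemma x_ring_eq: "x_ring B = ring_on (x_polys B)"
  by (simp add: x_ring_def x_polys_def)

lemma x_polys_add: "p \<in> x_polys B \<Longrightarrow> q \<in> x_polys B \<Longrightarrow> p + q \<in> x_polys B"
  using keys_add[of p q] by (auto simp: x_polys_def)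

lemma x_polys_uminus: "p \<in> x_polys B \<Longrightarrow> - p \<in> x_polys B"
  by (auto simp: x_polys_def in_keys_iff subset_iff)

lemma x_polys_diff: "p \<in> x_polys B \<Longrightarrow> q \<in> x_polys B \<Longrightarrow> p - q \<in> x_polys B"
  using x_polys_add[of p B "- q"] x_polys_uminus[of q B] by simp

lemma x_polys_single: "m \<in> xmonoms B \<Longrightarrow> single m c \<in> x_polys B"
  by (auto simp: x_polys_def)

lemma x_polys_mult: "p \<in> x_polys B \<Longrightarrow> q \<in> x_polys B \<Longrightarrow> p * q \<in> x_polys B"
  using keys_mult[of p q] by (fastforce simp: x_polys_def)

lemma x_polys_0: "0 \<in> x_polys B" and x_polys_1: "1 \<in> x_polys B"
  by (simp_all add: x_polys_def)

lemma cring_x_ring: "cring (ring_on (x_polys B :: 'a::field x_poly set))"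
  by (rule cring_ring_on)
    (simp_all add: x_polys_add x_polys_mult x_polys_uminus x_polys_0 x_polys_1)

lemma ideal_x_ringI:
  assumes "I \<subseteq> x_polys B" "0 \<in> I" "\<And>x y. x \<in> I \<Longrightarrow> y \<in> I \<Longrightarrow> x + y \<in> I"
    and "\<And>a x. a \<in> x_polys B \<Longrightarrow> x \<in> I \<Longrightarrow> a * x \<in> I"
  shows "ideal I (x_ring B)"
  unfolding x_ring_eq by (rule ideal_ring_onI[OF cring_x_ring]) (use assms x_polys_uminus in auto)

lemma ideal_x_ringD:
  assumes "ideal I (x_ring B)"
  shows "0 \<in> I" "x \<in> I \<Longrightarrow> y \<in> I \<Longrightarrow> x + y \<in> I" "a \<in> x_polys B \<Longrightarrow> x \<in> I \<Longrightarrow> a * x \<in> I"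
    "x \<in> I \<Longrightarrow> - x \<in> I" "x \<in> I \<Longrightarrow> y \<in> I \<Longrightarrow> x - y \<in> I"
proof -
  interpret ideal I "ring_on (x_polys B)" using assms by (simp add: x_ring_eq)
  show "0 \<in> I" "x \<in> I \<Longrightarrow> y \<in> I \<Longrightarrow> x + y \<in> I" "a \<in> x_polys B \<Longrightarrow> x \<in> I \<Longrightarrow> a * x \<in> I" for x y a
    using additive_subgroup.zero_closed[OF is_additive_subgroup]
      additive_subgroup.a_closed[OF is_additive_subgroup, of x y] I_l_closed[of x a] by simp_all
  moreover have "- 1 \<in> x_polys B"
    by (rule x_polys_uminus) (simp add: x_polys_def)
  ultimately show neg: "x \<in> I \<Longrightarrow> - x \<in> I" for x
    by fastforce
  show "x \<in> I \<Longrightarrow> y \<in> I \<Longrightarrow> x - y \<in> I"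
    using additive_subgroup.a_closed[OF is_additive_subgroup, of x "- y"] neg by simp
qed

lemma ideal_genideal_x: "X \<subseteq> x_polys B \<Longrightarrow> ideal (Idl\<^bsub>x_ring B\<^esub> X) (x_ring B)"
  using ring.genideal_ideal[OF cring.axioms(1)[OF cring_x_ring]] by (auto simp: x_ring_eq)

lemma genideal_x_incl: "X \<subseteq> x_polys B \<Longrightarrow> x \<in> X \<Longrightarrow> x \<in> Idl\<^bsub>x_ring B\<^esub> X"
  using ring.genideal_self[OF cring.axioms(1)[OF cring_x_ring], of X] by (auto simp: x_ring_eq)

lemma genideal_x_least: "ideal I (x_ring B) \<Longrightarrow> X \<subseteq> I \<Longrightarrow> Idl\<^bsub>x_ring B\<^esub> X \<subseteq> I"
  by (auto simp: genideal_def)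

lemma toric_ideal_eq: "toric_ideal B = {p \<in> x_polys B. push fibre_sum p = 0}"
  by (auto simp: toric_ideal_def a_kernel_def' x_ring_eq base_ring_def toric_map_eq)

lemma toric_ideal_subset: "toric_ideal B \<subseteq> x_polys B"
  by (auto simp: toric_ideal_eq)

lemma ideal_toric_ideal: "ideal (toric_ideal B) (x_ring B)"
  by (rule ideal_x_ringI)
    (auto simp: toric_ideal_eq push_add push_mult fibre_sum_add x_polys_0 x_polys_add x_polys_mult)

text \<open>The coefficient of the image at \<open>fibre_sum m\<close> is the sum of the
  coefficients of \<open>p\<close> over one fibre. It vanishes, so the nonzero coefficient at
  \<open>m\<close> cannot be the only one there.\<close>

lemma toric_ideal_other_monomial:
  assumes "p \<in> toric_ideal B" "m \<in> keys p"
  obtains m' where "m' \<in> keys p" "m' \<noteq> m" "fibre_sum m' = fibre_sum m"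
proof -
  have "\<exists>m'\<in>keys p. m' \<noteq> m \<and> fibre_sum m' = fibre_sum m"
  proof (rule ccontr)
    assume "\<not> ?thesis"
    then have "{m'. m' \<in> keys p \<and> fibre_sum m' = fibre_sum m} = {m}" using assms(2) by auto
    then have "lookup (push fibre_sum p) (fibre_sum m) = lookup p m" by (simp add: lookup_push)
    with assms show False by (auto simp: toric_ideal_eq in_keys_iff)
  qed
  with that show ?thesis by blast
qed

lemma toric_ideal_binomial:
  assumes "m \<in> xmonoms B" "m' \<in> xmonoms B" "fibre_sum m = fibre_sum m'"
  shows "single m 1 - single m' 1 \<in> toric_ideal B"
  using assms by (auto simp: toric_ideal_eq push_diff intro!: x_polys_diff x_polys_single)

lemma toric_ideal_least:
  fixes I :: "'a::field x_poly set"
  assumes I: "ideal I (x_ring B)"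
    and bin: "\<And>m m'. m \<in> xmonoms B \<Longrightarrow> m' \<in> xmonoms B \<Longrightarrow> fibre_sum m = fibre_sum m' \<Longrightarrow>
      single m 1 - single m' 1 \<in> I"
  shows "toric_ideal B \<subseteq> I"
proof
  fix p :: "'a x_poly" assume "p \<in> toric_ideal B"
  then show "p \<in> I"
  proof (induction "card (keys p)" arbitrary: p rule: less_induct)
    case (less p)
    show ?case
    proof (cases "p = 0")
      case False
      then obtain m where m: "m \<in> keys p"
        by (metis in_keys_iff lookup_zero poly_mapping_eqI)
      then obtain m' where m': "m' \<in> keys p" "m' \<noteq> m" "fibre_sum m' = fibre_sum m"
        using toric_ideal_other_monomial less.prems by blast
      have mB: "m \<in> xmonoms B" "m' \<in> xmonoms B"
        using m m' less.prems by (auto simp: toric_ideal_eq x_polys_def)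
      \<comment> \<open>Subtracting \<open>q\<close> removes \<open>m\<close> and otherwise touches
        only \<open>m'\<close>, which is already in the support, so the support shrinks.\<close>
      define q where "q = single 0 (lookup p m) * (single m 1 - single m' 1)"
      have qI: "q \<in> I"
        unfolding q_def by (intro ideal_x_ringD(3)[OF I] bin x_polys_single) (use mB m' in auto)
      have qt: "q \<in> toric_ideal B"
        unfolding q_def by (intro ideal_x_ringD(3)[OF ideal_toric_ideal] toric_ideal_binomial x_polys_single)
          (use mB m' in auto)
      have q: "q = single m (lookup p m) - single m' (lookup p m)"
        by (simp add: q_def right_diff_distrib mult_single)
      have "lookup (p - q) k = 0" if "k \<notin> keys p - {m}" for k
        using that m m' by (auto simp: q lookup_minus lookup_single when_def in_keys_iff)
      then have "keys (p - q) \<subseteq> keys p - {m}" by (auto simp: in_keys_iff)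
      then have "card (keys (p - q)) < card (keys p)"
        using m by (meson card_Diff1_less card_mono finite_Diff finite_keys le_less_trans)
      then have "p - q \<in> I"
        using less.hyps ideal_x_ringD(5)[OF ideal_toric_ideal less.prems qt] by blast
      then show ?thesis using ideal_x_ringD(2)[OF I _ qI, of "p - q"] by simp
    qed (simp add: ideal_x_ringD(1)[OF I])
  qed
qed

lemma xvar_mult: "xvar u * xvar v = single (single u 1 + single v 1) 1"
  by (simp add: xvar_def mult_single)

lemma exchange_sum:
  assumes "lookup u i > 0" "lookup v j > (0::nat)"
  shows "(u - \<epsilon> i + \<epsilon> j) + (v - \<epsilon> j + \<epsilon> i) = u + v"
  using assms by (intro poly_mapping_eqI) (auto simp: lookup_add lookup_minus lookup_single when_def)

lemma symmetric_exchange_relations_toric: "symmetric_exchange_relations B \<subseteq> toric_ideal B"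
proof
  fix p :: "'a x_poly" assume "p \<in> symmetric_exchange_relations B"
  then obtain u v i j where
    p: "p = xvar u * xvar v - xvar (u - \<epsilon> i + \<epsilon> j) * xvar (v - \<epsilon> j + \<epsilon> i)"
    and *: "u \<in> B" "v \<in> B" "u - \<epsilon> i + \<epsilon> j \<in> B" "v - \<epsilon> j + \<epsilon> i \<in> B"
    "lookup u i > lookup v i" "lookup u j < lookup v j"
    unfolding symmetric_exchange_relations_def by blast
  have fs: "fibre_sum (single u 1 + single v 1) = (u + v) + (\<epsilon> 0 + \<epsilon> 0)" for u v
    by (simp add: fibre_sum_add add_ac)
  show "p \<in> toric_ideal B"
    unfolding p xvar_mult
    by (rule toric_ideal_binomial) (use * exchange_sum[of u i v j] in \<open>simp_all only: fs xmonoms_add, simp_all\<close>)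
qed

lemma toric_ideal_eq_genidealI:
  assumes "\<And>m m'. m \<in> xmonoms B \<Longrightarrow> m' \<in> xmonoms B \<Longrightarrow> fibre_sum m = fibre_sum m' \<Longrightarrow>
      (single m 1 - single m' 1 :: 'a::field x_poly) \<in> Idl\<^bsub>x_ring B\<^esub> (symmetric_exchange_relations B)"
  shows "(toric_ideal B :: 'a::field x_poly set) = Idl\<^bsub>x_ring B\<^esub> (symmetric_exchange_relations B)"
proof
  show "Idl\<^bsub>x_ring B\<^esub> (symmetric_exchange_relations B) \<subseteq> toric_ideal B"
    by (rule genideal_x_least[OF ideal_toric_ideal symmetric_exchange_relations_toric])
  show "(toric_ideal B :: 'a x_poly set) \<subseteq> Idl\<^bsub>x_ring B\<^esub> (symmetric_exchange_relations B)"
    by (rule toric_ideal_least[OF ideal_genideal_x])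
      (rule order_trans[OF symmetric_exchange_relations_toric toric_ideal_subset] assms | assumption)+
qed

section \<open>Exchange in discrete polymatroids\<close>

lemma vle_add_diff: "vle u v \<Longrightarrow> v = u + (v - u)"
  by (rule poly_mapping_eqI) (simp add: vle_def lookup_add lookup_minus)

lemma vle_iff_add: "vle u v \<longleftrightarrow> (\<exists>w. v = u + w)"
  using vle_add_diff by (auto simp: vle_def lookup_add)

lemma modulus_eq_0_iff [simp]: "modulus u = 0 \<longleftrightarrow> u = 0"
proof
  assume "modulus u = 0"
  then have "\<forall>i\<in>keys u. lookup u i = 0" by (simp add: modulus_def)
  then show "u = 0" by (intro poly_mapping_eqI) (auto simp: in_keys_iff)
qed simp

lemma vless_modulus: "vless u v \<Longrightarrow> modulus u < modulus v"
  by (auto simp: vless_def vle_iff_add modulus_add intro!: Nat.gr0I)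

lemma lookup_le_modulus: "lookup u i \<le> modulus u"
  by (cases "i \<in> keys u") (auto simp: modulus_def in_keys_iff intro: member_le_sum)

lemma modulus_eq_1:
  assumes "modulus r = 1"
  obtains j where "r = single j 1"
proof -
  from assms have "r \<noteq> 0" by auto
  then obtain j where j: "lookup r j \<noteq> 0"
    by (metis lookup_zero poly_mapping_eqI)
  have r: "r = (r - single j 1) + single j 1"
    using j by (intro poly_mapping_eqI) (auto simp: lookup_add lookup_minus lookup_single when_def)
  have "modulus (r - single j 1) = 0"
    using assms arg_cong[OF r, of modulus] by (simp add: modulus_add)
  then show ?thesis using r that by simp
qed

lemma lookup_exchange:
  "lookup (u - single i (Suc 0) + single j (Suc 0)) k = lookup u k - (if k = i then 1 else 0) + (if k = j then 1 else 0)"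
  by (auto simp: lookup_add lookup_minus lookup_single when_def)

lemma modulus_exchange:
  assumes "lookup u i > 0"
  shows "modulus (u - \<epsilon> i + \<epsilon> j) = modulus u"
proof -
  have "u = (u - \<epsilon> i) + \<epsilon> i"
    using assms by (intro poly_mapping_eqI) (auto simp: lookup_add lookup_minus lookup_single when_def)
  then have "modulus u = modulus (u - \<epsilon> i) + 1"
    by (metis One_nat_def modulus_add modulus_single)
  then show ?thesis by (simp add: modulus_add)
qed

locale polymatroid =
  fixes n P
  assumes dp: "discrete_polymatroid n P"
begin

lemma finite_P: "finite P"
  and P_lattice: "u \<in> P \<Longrightarrow> u \<in> lattice_vectors n"
  and P_nonempty: "P \<noteq> {}"
  using dp by (auto simp: discrete_polymatroid_def)

lemma downward_closed:
  assumes "u \<in> P" "vle v u"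
  shows "v \<in> P"
proof -
  have "keys v \<subseteq> keys u"
    using assms(2) by (fastforce simp: vle_def in_keys_iff intro: less_le_trans)
  then have "v \<in> lattice_vectors n"
    using P_lattice[OF assms(1)] by (auto simp: lattice_vectors_def)
  then show ?thesis using dp assms by (auto simp: discrete_polymatroid_def)
qed

lemma augmentation:
  assumes "u \<in> P" "v \<in> P" "modulus u < modulus v"
  obtains w where "w \<in> P" "vless u w" "\<And>i. lookup w i \<le> max (lookup u i) (lookup v i)"
proof -
  have "\<exists>w\<in>P. vless u w \<and> (\<forall>i. lookup w i \<le> max (lookup u i) (lookup v i))"
    using dp assms by (simp add: discrete_polymatroid_def)
  then obtain w where "w \<in> P" "vless u w" "\<forall>i. lookup w i \<le> max (lookup u i) (lookup v i)"
    by blast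
  then show ?thesis by (intro that[of w]) auto
qed

text \<open>The vector provided by (D2) may be several steps away; the first unit step towards it
  stays in \<open>P\<close> because \<open>P\<close> is closed downwards.\<close>

lemma augment1:
  assumes "u \<in> P" "v \<in> P" "modulus u < modulus v"
  obtains i where "lookup u i < lookup v i" "u + \<epsilon> i \<in> P"
proof -
  obtain w where w: "w \<in> P" "vless u w" "\<And>i. lookup w i \<le> max (lookup u i) (lookup v i)"
    by (rule augmentation[OF assms]) (rule that)
  from w(2) obtain i where i: "lookup u i < lookup w i"
    unfolding vless_def vle_def by (metis antisym_conv2 poly_mapping_eqI)
  then have "vle (u + \<epsilon> i) w"
    using w(2) by (auto simp: vle_def vless_def lookup_add lookup_single when_def)
  then show ?thesis
    using that[of i] i w(3)[of i] downward_closed[OF w(1)] by force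
qed

lemma augment:
  assumes "u \<in> P" "v \<in> P" "modulus u \<le> modulus v"
  obtains w where "w \<in> P" "vle u w" "\<And>i. lookup w i \<le> max (lookup u i) (lookup v i)"
    "modulus w = modulus v"
  using assms
proof (induction "modulus v - modulus u" arbitrary: u thesis)
  case 0
  then show ?case by (metis vle_def le_refl max.cobounded1 diff_is_0_eq' le_antisym zero_less_diff diff_is_0_eq)
next
  case (Suc k)
  then have "modulus u < modulus v" by simp
  with Suc obtain i where i: "lookup u i < lookup v i" "u + \<epsilon> i \<in> P"
    using augment1 by blast
  have "k = modulus v - modulus (u + \<epsilon> i)" "modulus (u + \<epsilon> i) \<le> modulus v"
    using Suc(2) by (auto simp: modulus_add)
  then obtain w where w: "w \<in> P" "vle (u + \<epsilon> i) w" "modulus w = modulus v"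
      "\<And>k. lookup w k \<le> max (lookup (u + \<epsilon> i) k) (lookup v k)"
    using Suc(1)[of "u + \<epsilon> i"] i(2) Suc.prems by blast
  have "lookup w k \<le> max (lookup u k) (lookup v k)" for k
    using w(4)[of k] i(1) by (auto simp: lookup_add lookup_single when_def split: if_splits)
  moreover have "vle u w"
    using w(2) by (auto simp: vle_def lookup_add intro: add_leD1)
  ultimately show ?case using Suc.prems(1) w by blast
qed

lemma bases_P: "u \<in> bases P \<Longrightarrow> u \<in> P"
  by (simp add: bases_def)

lemma modulus_le_base:
  assumes "u \<in> P" "v \<in> bases P"
  shows "modulus u \<le> modulus v"
proof (rule ccontr)
  assume "\<not> ?thesis"
  then obtain w where "w \<in> P" "vless v w"
    using augmentation[OF bases_P[OF assms(2)] assms(1)] by (metis not_le)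
  then show False using assms(2) by (auto simp: bases_def)
qed

lemma bases_modulus: "u \<in> bases P \<Longrightarrow> v \<in> bases P \<Longrightarrow> modulus u = modulus v"
  using modulus_le_base bases_P by (meson le_antisym)

lemma basesI: "u \<in> P \<Longrightarrow> v \<in> bases P \<Longrightarrow> modulus u = modulus v \<Longrightarrow> u \<in> bases P"
  using modulus_le_base[of _ v] vless_modulus[of u] unfolding bases_def by fastforce

lemma bases_lattice: "u \<in> bases P \<Longrightarrow> keys u \<subseteq> {1..n}"
  using P_lattice bases_P by (auto simp: lattice_vectors_def)

lemma bases_lookup_0 [simp]: "u \<in> bases P \<Longrightarrow> lookup u 0 = 0"
  using bases_lattice[of u] by (auto simp: in_keys_iff subset_iff)

lemma finite_bases: "finite (bases P)"
  using finite_P by (simp add: bases_def)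

text \<open>
  With \<open>A\<close> the set of indices at which \<open>u\<close> admits an exchange for \<open>i\<close>, lower \<open>v\<close> to \<open>u\<close> on \<open>A\<close> and
  add \<open>\<epsilon> i\<close>. If no index of \<open>A\<close> worked for \<open>v\<close>, the result \<open>x\<close> would lie outside \<open>P\<close>; but
  \<open>u - \<epsilon> i\<close> is maximal below the lowered \<open>v\<close>, which forces \<open>x\<close> into \<open>P\<close>.
\<close>

lemma symmetric_exchange:
  assumes u: "u \<in> bases P" and v: "v \<in> bases P" and i: "lookup u i > lookup v i"
  obtains j where "lookup u j < lookup v j" "u - \<epsilon> i + \<epsilon> j \<in> bases P" "v - \<epsilon> j + \<epsilon> i \<in> bases P"
proof -
  define A where "A = {j. lookup u j < lookup v j \<and> u - \<epsilon> i + \<epsilon> j \<in> P}"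
  have uP: "u \<in> P" and vP: "v \<in> P" using u v bases_P by auto
  have uv: "modulus u = modulus v" using bases_modulus[OF u v] .
  have iA: "i \<notin> A" using i by (auto simp: A_def)
  have "\<exists>j\<in>A. v - \<epsilon> j + \<epsilon> i \<in> P"
  proof (rule ccontr)
    assume none: "\<not> ?thesis"
    define v' where "v' = Poly_Mapping.mapp (\<lambda>j c. if j \<in> A then lookup u j else c) v"
    have v': "lookup v' j = (if j \<in> A then lookup u j else lookup v j)" for j
      by (auto simp: v'_def lookup_mapp when_def A_def in_keys_iff)
    have v'v: "vle v' v" by (auto simp: vle_def v' A_def)
    have v'P: "v' \<in> P" using downward_closed[OF vP v'v] .
    define x where "x = v' + \<epsilon> i"
    have x: "lookup x j = lookup v' j + (if j = i then 1 else 0)" for j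
      by (auto simp: x_def lookup_add lookup_single when_def)
    \<comment> \<open>Completed to a base inside \<open>v + \<epsilon> i\<close>, the vector
      \<open>x\<close> would give a \<open>w\<close> that misses \<open>v + \<epsilon> i\<close> by
      one unit at some \<open>j\<close>. As \<open>x\<close> agrees with
      \<open>v + \<epsilon> i\<close> off \<open>A\<close>, this \<open>j\<close> lies in
      \<open>A\<close>, against \<open>none\<close>.\<close>
    have "x \<notin> P"
    proof
      assume xP: "x \<in> P"
      obtain w where w: "w \<in> P" "vle x w" "\<And>i. lookup w i \<le> max (lookup x i) (lookup v i)"
        "modulus w = modulus v"
        by (rule augment[OF xP vP modulus_le_base[OF xP v]]) (rule that)
      have "lookup w k \<le> lookup (v + \<epsilon> i) k" for k
        using w(3)[of k] v'v[unfolded vle_def, rule_format, of k]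
        by (cases "k = i") (auto simp: x lookup_add lookup_single)
      then have "vle w (v + \<epsilon> i)" by (simp add: vle_def)
      then obtain r where r: "v + \<epsilon> i = w + r" by (auto simp: vle_iff_add)
      have "modulus r = 1" using w(4) arg_cong[OF r, of modulus] by (simp add: modulus_add)
      then obtain j where j: "r = \<epsilon> j" using modulus_eq_1 by blast
      have r': "lookup v k + (if k = i then 1 else 0) = lookup w k + (if k = j then 1 else 0)" for k
        using arg_cong[OF r, of "\<lambda>w. lookup w k"] by (auto simp: j lookup_add lookup_single when_def)
      have xw: "lookup x k \<le> lookup w k" for k using w(2) by (simp add: vle_def)
      have ji: "j \<noteq> i" using r'[of i] xw[of i] iA by (auto simp: x v')
      have jA: "j \<in> A" using r'[of j] xw[of j] ji by (auto simp: x v' split: if_splits)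
      have "w = v - \<epsilon> j + \<epsilon> i"
      proof (rule poly_mapping_eqI)
        fix k show "lookup w k = lookup (v - \<epsilon> j + \<epsilon> i) k"
          using r'[of k] ji by (auto simp: lookup_exchange)
      qed
      then show False using none jA w(1) by auto
    qed
    define q where "q = u - \<epsilon> i"
    have q: "lookup q j = lookup u j - (if j = i then 1 else 0)" for j
      by (auto simp: q_def lookup_minus lookup_single when_def)
    have qu: "u = q + \<epsilon> i"
      using i by (intro poly_mapping_eqI) (auto simp: q lookup_add lookup_single when_def)
    have qm: "modulus u = modulus q + 1" unfolding qu by (simp add: modulus_add)
    have qP: "q \<in> P" by (rule downward_closed[OF uP]) (auto simp: vle_def q)
    \<comment> \<open>An index \<open>k\<close> at which \<open>q\<close> could grow towards
      \<open>v'\<close> would differ from \<open>i\<close> and admit an exchange for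
      \<open>i\<close> in \<open>u\<close>, so it would lie in \<open>A\<close>; but on
      \<open>A\<close> the vectors \<open>v'\<close> and \<open>q\<close> agree.\<close>
    have max: "modulus y \<le> modulus q" if "y \<in> P" "\<And>k. lookup y k \<le> max (lookup q k) (lookup v' k)" for y
    proof (rule ccontr)
      assume "\<not> ?thesis"
      then obtain k where k: "lookup q k < lookup y k" "q + \<epsilon> k \<in> P"
        using augment1[OF qP \<open>y \<in> P\<close>] by auto
      then have "lookup q k < lookup v' k" using that(2)[of k] by auto
      moreover have "k \<notin> A" "k \<noteq> i"
        using calculation iA i by (auto simp: q v' split: if_splits)
      moreover have "u - \<epsilon> i + \<epsilon> k \<in> P" using k(2) by (simp add: q_def)
      ultimately show False by (auto simp: A_def v' q)
    qed
    obtain q' where q': "q' \<in> P" "vle v' q'" "modulus q' = modulus q"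
      "\<And>k. lookup q' k \<le> max (lookup v' k) (lookup q k)"
      using augment[OF v'P qP max[OF v'P]] by auto
    \<comment> \<open>\<open>u\<close> exceeds \<open>q\<close> only at \<open>i\<close>, so a step
      from \<open>q'\<close> towards \<open>u\<close> at any other index would stay below the
      maximum of \<open>q\<close> and \<open>v'\<close> and contradict \<open>max\<close>.\<close>
    obtain k where k: "lookup q' k < lookup u k" "q' + \<epsilon> k \<in> P"
      using augment1[OF q'(1) uP] qm q'(3) by auto
    have "k = i"
    proof (rule ccontr)
      assume "k \<noteq> i"
      have "modulus (q' + \<epsilon> k) \<le> modulus q"
      proof (rule max[OF k(2)])
        fix l show "lookup (q' + \<epsilon> k) l \<le> max (lookup q l) (lookup v' l)"
          using q'(4)[of l] k(1) \<open>k \<noteq> i\<close> by (auto simp: lookup_add lookup_single when_def q)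
      qed
      then show False using q'(3) by (simp add: modulus_add)
    qed
    then have "x \<in> P"
      using k(2) q'(2) by (intro downward_closed[OF k(2)]) (auto simp: vle_def x_def lookup_add)
    with \<open>x \<notin> P\<close> show False ..
  qed
  then obtain j where "lookup u j < lookup v j" "u - \<epsilon> i + \<epsilon> j \<in> P" "v - \<epsilon> j + \<epsilon> i \<in> P"
    by (auto simp: A_def)
  then show ?thesis
    using that[of j] i basesI[OF _ u] uv modulus_exchange[of u i j] modulus_exchange[of v j i] by auto
qed

end

section \<open>Reduction to matroids\<close>

lemma symmetric_exchange_x_polys: "symmetric_exchange_relations B \<subseteq> x_polys B"
  using symmetric_exchange_relations_toric toric_ideal_subset by (rule order_trans)

definition exchange_ideal :: "expvec set \<Rightarrow> 'a::field x_poly set" where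
  "exchange_ideal B = Idl\<^bsub>x_ring B\<^esub> (symmetric_exchange_relations B)"

lemma ideal_exchange_ideal: "ideal (exchange_ideal B) (x_ring B)"
  unfolding exchange_ideal_def by (rule ideal_genideal_x[OF symmetric_exchange_x_polys])

lemmas exchange_idealD = ideal_x_ringD[OF ideal_exchange_ideal]

lemma exchange_relation:
  assumes "u \<in> B" "v \<in> B" "lookup u i > lookup v i" "lookup u j < lookup v j"
    "u - \<epsilon> i + \<epsilon> j \<in> B" "v - \<epsilon> j + \<epsilon> i \<in> B"
  shows "xvar u * xvar v - xvar (u - \<epsilon> i + \<epsilon> j) * xvar (v - \<epsilon> j + \<epsilon> i) \<in> exchange_ideal B"
  unfolding exchange_ideal_def
  by (rule genideal_x_incl[OF symmetric_exchange_x_polys])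
    (use assms in \<open>auto simp: symmetric_exchange_relations_def\<close>)

lemma exchange_ideal_trans:
  "p - q \<in> exchange_ideal B \<Longrightarrow> q - r \<in> exchange_ideal B \<Longrightarrow> p - r \<in> exchange_ideal B"
  using exchange_idealD(2)[of "p - q" B "q - r"] by simp

lemma exchange_ideal_sym: "p - q \<in> exchange_ideal B \<Longrightarrow> q - p \<in> exchange_ideal B"
  using exchange_idealD(4)[of "p - q" B] by simp

lemma exchange_eqs:
  assumes "u' = u - \<epsilon> a + \<epsilon> b" "lookup u a > 0"
  shows "u = u' - \<epsilon> b + \<epsilon> a"
  using assms(2) by (intro poly_mapping_eqI) (auto simp: assms(1) lookup_exchange)

section \<open>Exchanges that lack the inequalities\<close>

context polymatroid
begin

text \<open>The inequalities fail for this exchange and for its inverse. But \<open>u'\<close> has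
  fewer units than \<open>v'\<close> at \<open>a\<close>, so \<open>symmetric_exchange\<close> moves
  a unit at \<open>a\<close> back from \<open>v'\<close> in return for one at a new index
  \<open>c\<close>. The resulting pair also arises from \<open>(u, v)\<close> by exchanging
  \<open>b\<close> and \<open>c\<close>, and both steps are genuine relations.\<close>

lemma exchange_detour:
  assumes "u \<in> bases P" "v \<in> bases P" and a: "lookup u a > 0"
    and u': "u - \<epsilon> a + \<epsilon> b \<in> bases P" and v': "v - \<epsilon> b + \<epsilon> a \<in> bases P"
    and le: "lookup u a \<le> lookup v a" "lookup u b + 2 \<le> lookup v b" and ab: "a \<noteq> b"
  shows "xvar u * xvar v - xvar (u - \<epsilon> a + \<epsilon> b) * xvar (v - \<epsilon> b + \<epsilon> a) \<in> exchange_ideal (bases P)"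
proof -
  define u' v' where "u' = u - \<epsilon> a + \<epsilon> b" and "v' = v - \<epsilon> b + \<epsilon> a"
  have "lookup u' a < lookup v' a"
    using a le ab by (auto simp: u'_def v'_def lookup_exchange)
  then obtain c where c: "lookup v' c < lookup u' c"
    "v' - \<epsilon> a + \<epsilon> c \<in> bases P" "u' - \<epsilon> c + \<epsilon> a \<in> bases P"
    by (rule symmetric_exchange[rotated 2]) (use u' v' in \<open>simp_all add: u'_def v'_def\<close>)
  have ca: "c \<noteq> a" using c(1) \<open>lookup u' a < lookup v' a\<close> by auto
  \<comment> \<open>The gap of 2 at \<open>b\<close> enters here: even after the exchange,
    \<open>v'\<close> has at least as many units as \<open>u'\<close> at \<open>b\<close>.\<close>
  have cb: "c \<noteq> b"
    using c(1) le ab by (auto simp: u'_def v'_def lookup_exchange)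
  have uc: "lookup v c < lookup u c"
    using c(1) ca cb by (auto simp: u'_def v'_def lookup_exchange)
  have eqs: "v' - \<epsilon> a + \<epsilon> c = v - \<epsilon> b + \<epsilon> c" "u' - \<epsilon> c + \<epsilon> a = u - \<epsilon> c + \<epsilon> b"
    by (rule poly_mapping_eqI, use a le ca cb ab uc in \<open>auto simp: u'_def v'_def lookup_exchange\<close>)+
  have "xvar v * xvar u - xvar (v - \<epsilon> b + \<epsilon> c) * xvar (u - \<epsilon> c + \<epsilon> b) \<in> exchange_ideal (bases P)"
    by (rule exchange_relation) (use assms c uc eqs le in auto)
  moreover have "xvar v' * xvar u' - xvar (v' - \<epsilon> a + \<epsilon> c) * xvar (u' - \<epsilon> c + \<epsilon> a) \<in> exchange_ideal (bases P)"
    by (rule exchange_relation) (use c \<open>lookup u' a < lookup v' a\<close> u' v' in \<open>auto simp: u'_def v'_def\<close>)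
  ultimately show ?thesis
    unfolding eqs by (metis u'_def v'_def exchange_ideal_sym exchange_ideal_trans mult.commute)
qed

text \<open>
  Projecting an exchange in a matroid to the polymatroid loses the inequalities that a symmetric
  exchange relation requires.
\<close>

lemma exchange_without_inequalities:
  assumes uv: "u \<in> bases P" "v \<in> bases P" and ab: "lookup u a > 0" "lookup v b > 0"
    and u': "u - \<epsilon> a + \<epsilon> b \<in> bases P" and v': "v - \<epsilon> b + \<epsilon> a \<in> bases P"
  shows "xvar u * xvar v - xvar (u - \<epsilon> a + \<epsilon> b) * xvar (v - \<epsilon> b + \<epsilon> a) \<in> exchange_ideal (bases P)"
proof (cases "a = b")
  case True
  then have "u - \<epsilon> a + \<epsilon> b = u" "v - \<epsilon> b + \<epsilon> a = v"
    using ab by (auto intro!: poly_mapping_eqI simp: lookup_exchange)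
  then show ?thesis by (simp add: exchange_idealD(1))
next
  case False
  consider "lookup v a < lookup u a" "lookup u b < lookup v b"
    | "lookup u a < lookup v a + 2" "lookup v b < lookup u b + 2"
    | "lookup u a \<le> lookup v a" "lookup u b + 2 \<le> lookup v b"
    | "lookup v b \<le> lookup u b" "lookup v a + 2 \<le> lookup u a"
    by linarith
  then show ?thesis
  proof cases
    case 1
    then show ?thesis by (intro exchange_relation) (use uv u' v' in auto)
  next
    case 2
    define u'' v'' where "u'' = u - \<epsilon> a + \<epsilon> b" and "v'' = v - \<epsilon> b + \<epsilon> a"
    have eqs: "u = u'' - \<epsilon> b + \<epsilon> a" "v = v'' - \<epsilon> a + \<epsilon> b"
      by (fact exchange_eqs[OF u''_def ab(1)] exchange_eqs[OF v''_def ab(2)])+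
    have "xvar u'' * xvar v'' - xvar (u'' - \<epsilon> b + \<epsilon> a) * xvar (v'' - \<epsilon> a + \<epsilon> b) \<in> exchange_ideal (bases P)"
    proof (rule exchange_relation)
      show "lookup v'' b < lookup u'' b" "lookup u'' a < lookup v'' a"
        using 2 False ab by (auto simp: u''_def v''_def lookup_exchange)
      show "u'' \<in> bases P" "v'' \<in> bases P"
        using u' v' by (simp_all add: u''_def v''_def)
    qed (use uv in \<open>simp_all flip: eqs One_nat_def\<close>)
    from exchange_ideal_sym[OF this] show ?thesis
      unfolding eqs[symmetric] unfolding u''_def v''_def .
  next
    case 3
    then show ?thesis using exchange_detour[OF uv ab(1) u' v'] False by simp
  next
    case 4
    then show ?thesis using exchange_detour[OF uv(2,1) ab(2) v' u'] False by (simp add: mult.commute)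
  qed
qed

end

text \<open>
  The matroid lives on \<open>N\<close> copies of every element of \<open>{1..n}\<close>: the index \<open>c * n + a\<close> with
  \<open>a \<in> {1..n}\<close> and \<open>c < N\<close> is the \<open>c\<close>-th copy of \<open>a\<close>.
\<close>

definition copy_of :: "nat \<Rightarrow> nat \<Rightarrow> nat" where
  "copy_of n k = (k - 1) mod n + 1"

lemma copy_of: "a \<in> {1..n} \<Longrightarrow> copy_of n (c * n + a) = a"
  using mod_mult_self1[of "a - 1" c n] by (auto simp: copy_of_def add.commute)

lemma copy_le: "(a::nat) \<in> {1..n} \<Longrightarrow> c < N \<Longrightarrow> c * n + a \<in> {1..n * N}"
proof -
  assume a: "a \<in> {1..n}" "c < N"
  then have "(c + 1) * n \<le> N * n" by (metis Suc_eq_plus1 Suc_leI mult_le_mono1)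
  then show ?thesis using a by (auto simp: algebra_simps)
qed

definition forget :: "nat \<Rightarrow> expvec \<Rightarrow> expvec" where
  "forget n = lin_ext (\<lambda>k. \<epsilon> (copy_of n k))"

lemma forget_0 [simp]: "forget n 0 = 0"
  and forget_add: "forget n (F + G) = forget n F + forget n G"
  and forget_single [simp]: "forget n (single k (Suc 0)) = \<epsilon> (copy_of n k)"
  by (auto simp: forget_def lin_ext_add)

lemma modulus_forget: "modulus (forget n F) = modulus F"
  using lin_ext_unique[of "\<lambda>F. modulus (forget n F)" F]
  by (simp add: forget_add modulus_add modulus_eq[of F])

lemma lookup_forget: "lookup (forget n F) a = (\<Sum>k | k \<in> keys F \<and> copy_of n k = a. lookup F k)"
  unfolding forget_def lookup_lin_ext unfolding lin_ext_def
  by (auto simp: lookup_single when_def sum.inter_filter intro!: sum.cong)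

lemma forget_exchange:
  assumes "lookup F i > 0"
  shows "forget n (F - \<epsilon> i + \<epsilon> j) = forget n F - \<epsilon> (copy_of n i) + \<epsilon> (copy_of n j)"
proof -
  have "F = (F - \<epsilon> i) + \<epsilon> i"
    using assms by (intro poly_mapping_eqI) (auto simp: lookup_add lookup_minus lookup_single when_def)
  then have "forget n F = forget n (F - \<epsilon> i) + \<epsilon> (copy_of n i)"
    by (metis One_nat_def forget_add forget_single)
  then show ?thesis by (simp add: forget_add)
qed

lemma forget_mono: "vle F G \<Longrightarrow> vle (forget n F) (forget n G)"
  by (auto simp: vle_iff_add forget_add)

definition expansion :: "nat \<Rightarrow> nat \<Rightarrow> expvec set \<Rightarrow> expvec set" where
  "expansion n N P = {F \<in> lattice_vectors (n * N). (\<forall>k. lookup F k \<le> 1) \<and> forget n F \<in> P}"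

lemma expansionD: "F \<in> expansion n N P \<Longrightarrow> forget n F \<in> P"
  by (simp add: expansion_def)

lemma (in polymatroid) expansion_add:
  assumes F: "F \<in> expansion n N P" and k: "k \<in> {1..n * N}" "lookup F k = 0"
    and P: "forget n F + \<epsilon> (copy_of n k) \<in> P"
  shows "F + \<epsilon> k \<in> expansion n N P"
  using assms keys_plus_nat[of F "\<epsilon> k"]
  by (auto simp: expansion_def lattice_vectors_def forget_add lookup_add lookup_single when_def)

text \<open>Augmentation of the count vectors in \<open>P\<close> names an element \<open>a\<close>;
  since \<open>G\<close> contains more copies of \<open>a\<close> than \<open>F\<close>, some copy
  lies in \<open>G\<close> and not in \<open>F\<close>.\<close>

lemma (in polymatroid) matroid_expansion: "matroid (n * N) (expansion n N P)"
proof -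
  let ?M = "expansion n N P"
  have zero: "0 \<in> P" using P_nonempty downward_closed by (auto simp: vle_def)
  have "\<exists>w\<in>?M. vless F w \<and> (\<forall>i. lookup w i \<le> max (lookup F i) (lookup G i))"
    if FG: "F \<in> ?M" "G \<in> ?M" "modulus G > modulus F" for F G
  proof -
    obtain a where a: "lookup (forget n F) a < lookup (forget n G) a" "forget n F + \<epsilon> a \<in> P"
      using augment1[of "forget n F" "forget n G"] FG expansionD by (metis modulus_forget)
    have "\<exists>k. copy_of n k = a \<and> lookup F k < lookup G k"
    proof (rule ccontr)
      assume "\<not> ?thesis"
      then have le: "\<And>k. copy_of n k = a \<Longrightarrow> lookup G k \<le> lookup F k" by (auto simp: not_less)
      have "lookup (forget n G) a \<le> (\<Sum>k | k \<in> keys G \<and> copy_of n k = a. lookup F k)"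
        unfolding lookup_forget by (rule sum_mono) (use le in auto)
      also have "\<dots> \<le> lookup (forget n F) a"
        unfolding lookup_forget
        by (rule sum_mono2) (use le in \<open>force simp: in_keys_iff\<close>)+
      finally show False using a(1) by simp
    qed
    then obtain k where k: "copy_of n k = a" "lookup F k < lookup G k" by blast
    have "lookup G k \<le> 1" "k \<in> {1..n * N}"
      using FG(2) k(2) by (auto simp: expansion_def lattice_vectors_def in_keys_iff subset_iff)
    then have "F + \<epsilon> k \<in> ?M"
      by (intro expansion_add) (use FG k a in auto)
    moreover have "vless F (F + \<epsilon> k)"
      by (auto simp: vless_def vle_def lookup_add dest!: arg_cong[of _ _ "\<lambda>w. lookup w k"])
    moreover have "lookup (F + \<epsilon> k) i \<le> max (lookup F i) (lookup G i)" for i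
      using k(2) by (auto simp: lookup_add lookup_single when_def)
    ultimately show ?thesis by blast
  qed
  moreover have "finite ?M"
  proof (rule finite_imageD)
    show "finite (keys ` ?M)"
      by (rule finite_subset[of _ "Pow {1..n * N}"]) (auto simp: expansion_def lattice_vectors_def)
    show "inj_on keys ?M"
    proof (rule inj_onI, rule poly_mapping_eqI)
      fix F G k assume FG: "F \<in> ?M" "G \<in> ?M" "keys F = keys G"
      have "lookup F k \<le> 1" "lookup G k \<le> 1" using FG by (auto simp: expansion_def)
      moreover have "lookup F k = 0 \<longleftrightarrow> lookup G k = 0" using FG(3) by (auto simp: in_keys_iff)
      ultimately show "lookup F k = lookup G k" by linarith
    qed
  qed
  moreover have "v \<in> ?M" if "u \<in> ?M" "v \<in> lattice_vectors (n * N)" "vle v u" for u v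
    using that forget_mono[OF that(3), of n] downward_closed[OF expansionD[OF that(1)]]
    by (auto simp: expansion_def vle_def intro: order_trans)
  moreover have "0 \<in> ?M" using zero by (auto simp: expansion_def lattice_vectors_def)
  moreover have "lookup u i \<in> {0, 1}" if "u \<in> ?M" for u i
    using that by (auto simp: expansion_def dest!: spec[of _ i])
  moreover have "?M \<subseteq> lattice_vectors (n * N)" by (auto simp: expansion_def)
  ultimately show ?thesis
    unfolding matroid_def discrete_polymatroid_def by (intro conjI ballI impI allI) blast+
qed

lemma (in polymatroid) bases_expansion:
  assumes N: "\<And>u a. u \<in> P \<Longrightarrow> lookup u a \<le> N"
  shows "bases (expansion n N P) = {F \<in> expansion n N P. forget n F \<in> bases P}"
proof (intro equalityI subsetI)
  fix F assume F: "F \<in> bases (expansion n N P)"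
  then have FM: "F \<in> expansion n N P" by (auto simp: bases_def)
  have "forget n F \<in> bases P"
  proof (rule ccontr)
    assume "forget n F \<notin> bases P"
    then obtain v where v: "v \<in> P" "vless (forget n F) v"
      using expansionD[OF FM] by (auto simp: bases_def)
    then obtain a where a: "lookup (forget n F) a < lookup v a" "forget n F + \<epsilon> a \<in> P"
      using augment1[OF expansionD[OF FM]] vless_modulus by metis
    have an: "a \<in> {1..n}"
      using a P_lattice[OF v(1)] by (auto simp: lattice_vectors_def in_keys_iff subset_iff)
    have "\<exists>c<N. lookup F (c * n + a) = 0"
    proof (rule ccontr)
      assume "\<not> ?thesis"
      then have "(\<lambda>c. c * n + a) ` {..<N} \<subseteq> {k. k \<in> keys F \<and> copy_of n k = a}"
        using copy_of[OF an] by (auto simp: in_keys_iff)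
      then have "card ((\<lambda>c. c * n + a) ` {..<N}) \<le> card {k. k \<in> keys F \<and> copy_of n k = a}"
        by (intro card_mono) auto
      then have "N \<le> card {k. k \<in> keys F \<and> copy_of n k = a}"
        using an by (subst (asm) card_image) (auto simp: inj_on_def)
      also have "\<dots> \<le> lookup (forget n F) a"
        unfolding lookup_forget card_eq_sum by (rule sum_mono) (auto simp: in_keys_iff)
      finally show False using a(1) N[OF v(1), of a] by simp
    qed
    then obtain c where c: "c < N" "lookup F (c * n + a) = 0" by blast
    have "F + \<epsilon> (c * n + a) \<in> expansion n N P"
      by (rule expansion_add[OF FM copy_le[OF an c(1)] c(2)]) (use a in \<open>simp add: copy_of[OF an]\<close>)
    moreover have "vless F (F + \<epsilon> (c * n + a))"
      by (auto simp: vless_def vle_def lookup_add dest!: arg_cong[of _ _ "\<lambda>w. lookup w (c * n + a)"])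
    ultimately show False using F by (auto simp: bases_def)
  qed
  with FM show "F \<in> {F \<in> expansion n N P. forget n F \<in> bases P}" by simp
next
  fix F assume F: "F \<in> {F \<in> expansion n N P. forget n F \<in> bases P}"
  then have "\<not> vless F G" if "G \<in> expansion n N P" for G
    using vless_modulus[of F G] modulus_le_base[OF expansionD[OF that], of "forget n F"]
    by (auto simp: modulus_forget)
  with F show "F \<in> bases (expansion n N P)" by (auto simp: bases_def)
qed

text \<open>
  A vector lifts to a block of consecutive copies of every index, starting at the offset \<open>b\<close>. Lifting the factors
  of a monomial consecutively makes the total depend on the sum of the factors only.
\<close>

definition lift_from :: "nat \<Rightarrow> expvec \<Rightarrow> expvec \<Rightarrow> expvec" where
  "lift_from n b u = (\<Sum>a\<in>{1..n}. \<Sum>c\<in>{lookup b a..<lookup b a + lookup u a}. \<epsilon> (c * n + a))"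

lemma lift_from_0 [simp]: "lift_from n b 0 = 0"
  by (simp add: lift_from_def)

lemma lift_from_add: "lift_from n b (u + v) = lift_from n b u + lift_from n (b + u) v"
  unfolding lift_from_def sum.distrib[symmetric] lookup_add
  by (rule sum.cong[OF refl], subst sum.atLeastLessThan_concat) (auto simp: add_ac)

lemma forget_sum: "forget n (sum f A) = (\<Sum>x\<in>A. forget n (f x))"
  by (induction A rule: infinite_finite_induct) (auto simp: forget_add)

lemma forget_lift_from:
  assumes "u \<in> lattice_vectors n"
  shows "forget n (lift_from n b u) = u"
proof -
  have "forget n (lift_from n b u) = (\<Sum>a\<in>{1..n}. \<Sum>c\<in>{lookup b a..<lookup b a + lookup u a}. \<epsilon> a)"
    unfolding lift_from_def forget_sum by (intro sum.cong refl) (simp add: copy_of)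
  also have "\<dots> = u"
  proof (rule poly_mapping_eqI)
    fix k
    have "lookup u k = 0" if "k \<notin> {1..n}" using that assms by (auto simp: lattice_vectors_def in_keys_iff)
    moreover have "lookup (\<Sum>c\<in>{lookup b a..<lookup b a + lookup u a}. \<epsilon> a) k =
        (if a = k then lookup u a else 0)" for a
      unfolding lookup_sum by (cases "a = k") (auto simp: lookup_single_not_eq)
    ultimately show "lookup (\<Sum>a\<in>{1..n}. \<Sum>c\<in>{lookup b a..<lookup b a + lookup u a}. \<epsilon> a) k = lookup u k"
      unfolding lookup_sum[of _ "{1..n}"] by (simp del: sum_constant)
  qed
  finally show ?thesis .
qed

text \<open>Distinct pairs of an element and a copy number give distinct indices, so a block is a
  (0,1)-vector; the bound keeps it within the \<open>N\<close> available copies.\<close>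

lemma lift_from_expansion:
  assumes u: "u \<in> lattice_vectors n" "u \<in> P" and N: "\<And>a. lookup b a + lookup u a \<le> N"
  shows "lift_from n b u \<in> expansion n N P"
proof -
  let ?I = "SIGMA a:{1..n}. {lookup b a..<lookup b a + lookup u a}"
  have eq: "lift_from n b u = (\<Sum>(a, c)\<in>?I. \<epsilon> (c * n + a))"
    unfolding lift_from_def by (subst sum.Sigma) auto
  have inj: "inj_on (\<lambda>(a, c). c * n + a) ?I"
  proof (rule inj_onI, clarsimp)
    fix a c a' c' assume *: "Suc 0 \<le> a" "a \<le> n" "Suc 0 \<le> a'" "a' \<le> n" "c * n + a = c' * n + a'"
    then have "a = a'" using copy_of[of a n c] copy_of[of a' n c'] by auto
    with * show "a = a' \<and> c = c'" by auto
  qed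
  have "lookup (lift_from n b u) k \<le> 1" for k
  proof -
    have "lookup (lift_from n b u) k = card {x \<in> ?I. (\<lambda>(a, c). c * n + a) x = k}"
      by (simp add: eq lookup_sum lookup_single when_def case_prod_unfold sum.If_cases Int_def)
    also have "\<dots> \<le> 1"
    proof -
      have "finite {x \<in> ?I. (\<lambda>(a, c). c * n + a) x = k}" by auto
      from card_le_Suc0_iff_eq[OF this] show ?thesis
        using inj unfolding inj_on_def by (simp only: One_nat_def) blast
    qed
    finally show ?thesis .
  qed
  moreover have "keys (lift_from n b u) \<subseteq> {1..n * N}"
  proof
    fix k assume "k \<in> keys (lift_from n b u)"
    then have "(\<Sum>x\<in>?I. lookup (\<epsilon> (snd x * n + fst x)) k) \<noteq> 0"
      by (simp add: eq lookup_sum in_keys_iff case_prod_unfold)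
    then obtain x where x: "x \<in> ?I" "lookup (\<epsilon> (snd x * n + fst x)) k \<noteq> 0"
      by (meson sum.neutral)
    then have k: "k = snd x * n + fst x" by (auto simp: lookup_single when_def split: if_splits)
    show "k \<in> {1..n * N}"
      unfolding k by (rule copy_le) (use x(1) N[of "fst x"] in auto)
  qed
  ultimately show ?thesis
    using u forget_lift_from[OF u(1)] by (auto simp: expansion_def lattice_vectors_def)
qed

definition vsum :: "xmonom \<Rightarrow> expvec" where
  "vsum = lin_ext (\<lambda>u. u)"

lemma vsum_0 [simp]: "vsum 0 = 0"
  and vsum_add: "vsum (m + m') = vsum m + vsum m'"
  and vsum_single [simp]: "vsum (single u (Suc 0)) = u"
  by (auto simp: vsum_def lin_ext_add)

lemma fibre_sum_eq: "fibre_sum m = vsum m + single 0 (modulus m)"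
  by (induction m rule: exponent_induct)
    (auto simp: fibre_sum_add vsum_add modulus_add add_ac simp flip: single_add)

definition forget_monom :: "nat \<Rightarrow> xmonom \<Rightarrow> xmonom" where
  "forget_monom n = lin_ext (\<lambda>F. single (forget n F) 1)"

lemma forget_monom_0 [simp]: "forget_monom n 0 = 0"
  and forget_monom_add: "forget_monom n (m + m') = forget_monom n m + forget_monom n m'"
  and forget_monom_single [simp]: "forget_monom n (single F (Suc 0)) = single (forget n F) 1"
  by (auto simp: forget_monom_def lin_ext_add)

context polymatroid
begin

lemma vsum_keys: "m \<in> xmonoms (bases P) \<Longrightarrow> keys (vsum m) \<subseteq> {1..n}"
  by (induction m rule: exponent_induct) (use bases_lattice in \<open>auto simp: vsum_add keys_plus_nat\<close>)

text \<open>Bases vanish at entry 0, so that entry of \<open>fibre_sum m\<close>, the exponent of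
  \<open>s\<close>, is exactly the degree and can be split off.\<close>

lemma fibre_sum_eq_iff:
  assumes "m \<in> xmonoms (bases P)" "m' \<in> xmonoms (bases P)"
  shows "fibre_sum m = fibre_sum m' \<longleftrightarrow> vsum m = vsum m' \<and> modulus m = modulus m'"
proof
  assume eq: "fibre_sum m = fibre_sum m'"
  have "lookup (fibre_sum m) 0 = modulus m" if "m \<in> xmonoms (bases P)" for m
    using vsum_keys[OF that] by (auto simp: fibre_sum_eq lookup_add in_keys_iff subset_iff)
  then have "modulus m = modulus m'" using assms eq by metis
  then show "vsum m = vsum m' \<and> modulus m = modulus m'"
    using eq by (simp add: fibre_sum_eq)
qed (simp add: fibre_sum_eq)

lemma lift_monomial:
  assumes N: "\<And>u a. u \<in> P \<Longrightarrow> lookup u a \<le> N"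
    and m: "m \<in> xmonoms (bases P)" "\<And>a. lookup (vsum m) a \<le> N"
  obtains M where "M \<in> xmonoms (bases (expansion n N P))" "forget_monom n M = m"
    "vsum M = lift_from n 0 (vsum m)" "modulus M = modulus m"
proof -
  have "\<exists>M\<in>xmonoms (bases (expansion n N P)). forget_monom n M = m \<and>
      vsum M = lift_from n 0 (vsum m) \<and> modulus M = modulus m"
    using m
  proof (induction m rule: exponent_induct)
    case (add m u)
    have b: "lookup (vsum m) a + lookup u a \<le> N" for a
      using add.prems(2)[of a] by (simp add: vsum_add lookup_add)
    have "\<exists>M\<in>xmonoms (bases (expansion n N P)). forget_monom n M = m \<and>
        vsum M = lift_from n 0 (vsum m) \<and> modulus M = modulus m"
      by (rule add.IH) (use add.prems(1) add_leD1[OF b] in auto)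
    then obtain M where M: "M \<in> xmonoms (bases (expansion n N P))" "forget_monom n M = m"
      "vsum M = lift_from n 0 (vsum m)" "modulus M = modulus m"
      by blast
    \<comment> \<open>The offset is the sum of the factors lifted so far; by
      \<open>lift_from_add\<close> all blocks together make up the block of the total sum.\<close>
    let ?F = "lift_from n (vsum m) u"
    have u: "u \<in> bases P" using add.prems by simp
    then have "?F \<in> bases (expansion n N P)"
      using lift_from_expansion[OF P_lattice bases_P b] forget_lift_from[OF P_lattice] bases_P[OF u]
      by (simp add: bases_expansion[OF N])
    then show ?case
      using M forget_lift_from[OF P_lattice[OF bases_P[OF u]]]
      by (intro bexI[of _ "M + single ?F 1"])
        (auto simp: forget_monom_add vsum_add modulus_add lift_from_add)
  qed auto
  then show ?thesis using that by blast
qed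

text \<open>The polynomials that are mapped into the exchange ideal form an ideal, so only the
  generators matter, and these become exchanges without inequalities.\<close>

lemma forget_exchange_ideal:
  assumes N: "\<And>u a. u \<in> P \<Longrightarrow> lookup u a \<le> N"
  shows "push (forget_monom n) ` exchange_ideal (bases (expansion n N P)) \<subseteq> exchange_ideal (bases P)"
proof -
  let ?B = "bases (expansion n N P)" and ?f = "push (forget_monom n)"
  have hom: "?f (p * q) = ?f p * ?f q" for p q :: "'a::field x_poly"
    by (rule push_mult) (rule forget_monom_add)
  have mem: "forget_monom n M \<in> xmonoms (bases P)" if "M \<in> xmonoms ?B" for M
    using that by (induction M rule: exponent_induct)
      (auto simp: forget_monom_add bases_expansion[OF N])
  have closed: "?f p \<in> x_polys (bases P)" if "p \<in> x_polys ?B" for p :: "'a x_poly"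
    using keys_push[of "forget_monom n" p] that mem by (fastforce simp: x_polys_def)
  have var: "?f (xvar F :: 'a x_poly) = xvar (forget n F)" for F
    by (simp add: xvar_def)
  let ?I = "{p \<in> x_polys ?B. ?f p \<in> (exchange_ideal (bases P) :: 'a x_poly set)}"
  have "ideal ?I (x_ring ?B)"
    by (rule ideal_x_ringI)
      (auto simp: x_polys_0 x_polys_add x_polys_mult push_add hom exchange_idealD closed)
  moreover have "symmetric_exchange_relations ?B \<subseteq> ?I"
  proof
    fix p :: "'a x_poly" assume p: "p \<in> symmetric_exchange_relations ?B"
    then obtain F G i j where
      p': "p = xvar F * xvar G - xvar (F - \<epsilon> i + \<epsilon> j) * xvar (G - \<epsilon> j + \<epsilon> i)"
      and *: "F \<in> ?B" "G \<in> ?B" "F - \<epsilon> i + \<epsilon> j \<in> ?B" "G - \<epsilon> j + \<epsilon> i \<in> ?B"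
      "lookup F i > lookup G i" "lookup F j < lookup G j"
      unfolding symmetric_exchange_relations_def by blast
    have pos: "lookup (forget n F) (copy_of n i) > 0" if "lookup F i > 0" for F i
    proof -
      have "(\<Sum>k | k \<in> keys F \<and> copy_of n k = copy_of n i. lookup F k) \<ge> lookup F i"
        by (rule member_le_sum) (use that in \<open>auto simp: in_keys_iff\<close>)
      then show ?thesis using that by (simp add: lookup_forget)
    qed
    have B: "forget n F \<in> bases P" if "F \<in> ?B" for F
      using that by (simp add: bases_expansion[OF N])
    have FG: "lookup F i > 0" "lookup G j > 0" using * by auto
    have "?f p = xvar (forget n F) * xvar (forget n G) -
        xvar (forget n F - \<epsilon> (copy_of n i) + \<epsilon> (copy_of n j)) *
        xvar (forget n G - \<epsilon> (copy_of n j) + \<epsilon> (copy_of n i))"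
      unfolding p' push_diff hom var forget_exchange[OF FG(1)] forget_exchange[OF FG(2)] ..
    also have "\<dots> \<in> exchange_ideal (bases P)"
      by (rule exchange_without_inequalities)
        (use * B FG pos forget_exchange[OF FG(1), of n j] forget_exchange[OF FG(2), of n i] in \<open>metis\<close>)+
    finally show "p \<in> ?I" using p symmetric_exchange_x_polys by auto
  qed
  ultimately have "exchange_ideal ?B \<subseteq> ?I"
    unfolding exchange_ideal_def[of ?B] by (rule genideal_x_least)
  then show ?thesis by blast
qed

theorem toric_ideal_from_matroids:
  assumes "\<And>n M. matroid n M \<Longrightarrow>
      (toric_ideal (bases M) :: 'a::field x_poly set) =
        Idl\<^bsub>x_ring (bases M)\<^esub> (symmetric_exchange_relations (bases M))"
  shows "(toric_ideal (bases P) :: 'a x_poly set) =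
      Idl\<^bsub>x_ring (bases P)\<^esub> (symmetric_exchange_relations (bases P))"
proof (rule toric_ideal_eq_genidealI)
  fix m m' assume m: "m \<in> xmonoms (bases P)" "m' \<in> xmonoms (bases P)"
    and "fibre_sum m = fibre_sum m'"
  then have eq: "vsum m = vsum m'" "modulus m = modulus m'" by (simp_all add: fibre_sum_eq_iff)
  \<comment> \<open>The first summand bounds the entries of all vectors in \<open>P\<close>; the
    second leaves room for the blocks of all factors of \<open>m\<close>, and of \<open>m'\<close>
    as well because the factors have the same sum.\<close>
  define N where "N = (\<Sum>u\<in>P. modulus u) + modulus (vsum m)"
  have N: "lookup u a \<le> N" if "u \<in> P" for u a
    using member_le_sum[of u P modulus] lookup_le_modulus[of u a] that finite_P by (simp add: N_def)
  have N': "lookup (vsum m) a \<le> N" for a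
    using lookup_le_modulus[of "vsum m" a] by (simp add: N_def)
  interpret M: polymatroid "n * N" "expansion n N P"
    using matroid_expansion by unfold_locales (simp add: matroid_def)
  obtain M where M: "M \<in> xmonoms (bases (expansion n N P))" "forget_monom n M = m"
    "vsum M = lift_from n 0 (vsum m)" "modulus M = modulus m"
    using lift_monomial[OF N m(1) N'] by blast
  obtain M' where M': "M' \<in> xmonoms (bases (expansion n N P))" "forget_monom n M' = m'"
    "vsum M' = lift_from n 0 (vsum m')" "modulus M' = modulus m'"
    using lift_monomial[OF N m(2)] N' eq by metis
  have "(single M 1 - single M' 1 :: 'a x_poly) \<in> toric_ideal (bases (expansion n N P))"
    by (rule toric_ideal_binomial) (use M M' eq in \<open>auto simp: M.fibre_sum_eq_iff\<close>)
  also have "\<dots> = exchange_ideal (bases (expansion n N P))"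
    unfolding exchange_ideal_def using assms matroid_expansion by blast
  finally have "push (forget_monom n) (single M 1 - single M' 1 :: 'a x_poly) \<in> exchange_ideal (bases P)"
    using forget_exchange_ideal[OF N] by blast
  then show "(single m 1 - single m' 1 :: 'a x_poly) \<in>
      Idl\<^bsub>x_ring (bases P)\<^esub> (symmetric_exchange_relations (bases P))"
    by (simp add: push_diff M M' exchange_ideal_def)
qed

end

section \<open>Sorting\<close>

text \<open>Partial sums turn sorting into arithmetic: they determine the vector, and sorting halves
  those of \<open>u + v\<close>, rounding up for one half and down for the other.\<close>

definition pre :: "expvec \<Rightarrow> nat \<Rightarrow> nat" where
  "pre w i = (\<Sum>k\<le>i. lookup w k)"

lemma pre_eqD:
  assumes "\<And>i. pre u i = pre v i"
  shows "u = v"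
proof (rule poly_mapping_eqI)
  fix k show "lookup u k = lookup v k"
    using assms[of k] assms[of "k - 1"] by (cases k) (auto simp: pre_def)
qed

lemma pre_add: "pre (u + v) i = pre u i + pre v i"
  by (simp add: pre_def lookup_add sum.distrib)

lemma pre_le_modulus: "pre w i \<le> modulus w"
proof -
  have "pre w i = (\<Sum>k\<in>{..i} \<inter> keys w. lookup w k)"
    unfolding pre_def by (rule sum.mono_neutral_right) (auto simp: in_keys_iff)
  also have "\<dots> \<le> modulus w"
    unfolding modulus_def by (rule sum_mono2) auto
  finally show ?thesis .
qed

lemma pre_eq_modulus:
  assumes "keys w \<subseteq> {..i}"
  shows "pre w i = modulus w"
  unfolding pre_def modulus_def by (rule sum.mono_neutral_right) (use assms in \<open>auto simp: in_keys_iff\<close>)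

lemma sorted_nth_le_iff:
  assumes "sorted xs" "p < length xs"
  shows "xs ! p \<le> i \<longleftrightarrow> p < length (filter (\<lambda>x. x \<le> i) xs)"
  using assms
proof (induction xs arbitrary: p)
  case (Cons x xs)
  show ?case
  proof (cases "x \<le> i")
    case True
    then show ?thesis using Cons by (cases p) auto
  next
    case False
    then have gt: "\<forall>y\<in>set (x # xs). i < y" using Cons.prems(1) by auto
    then have "filter (\<lambda>x. x \<le> i) xs = []" by (auto simp: filter_empty_conv)
    moreover have "\<not> (x # xs) ! p \<le> i" using bspec[OF gt nth_mem[OF Cons.prems(2)]] by simp
    ultimately show ?thesis using False by simp
  qed
qed simp

text \<open>In the sorted list the entries up to \<open>i\<close> occupy exactly the first
  \<open>pre w i\<close> positions; this translates positions into partial sums.\<close>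

lemma index_list:
  shows "length (index_list w) = modulus w"
    and "p < modulus w \<Longrightarrow> index_list w ! p \<le> i \<longleftrightarrow> p < pre w i"
proof -
  define W where "W = (\<Sum>i\<in>keys w. replicate_mset (lookup w i) i)"
  have xs: "index_list w = sorted_list_of_multiset W" by (simp add: index_list_def W_def)
  have count: "count W k = lookup w k" for k
    by (auto simp: W_def count_sum in_keys_iff sum.delta)
  have setW: "set_mset W = keys w"
    by (auto simp: set_mset_def count in_keys_iff)
  show len: "length (index_list w) = modulus w"
    by (metis xs mset_sorted_list_of_multiset size_mset size_multiset_overloaded_eq setW count modulus_def sum.cong)
  have "length (filter (\<lambda>x. x \<le> i) (index_list w)) = size (filter_mset (\<lambda>x. x \<le> i) W)"
    by (metis xs mset_filter mset_sorted_list_of_multiset size_mset)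
  also have "\<dots> = (\<Sum>k\<in>{k \<in> keys w. k \<le> i}. lookup w k)"
    by (auto simp: size_multiset_overloaded_eq setW count intro!: sum.cong)
  also have "\<dots> = pre w i"
    unfolding pre_def by (rule sum.mono_neutral_left) (auto simp: in_keys_iff)
  finally show "p < modulus w \<Longrightarrow> index_list w ! p \<le> i \<longleftrightarrow> p < pre w i"
    using sorted_nth_le_iff[of "index_list w" p i] len by (simp add: xs)
qed

lemma pre_sum_units: "finite A \<Longrightarrow> pre (\<Sum>j\<in>A. \<epsilon> (f j)) i = card {j \<in> A. f j \<le> i}"
proof -
  assume A: "finite A"
  have "pre (\<Sum>j\<in>A. \<epsilon> (f j)) i = (\<Sum>k\<le>i. \<Sum>j\<in>A. lookup (\<epsilon> (f j)) k)"
    by (simp add: pre_def lookup_sum)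
  also have "\<dots> = (\<Sum>j\<in>A. \<Sum>k\<le>i. lookup (\<epsilon> (f j)) k)"
    by (rule sum.swap)
  also have "\<dots> = (\<Sum>j\<in>A. if f j \<le> i then 1 else 0)"
    by (intro sum.cong) (auto simp: lookup_single when_def)
  also have "\<dots> = card {j \<in> A. f j \<le> i}"
    using A by (simp add: sum.If_cases Int_def)
  finally show ?thesis .
qed

text \<open>Of the first \<open>x\<close> positions, counted from 0, the even ones number
  \<open>(x + 1) div 2\<close> and the odd ones \<open>x div 2\<close>.\<close>

lemma sort_pair:
  assumes "modulus u = modulus v" and ab: "sort_pair u v = (a, b)"
  shows "pre a i = (pre (u + v) i + 1) div 2" "pre b i = pre (u + v) i div 2" "a + b = u + v"
proof -
  let ?xs = "index_list (u + v)" and ?d = "modulus u"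
  have d: "modulus (u + v) = 2 * ?d" using assms by (simp add: modulus_add)
  have le: "pre (u + v) i \<le> 2 * ?d" for i using pre_le_modulus[of "u + v" i] d by simp
  have a: "a = (\<Sum>j<?d. \<epsilon> (?xs ! (2 * j)))" and b: "b = (\<Sum>j<?d. \<epsilon> (?xs ! (2 * j + 1)))"
    using ab by (simp_all add: sort_pair_def Let_def)
  have "{j \<in> {..<?d}. ?xs ! (2 * j) \<le> i} = {..<(pre (u + v) i + 1) div 2}" for i
    using index_list(2)[of "2 * _" "u + v" i] le[of i] d by auto
  then show A: "pre a i = (pre (u + v) i + 1) div 2" for i
    unfolding a by (subst pre_sum_units) auto
  have "{j \<in> {..<?d}. ?xs ! (2 * j + 1) \<le> i} = {..<pre (u + v) i div 2}" for i
    using index_list(2)[of "2 * _ + 1" "u + v" i] le[of i] d by auto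
  then show B: "pre b i = pre (u + v) i div 2" for i
    unfolding b by (subst pre_sum_units) auto
  have half: "(x + 1) div 2 + x div 2 = x" for x :: nat
    by presburger
  show "a + b = u + v"
    by (rule pre_eqD) (simp only: pre_add[of a b] A B half)
qed

text \<open>The interval is open on the left, so that block sums are differences of partial sums and
  adjacent blocks add up.\<close>

definition blk :: "expvec \<Rightarrow> nat \<Rightarrow> nat \<Rightarrow> nat" where
  "blk u i j = (\<Sum>k\<in>{i<..j}. lookup u k)"

lemma blk_add: "blk (u + v) i j = blk u i j + blk v i j"
  by (simp add: blk_def lookup_add sum.distrib)

lemma blk_0 [simp]: "blk 0 i j = 0"
  by (simp add: blk_def)

lemma blk_split: "i \<le> j \<Longrightarrow> j \<le> k \<Longrightarrow> blk u i k = blk u i j + blk u j k"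
  unfolding blk_def by (subst sum.union_disjoint[symmetric]) (auto intro!: sum.cong)

lemma blk_pre: "i \<le> j \<Longrightarrow> pre u j = pre u i + blk u i j"
  unfolding blk_def pre_def by (subst sum.union_disjoint[symmetric]) (auto intro!: sum.cong)

lemma blk_empty: "j \<le> i \<Longrightarrow> blk u i j = 0"
  by (simp add: blk_def)

lemma blk_single: "0 < k \<Longrightarrow> blk u (k - 1) k = lookup u k"
proof -
  assume "0 < k"
  then have "{k - 1<..k} = {k}" by auto
  then show ?thesis by (simp add: blk_def)
qed

lemma balanced_squares:
  fixes a b u v :: nat
  assumes "a + b = u + v" "a \<le> b + 1" "b \<le> a + 1"
  shows "a\<^sup>2 + b\<^sup>2 \<le> u\<^sup>2 + v\<^sup>2" "u + 2 \<le> v \<or> v + 2 \<le> u \<Longrightarrow> a\<^sup>2 + b\<^sup>2 < u\<^sup>2 + v\<^sup>2"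
proof -
  define A B U V where "A = int a" "B = int b" "U = int u" "V = int v"
  note defs = this
  have V: "V = A + B - U" using assms(1) by (simp add: defs)
  \<comment> \<open>Twice a sum of two squares is the square of the sum plus the square of the
    difference. The sums agree, so only the differences have to be compared.\<close>
  have eq: "2 * (U\<^sup>2 + V\<^sup>2) = 2 * (A\<^sup>2 + B\<^sup>2) + ((U - V)\<^sup>2 - (A - B)\<^sup>2)"
    unfolding V by (simp add: power2_eq_square algebra_simps)
  have "\<bar>A - B\<bar> \<le> \<bar>U - V\<bar>"
  proof (cases "U = V")
    case True
    \<comment> \<open>An even sum and a difference of at most 1 force equality.\<close>
    then have "a = b" using assms unfolding defs by presburger
    then show ?thesis by (simp add: defs)
  next
    case False
    then show ?thesis using assms unfolding defs by linarith
  qed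
  then have 1: "(A - B)\<^sup>2 \<le> (U - V)\<^sup>2" by (simp add: abs_le_square_iff)
  have 2: "(A - B)\<^sup>2 < (U - V)\<^sup>2" if "u + 2 \<le> v \<or> v + 2 \<le> u"
  proof -
    have "\<bar>A - B\<bar> < \<bar>U - V\<bar>" using assms that by (auto simp: defs abs_if)
    then show ?thesis by (metis abs_ge_zero power2_abs power_strict_mono zero_less_numeral)
  qed
  have "2 * (A\<^sup>2 + B\<^sup>2) \<le> 2 * (U\<^sup>2 + V\<^sup>2)" unfolding eq using 1 by simp
  then show "a\<^sup>2 + b\<^sup>2 \<le> u\<^sup>2 + v\<^sup>2"
    unfolding defs mult_le_cancel_left by (simp flip: of_nat_power of_nat_add)
  show "a\<^sup>2 + b\<^sup>2 < u\<^sup>2 + v\<^sup>2" if "u + 2 \<le> v \<or> v + 2 \<le> u"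
  proof -
    have "2 * (A\<^sup>2 + B\<^sup>2) < 2 * (U\<^sup>2 + V\<^sup>2)" unfolding eq using 2[OF that] by simp
    then show ?thesis
      unfolding defs mult_less_cancel_left by (simp flip: of_nat_power of_nat_add)
  qed
qed

section \<open>Unsorted pairs, standard monomials and the monomial order\<close>

context polymatroid
begin

text \<open>The obstruction to being sorted, in a form symmetric in \<open>u\<close> and
  \<open>v\<close>; the two halves of a sorted pair never have it
  (\<open>sort_pair_bases\<close>).\<close>

definition unsorted :: "expvec \<Rightarrow> expvec \<Rightarrow> bool" where
  "unsorted u v \<longleftrightarrow> (\<exists>i\<le>n. \<exists>j\<le>n. blk u i j + 2 \<le> blk v i j \<or> blk v i j + 2 \<le> blk u i j)"

lemma unsorted_irrefl [simp]: "\<not> unsorted u u"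
  and unsorted_sym: "unsorted u v \<longleftrightarrow> unsorted v u"
  by (auto simp: unsorted_def)

text \<open>This weight makes the sorted pair the smaller one, as the sum of the squares of two numbers
  with given sum is least when they are as close as possible.\<close>

definition weight :: "expvec \<Rightarrow> nat" where
  "weight u = (\<Sum>i\<le>n. \<Sum>j\<le>n. (blk u i j)\<^sup>2)"

lemma weight_less:
  assumes "a + b = u + v" "\<And>i j. blk a i j \<le> blk b i j + 1" "\<And>i j. blk b i j \<le> blk a i j + 1"
    and "unsorted u v"
  shows "weight a + weight b < weight u + weight v"
proof -
  have eq: "blk a i j + blk b i j = blk u i j + blk v i j" for i j
    using assms(1) by (metis blk_add)
  note sq = balanced_squares[OF eq assms(2,3)]
  obtain i j where ij: "i \<le> n" "j \<le> n" "blk u i j + 2 \<le> blk v i j \<or> blk v i j + 2 \<le> blk u i j"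
    using assms(4) by (auto simp: unsorted_def)
  have "weight a + weight b = (\<Sum>(i, j)\<in>{..n} \<times> {..n}. (blk a i j)\<^sup>2 + (blk b i j)\<^sup>2)"
    by (simp add: weight_def sum.cartesian_product sum.distrib case_prod_unfold)
  also have "\<dots> < (\<Sum>(i, j)\<in>{..n} \<times> {..n}. (blk u i j)\<^sup>2 + (blk v i j)\<^sup>2)"
  proof (rule sum_strict_mono_ex1)
    show "\<exists>x\<in>{..n} \<times> {..n}. (case x of (i, j) \<Rightarrow> (blk a i j)\<^sup>2 + (blk b i j)\<^sup>2)
        < (case x of (i, j) \<Rightarrow> (blk u i j)\<^sup>2 + (blk v i j)\<^sup>2)"
      using ij sq(2)[OF ij(3)] by (intro bexI[of _ "(i, j)"]) auto
  qed (use sq(1) in auto)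
  also have "\<dots> = weight u + weight v"
    by (simp add: weight_def sum.cartesian_product sum.distrib case_prod_unfold)
  finally show ?thesis .
qed

definition wt :: "xmonom \<Rightarrow> nat" where
  "wt = lin_ext weight"

lemma wt_0 [simp]: "wt 0 = 0"
  and wt_add: "wt (m + m') = wt m + wt m'"
  and wt_single [simp]: "wt (single u (Suc 0)) = weight u"
  by (auto simp: wt_def lin_ext_add)

text \<open>Under the strong exchange property these turn out to be the monomials outside the
  initial ideal of the toric ideal.\<close>

definition standard :: "xmonom \<Rightarrow> bool" where
  "standard m \<longleftrightarrow> m \<in> xmonoms (bases P) \<and> (\<forall>u\<in>keys m. \<forall>v\<in>keys m. \<not> unsorted u v)"

lemma standard_add: "standard (m + m') \<Longrightarrow> standard m"
  by (auto simp: standard_def keys_plus_nat)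

text \<open>The factors of a standard monomial are totally ordered by comparing all partial sums at
  once: if two of them crossed, their sums over the block between the two places would differ by at
  least 2. The factor with the largest total of partial sums is therefore on top.\<close>

lemma largest_factor:
  assumes "standard m" "m \<noteq> 0"
  obtains a where "a \<in> keys m" "\<And>x j. x \<in> keys m \<Longrightarrow> j \<le> n \<Longrightarrow> blk x 0 j \<le> blk a 0 j"
    "\<And>x j. x \<in> keys m \<Longrightarrow> j \<le> n \<Longrightarrow> blk a 0 j \<le> blk x 0 j + 1"
proof -
  have ne: "keys m \<noteq> {}"
    using assms(2) by (metis empty_iff in_keys_iff lookup_zero poly_mapping_eqI)
  define t where "t x = (\<Sum>j\<le>n. blk x 0 j)" for x
  obtain a where a: "a \<in> keys m" "\<And>x. x \<in> keys m \<Longrightarrow> t x \<le> t a"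
    using Max_in[of "t ` keys m"] Max_ge[of "t ` keys m"] ne by fastforce
  have *: "blk x i j < blk y i j + 2" if "x \<in> keys m" "y \<in> keys m" "i \<le> n" "j \<le> n" for x y i j
    using assms(1) that by (force simp: standard_def unsorted_def)
  have "blk x 0 j \<le> blk a 0 j" if x: "x \<in> keys m" "j \<le> n" for x j
  proof (rule ccontr)
    assume j: "\<not> ?thesis"
    have "\<exists>k\<le>n. blk x 0 k < blk a 0 k"
    proof (rule ccontr)
      assume "\<not> ?thesis"
      then have "\<And>k. k \<le> n \<Longrightarrow> blk a 0 k \<le> blk x 0 k" by (meson not_less)
      then have "t a < t x"
        unfolding t_def by (intro sum_strict_mono_ex1) (use j x in \<open>auto simp: not_le intro!: bexI[of _ j]\<close>)
      with a(2)[OF x(1)] show False by simp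
    qed
    then obtain k where k: "k \<le> n" "blk x 0 k < blk a 0 k" by blast
    consider "j \<le> k" | "k \<le> j" by linarith
    then show False
    proof cases
      case 1
      then show False
        using j k *[OF a(1) x(1), of j k] x(2) by (simp add: blk_split[of 0 j k])
    next
      case 2
      then show False
        using j k *[OF x(1) a(1), of k j] x(2) by (simp add: blk_split[of 0 k j])
    qed
  qed
  moreover have "blk a 0 j \<le> blk x 0 j + 1" if "x \<in> keys m" "j \<le> n" for x j
    using *[OF a(1) that(1), of 0 j] that(2) by simp
  ultimately show ?thesis using that a(1) by blast
qed

lemma lin_ext_mono: "(\<And>x. x \<in> keys m \<Longrightarrow> f x \<le> g x) \<Longrightarrow> lin_ext f m \<le> (lin_ext g m :: nat)"
  unfolding lin_ext_def by (intro sum_mono) auto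

lemma lin_ext_const: "lin_ext (\<lambda>_. c) m = modulus m * (c :: nat)"
  by (simp add: lin_ext_def modulus_def sum_distrib_right)

lemma blk_vsum: "blk (vsum m) i j = lin_ext (\<lambda>x. blk x i j) m"
  using lin_ext_unique[of "\<lambda>m. blk (vsum m) i j" m] by (simp add: blk_add vsum_add)

lemma keys_split:
  assumes "a \<in> keys m"
  obtains m' where "m = m' + single a (Suc 0)"
  using assms
  by (intro that[of "m - single a 1"] poly_mapping_eqI)
    (auto simp: lookup_add lookup_minus lookup_single when_def in_keys_iff)

text \<open>The largest factor is determined by the product: its partial sums are the quotients,
  rounded up, of those of the product by the degree.\<close>

lemma standard_unique:
  assumes "standard m" "standard m'" "fibre_sum m = fibre_sum m'"
  shows "m = m'"
  using assms
proof (induction "modulus m" arbitrary: m m')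
  case 0
  then have "modulus m = modulus m'" by (simp only: standard_def fibre_sum_eq_iff)
  with 0 show ?case by simp
next
  case (Suc k)
  note st = Suc.prems
  have eq: "vsum m = vsum m'" "modulus m = modulus m'"
    using st by (auto simp: standard_def fibre_sum_eq_iff)
  \<comment> \<open>Together the bounds give the rounded quotient. The second one is strict because
    \<open>a\<close> itself does not fall short of its own partial sum, whereas every other factor
    may do so by 1.\<close>
  have bounds: "blk (vsum m) 0 j \<le> modulus m * blk a 0 j"
    "modulus m * blk a 0 j < blk (vsum m) 0 j + modulus m"
    if am: "a \<in> keys m" "\<And>x j. x \<in> keys m \<Longrightarrow> j \<le> n \<Longrightarrow> blk x 0 j \<le> blk a 0 j"
    "\<And>x j. x \<in> keys m \<Longrightarrow> j \<le> n \<Longrightarrow> blk a 0 j \<le> blk x 0 j + 1" "j \<le> n" for m a j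
  proof -
    show "blk (vsum m) 0 j \<le> modulus m * blk a 0 j"
      unfolding blk_vsum lin_ext_const[symmetric] by (rule lin_ext_mono) (use that in auto)
    obtain m1 where m1: "m = m1 + single a (Suc 0)" by (rule keys_split[OF am(1)])
    have "modulus m1 * blk a 0 j \<le> lin_ext (\<lambda>x. blk x 0 j + 1) m1"
      unfolding lin_ext_const[symmetric] by (rule lin_ext_mono) (use that in \<open>auto simp: m1 keys_plus_nat\<close>)
    also have "\<dots> = blk (vsum m1) 0 j + modulus m1"
      using lin_ext_unique[of "\<lambda>m. blk (vsum m) 0 j + modulus m" m1]
      by (simp add: blk_add vsum_add modulus_add)
    finally show "modulus m * blk a 0 j < blk (vsum m) 0 j + modulus m"
      by (simp add: m1 modulus_add vsum_add blk_add)
  qed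
  have ne: "m \<noteq> 0" "m' \<noteq> 0" using Suc(2) eq by auto
  obtain a where a: "a \<in> keys m" "\<And>x j. x \<in> keys m \<Longrightarrow> j \<le> n \<Longrightarrow> blk x 0 j \<le> blk a 0 j"
    "\<And>x j. x \<in> keys m \<Longrightarrow> j \<le> n \<Longrightarrow> blk a 0 j \<le> blk x 0 j + 1"
    using largest_factor[OF st(1) ne(1)] by blast
  obtain b where b: "b \<in> keys m'" "\<And>x j. x \<in> keys m' \<Longrightarrow> j \<le> n \<Longrightarrow> blk x 0 j \<le> blk b 0 j"
    "\<And>x j. x \<in> keys m' \<Longrightarrow> j \<le> n \<Longrightarrow> blk b 0 j \<le> blk x 0 j + 1"
    using largest_factor[OF st(2) ne(2)] by blast
  have less: "\<not> x < y" if "k * y < s + k" "s \<le> k * x" for x y k s :: nat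
  proof
    assume "x < y"
    then have "k * (x + 1) \<le> k * y" by (intro mult_le_mono2) simp
    then show False using that by simp
  qed
  have blk_eq: "blk a 0 j = blk b 0 j" if "j \<le> n" for j
    using less[OF bounds(2)[OF a that] bounds(1)[OF b that, folded eq]]
      less[OF bounds(2)[OF b that, folded eq] bounds(1)[OF a that]] by simp
  have B: "a \<in> bases P" "b \<in> bases P" using a(1) b(1) st by (auto simp: standard_def xmonoms_def)
  have "a = b"
  proof (rule poly_mapping_eqI)
    fix k
    show "lookup a k = lookup b k"
    proof (cases "k \<in> {1..n}")
      case True
      then have "k \<le> n" "k - 1 \<le> n" by auto
      with True show ?thesis
        using blk_eq[of k] blk_eq[of "k - 1"] blk_split[of 0 "k - 1" k a] blk_split[of 0 "k - 1" k b]
          blk_single[of k a] blk_single[of k b] by simp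
    next
      case False
      then show ?thesis using bases_lattice[OF B(1)] bases_lattice[OF B(2)]
        by (metis in_keys_iff subsetD)
    qed
  qed
  obtain m1 m1' where m1: "m = m1 + single a (Suc 0)" "m' = m1' + single a (Suc 0)"
    using keys_split a(1) b(1) \<open>a = b\<close> by metis
  have "m1 = m1'"
    by (rule Suc(1)) (use Suc(2) st standard_add in \<open>auto simp: m1 modulus_add fibre_sum_add\<close>)
  then show ?case by (simp add: m1)
qed

text \<open>The additive weight decides; the lexicographic order on \<open>xmonom\<close> only
  breaks ties, so that the order is linear and compatible with products.\<close>

definition mle :: "xmonom \<Rightarrow> xmonom \<Rightarrow> bool" where
  "mle m m' \<longleftrightarrow> wt m < wt m' \<or> wt m = wt m' \<and> m \<le> m'"

lemma mle_refl: "mle m m"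
  and mle_trans: "mle m m' \<Longrightarrow> mle m' m'' \<Longrightarrow> mle m m''"
  and mle_antisym: "mle m m' \<Longrightarrow> mle m' m \<Longrightarrow> m = m'"
  and mle_linear: "mle m m' \<or> mle m' m"
  and mle_add: "mle m m' \<Longrightarrow> mle (m + l) (m' + l)"
  by (auto simp: mle_def wt_add intro: add_right_mono)

lemma mle_0: "mle 0 m"
proof -
  have "\<not> m < 0" by (simp add: less_poly_mapping.rep_eq less_fun_def)
  then show ?thesis by (auto simp: mle_def)
qed

end

section \<open>Sorting by symmetric exchanges\<close>

locale strong_polymatroid = polymatroid +
  assumes strong: "strong_exchange_property (bases P)"
begin

text \<open>Balance ensures that where \<open>u\<close> exceeds \<open>a\<close> it also exceeds
  \<open>v\<close>, and likewise where it falls short. So the strong exchange property applies to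
  both vectors, and each exchange brings \<open>u\<close> closer to \<open>a\<close>.\<close>

lemma exchange_to_balanced:
  assumes "u \<in> bases P" "v \<in> bases P" "a + b = u + v" "modulus a = modulus u"
    and bal: "\<And>k. lookup a k \<le> lookup b k + 1" "\<And>k. lookup b k \<le> lookup a k + 1"
  shows "a \<in> bases P \<and> b \<in> bases P \<and>
    (xvar u * xvar v - xvar a * xvar b :: 'a::field x_poly) \<in> exchange_ideal (bases P)"
  using assms(1-4)
proof (induction "modulus (u - a)" arbitrary: u v rule: less_induct)
  case less
  have sum: "lookup a k + lookup b k = lookup u k + lookup v k" for k
    using less.prems(3) by (metis lookup_add)
  show ?case
  proof (cases "u = a")
    case True
    with less.prems have "v = b" by (simp add: add_left_cancel)
    with True less.prems show ?thesis by (simp add: exchange_idealD(1))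
  next
    case False
    have "\<not> vle u a" "\<not> vle a u"
      using False less.prems(4) vless_modulus[of u a] vless_modulus[of a u] by (auto simp: vless_def)
    then obtain i j where i: "lookup a i < lookup u i" and j: "lookup u j < lookup a j"
      by (auto simp: vle_def not_le)
    \<comment> \<open>At \<open>i\<close> the entries satisfy
      \<open>v < b \<le> a + 1 \<le> u\<close>, the first inequality because the sums agree; dually
      at \<open>j\<close>.\<close>
    have vi: "lookup v i < lookup u i" and vj: "lookup u j < lookup v j"
      using i j sum[of i] sum[of j] bal(1)[of j] bal(2)[of i] by linarith+
    define u' v' where "u' = u - \<epsilon> i + \<epsilon> j" and "v' = v - \<epsilon> j + \<epsilon> i"
    have "u \<noteq> v" using vi by auto
    then have B: "u' \<in> bases P" "v' \<in> bases P"
      using strong less.prems(1,2) vi vj by (auto simp: strong_exchange_property_def u'_def v'_def)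
    have "u - a = (u' - a) + \<epsilon> i"
    proof (rule poly_mapping_eqI)
      fix k show "lookup (u - a) k = lookup (u' - a + \<epsilon> i) k"
        using i j by (auto simp: u'_def lookup_add lookup_minus lookup_single when_def)
    qed
    then have "modulus (u' - a) < modulus (u - a)" by (simp add: modulus_add)
    moreover have "a + b = u' + v'"
      using less.prems(3) exchange_sum[of u i v j] vi vj by (simp add: u'_def v'_def)
    moreover have "modulus a = modulus u'"
      using less.prems(4) modulus_exchange[of u i j] vi by (simp add: u'_def)
    ultimately have IH: "a \<in> bases P \<and> b \<in> bases P \<and>
        (xvar u' * xvar v' - xvar a * xvar b :: 'a x_poly) \<in> exchange_ideal (bases P)"
      using less.hyps B by blast
    have "(xvar u * xvar v - xvar u' * xvar v' :: 'a x_poly) \<in> exchange_ideal (bases P)"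
      unfolding u'_def v'_def
      by (rule exchange_relation) (use less.prems vi vj B in \<open>auto simp: u'_def v'_def\<close>)
    with IH show ?thesis using exchange_ideal_trans by blast
  qed
qed

lemma sort_pair_bases:
  assumes uv: "u \<in> bases P" "v \<in> bases P" and ab: "sort_pair u v = (a, b)"
  shows "a \<in> bases P" "b \<in> bases P" "a + b = u + v"
    "(xvar u * xvar v - xvar a * xvar b :: 'a::field x_poly) \<in> exchange_ideal (bases P)"
    "\<not> unsorted a b"
    "unsorted u v \<Longrightarrow> weight a + weight b < weight u + weight v"
proof -
  note sp = sort_pair[OF bases_modulus[OF uv] ab]
  show ab_eq: "a + b = u + v" by (rule sp(3))
  \<comment> \<open>A block sum of \<open>a\<close> is a difference of two halves rounded up, that
    of \<open>b\<close> the difference of the same halves rounded down; these differ by at most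
    1.\<close>
  have bal: "blk a i j \<le> blk b i j + 1 \<and> blk b i j \<le> blk a i j + 1" for i j
  proof (cases "i \<le> j")
    case True
    have "(pre (u + v) j + 1) div 2 = (pre (u + v) i + 1) div 2 + blk a i j"
      "pre (u + v) j div 2 = pre (u + v) i div 2 + blk b i j"
      using blk_pre[OF True, of a] blk_pre[OF True, of b] by (simp_all only: sp)
    then show ?thesis by linarith
  qed (simp add: blk_empty)
  have ab0: "lookup a 0 = 0 \<and> lookup b 0 = 0"
    using arg_cong[OF ab_eq, of "\<lambda>w. lookup w 0"] uv by (simp add: lookup_add)
  \<comment> \<open>A positive index \<open>k\<close> is the block from \<open>k - 1\<close> to
    \<open>k\<close>. For index 0 that block is empty, but there both entries vanish.\<close>
  have bal': "lookup a k \<le> lookup b k + 1 \<and> lookup b k \<le> lookup a k + 1" for k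
    using bal[of "k - 1" k] ab0 by (cases k) (auto simp: blk_single[of "Suc _", simplified])
  have "keys (a + b) \<subseteq> {..n}" "keys u \<subseteq> {..n}" "keys v \<subseteq> {..n}"
    unfolding ab_eq keys_plus_nat using bases_lattice[OF uv(1)] bases_lattice[OF uv(2)] by auto
  then have "modulus a = modulus u"
    using sp(1)[of n] pre_eq_modulus[of a n] pre_eq_modulus[of u n] pre_eq_modulus[of v n]
      bases_modulus[OF uv] by (simp add: keys_plus_nat pre_add)
  from exchange_to_balanced[OF uv ab_eq this] bal'
  show "a \<in> bases P" "b \<in> bases P"
    "(xvar u * xvar v - xvar a * xvar b :: 'a x_poly) \<in> exchange_ideal (bases P)"
    by blast+
  show "\<not> unsorted a b"
    unfolding unsorted_def
  proof (clarify)
    fix i j assume "blk a i j + 2 \<le> blk b i j \<or> blk b i j + 2 \<le> blk a i j"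
    then show False using bal[of i j] by linarith
  qed
  show "unsorted u v \<Longrightarrow> weight a + weight b < weight u + weight v"
    by (rule weight_less[OF ab_eq]) (use bal in auto)
qed

lemma sortable_bases: "sortable (bases P)"
  unfolding sortable_def
proof (intro ballI)
  fix u v assume "u \<in> bases P" "v \<in> bases P"
  from sort_pair_bases(1,2)[OF this] show "sort_pair u v \<in> bases P \<times> bases P"
    by (cases "sort_pair u v") auto
qed

lemma unsorted_factors:
  assumes "m \<in> xmonoms (bases P)" "\<not> standard m"
  obtains l u v where "m = l + (single u 1 + single v 1)" "unsorted u v" "u \<in> bases P" "v \<in> bases P"
    "l \<in> xmonoms (bases P)"
proof -
  obtain u v where uv: "u \<in> keys m" "v \<in> keys m" "unsorted u v"
    using assms by (auto simp: standard_def)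
  obtain m' where m': "m = m' + single u (Suc 0)" using keys_split[OF uv(1)] by blast
  have "v \<in> keys m'" using uv by (auto simp: m' keys_plus_nat)
  then obtain l where l: "m' = l + single v (Suc 0)" by (rule keys_split)
  show ?thesis
    by (rule that[of l u v]) (use assms(1) uv in \<open>auto simp: m' l add_ac\<close>)
qed

text \<open>Replacing an unsorted pair of factors by its sorted pair stays in the fibre, changes the
  monomial by an element of the exchange ideal and lowers the weight, so the process ends, and it
  ends at a standard monomial.\<close>

lemma normal_form:
  assumes "m \<in> xmonoms (bases P)"
  obtains m' where "standard m'" "fibre_sum m' = fibre_sum m" "mle m' m"
    "(single m 1 - single m' 1 :: 'a::field x_poly) \<in> exchange_ideal (bases P)"
proof -
  have "\<exists>m'. standard m' \<and> fibre_sum m' = fibre_sum m \<and> mle m' m \<and>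
    (single m 1 - single m' 1 :: 'a::field x_poly) \<in> exchange_ideal (bases P)"
    using assms
  proof (induction "wt m" arbitrary: m rule: less_induct)
    case less
    show ?case
    proof (cases "standard m")
      case True
      then show ?thesis by (intro exI[of _ m]) (auto simp: mle_refl exchange_idealD(1))
    next
      case False
      then obtain l u v where m: "m = l + (single u 1 + single v 1)" and uv: "unsorted u v"
        "u \<in> bases P" "v \<in> bases P" "l \<in> xmonoms (bases P)"
        using unsorted_factors less.prems by blast
      obtain a b where ab: "sort_pair u v = (a, b)" by (cases "sort_pair u v")
      note sp = sort_pair_bases[OF uv(2,3) ab]
      define m1 where "m1 = l + (single a 1 + single b 1)"
      have wt: "wt m1 < wt m" using sp(6)[OF uv(1)] by (simp add: m m1_def wt_add)
      have "a + \<epsilon> 0 + (b + \<epsilon> 0) = u + \<epsilon> 0 + (v + \<epsilon> 0)"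
        using arg_cong[OF sp(3), of "\<lambda>w. w + (\<epsilon> 0 + \<epsilon> 0)"] by (simp only: add_ac)
      then have fs: "fibre_sum m1 = fibre_sum m"
        by (simp add: m m1_def fibre_sum_add)
      have "single l 1 * (xvar u * xvar v - xvar a * xvar b :: 'a x_poly) \<in> exchange_ideal (bases P)"
        by (intro exchange_idealD(3) x_polys_single sp(4) uv(4))
      then have "(single m 1 - single m1 1 :: 'a x_poly) \<in> exchange_ideal (bases P)"
        by (simp add: m m1_def xvar_mult right_diff_distrib mult_single)
      moreover obtain m' where "standard m'" "fibre_sum m' = fibre_sum m1" "mle m' m1"
        "(single m1 1 - single m' 1 :: 'a x_poly) \<in> exchange_ideal (bases P)"
        using less.hyps[OF wt] sp(1,2) uv(4) by (auto simp: m1_def)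
      moreover have "mle m1 m" using wt by (simp add: mle_def)
      ultimately show ?thesis
        using fs exchange_ideal_trans[of "single m 1" "single m1 1"] mle_trans[of m' m1 m]
        by (intro exI[of _ m']) simp
    qed
  qed
  then show ?thesis using that by blast
qed

text \<open>Two monomials of one fibre have the same normal form and are both congruent to it modulo
  the exchange ideal.\<close>

theorem toric_ideal_strong:
  "(toric_ideal (bases P) :: 'a::field x_poly set) =
      Idl\<^bsub>x_ring (bases P)\<^esub> (symmetric_exchange_relations (bases P))"
proof (rule toric_ideal_eq_genidealI)
  fix m m' assume m: "m \<in> xmonoms (bases P)" "m' \<in> xmonoms (bases P)" "fibre_sum m = fibre_sum m'"
  obtain s where s: "standard s" "fibre_sum s = fibre_sum m" "mle s m"
    "(single m 1 - single s 1 :: 'a x_poly) \<in> exchange_ideal (bases P)"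
    by (rule normal_form[OF m(1)])
  obtain s' where s': "standard s'" "fibre_sum s' = fibre_sum m'" "mle s' m'"
    "(single m' 1 - single s' 1 :: 'a x_poly) \<in> exchange_ideal (bases P)"
    by (rule normal_form[OF m(2)])
  have "s = s'" using standard_unique[OF s(1) s'(1)] s(2) s'(2) m(3) by simp
  then show "(single m 1 - single m' 1 :: 'a x_poly) \<in>
      Idl\<^bsub>x_ring (bases P)\<^esub> (symmetric_exchange_relations (bases P))"
    using exchange_ideal_trans[OF s(4)] exchange_ideal_sym[OF s'(4)] by (simp add: exchange_ideal_def)
qed

lemma standard_least:
  assumes "m \<in> xmonoms (bases P)" "standard s" "fibre_sum s = fibre_sum m"
  shows "mle s m"
proof -
  obtain s' where "standard s'" "fibre_sum s' = fibre_sum m" "mle s' m"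
    by (rule normal_form[OF assms(1)])
  then show ?thesis using standard_unique[OF assms(2), of s'] assms(3) by simp
qed

section \<open>A quadratic Groebner basis\<close>

definition mon_order :: "xmonom rel" where
  "mon_order = {(m, m'). m \<in> xmonoms (bases P) \<and> m' \<in> xmonoms (bases P) \<and> mle m m'}"

lemma monomial_order_mon_order: "monomial_order (bases P) mon_order"
  unfolding monomial_order_def order_on_defs
  using mle_linear by (auto simp: mon_order_def refl_on_def total_on_def mle_refl mle_0 mle_add
      intro!: transI antisymI intro: mle_trans mle_antisym)

lemma initial_monomial_eq:
  assumes "f \<in> x_polys (bases P)" "m \<in> keys f" "\<And>m'. m' \<in> keys f \<Longrightarrow> mle m' m"
  shows "initial_monomial mon_order f = single m 1"
proof -
  have B: "m' \<in> xmonoms (bases P)" if "m' \<in> keys f" for m'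
    using assms(1) that by (auto simp: x_polys_def)
  have "(THE m. m \<in> keys f \<and> (\<forall>m'\<in>keys f. (m', m) \<in> mon_order)) = m"
    by (rule the_equality) (use assms B mle_antisym in \<open>auto simp: mon_order_def\<close>)
  then show ?thesis by (simp add: initial_monomial_def)
qed

lemma initial_monomial_exists:
  assumes "f \<in> x_polys (bases P)" "f \<noteq> 0"
  obtains m where "m \<in> keys f" "\<And>m'. m' \<in> keys f \<Longrightarrow> mle m' m"
    "initial_monomial mon_order f = single m 1"
proof -
  have "\<exists>m\<in>A. \<forall>m'\<in>A. mle m' m" if "finite A" "A \<noteq> {}" for A
    using that
  proof (induction A rule: finite_ne_induct)
    case (insert x A)
    then obtain m where m: "m \<in> A" "\<forall>m'\<in>A. mle m' m" by blast
    from mle_linear[of x m] show ?case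
    proof
      assume "mle m x"
      then show ?thesis using m(2) mle_trans mle_refl by (intro bexI[of _ x]) blast+
    qed (use m in blast)
  qed (simp add: mle_refl)
  moreover have "keys f \<noteq> {}"
    using assms(2) by (metis empty_iff in_keys_iff lookup_zero poly_mapping_eqI)
  ultimately obtain m where m: "m \<in> keys f" and "\<forall>m'\<in>keys f. mle m' m"
    using finite_keys by meson
  then have max: "\<And>m'. m' \<in> keys f \<Longrightarrow> mle m' m" by blast
  show ?thesis by (rule that[OF m max initial_monomial_eq[OF assms(1) m max]])
qed

definition sorting_relation :: "expvec \<times> expvec \<Rightarrow> 'a::field x_poly" where
  "sorting_relation p = (case p of (u, v) \<Rightarrow> case sort_pair u v of (a, b) \<Rightarrow>
    xvar u * xvar v - xvar a * xvar b)"

definition sorting_relations :: "'a::field x_poly set" where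
  "sorting_relations = sorting_relation ` {(u, v) \<in> bases P \<times> bases P. unsorted u v}"

lemma sorting_relation:
  assumes uv: "u \<in> bases P" "v \<in> bases P" "unsorted u v"
  shows "(sorting_relation (u, v) :: 'a::field x_poly) \<in> toric_ideal (bases P)"
    "(sorting_relation (u, v) :: 'a x_poly) \<noteq> 0"
    "quadratic (sorting_relation (u, v) :: 'a x_poly)"
    "initial_monomial mon_order (sorting_relation (u, v) :: 'a x_poly) = single (single u 1 + single v 1) 1"
proof -
  obtain a b where ab: "sort_pair u v = (a, b)" by (cases "sort_pair u v")
  note sp = sort_pair_bases[OF uv(1,2) ab]
  let ?m = "single u 1 + single v 1 :: xmonom" and ?m' = "single a 1 + single b 1 :: xmonom"
  have g: "(sorting_relation (u, v) :: 'a x_poly) = single ?m 1 - single ?m' 1"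
    by (simp add: sorting_relation_def ab xvar_mult)
  have "wt ?m' < wt ?m" using sp(6)[OF uv(3)] by (simp add: wt_add)
  then have less: "mle ?m' ?m" "?m \<noteq> ?m'" by (auto simp: mle_def)
  have keys: "keys (sorting_relation (u, v) :: 'a x_poly) = {?m, ?m'}"
    unfolding g using less(2) by (auto simp: in_keys_iff lookup_minus lookup_single when_def split: if_splits)
  show I: "(sorting_relation (u, v) :: 'a x_poly) \<in> toric_ideal (bases P)"
    using sp(4) unfolding toric_ideal_strong exchange_ideal_def[symmetric] by (simp add: sorting_relation_def ab)
  show nz: "(sorting_relation (u, v) :: 'a x_poly) \<noteq> 0" using keys by auto
  then show "quadratic (sorting_relation (u, v) :: 'a x_poly)"
    unfolding quadratic_def keys by (simp add: modulus_add)
  show "initial_monomial mon_order (sorting_relation (u, v) :: 'a x_poly) = single ?m 1"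
    by (rule initial_monomial_eq) (use I toric_ideal_subset keys less mle_refl in auto)
qed

theorem groebner_basis_sorting_relations:
  "groebner_basis (bases P) mon_order (toric_ideal (bases P)) (sorting_relations :: 'a::field x_poly set)"
proof -
  let ?B = "bases P" and ?I = "toric_ideal (bases P) :: 'a x_poly set"
  let ?G = "sorting_relations :: 'a x_poly set" and ?in = "initial_monomial mon_order"
  have G: "?G \<subseteq> ?I - {0}"
    using sorting_relation(1,2) by (auto simp: sorting_relations_def)
  have sub: "?in ` (?I - {0}) \<subseteq> x_polys ?B"
  proof
    fix x assume "x \<in> ?in ` (?I - {0})"
    then obtain f where f: "f \<in> ?I" "f \<noteq> 0" "x = ?in f" by blast
    then have fp: "f \<in> x_polys ?B" using toric_ideal_subset by blast
    obtain m where "m \<in> keys f" "?in f = single m 1"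
      by (rule initial_monomial_exists[OF fp f(2)]) (rule that)
    then show "x \<in> x_polys ?B" using fp f(3) x_polys_single by (auto simp: x_polys_def)
  qed
  have subG: "?in ` ?G \<subseteq> x_polys ?B" using sub G by blast
  have "?in ` (?I - {0}) \<subseteq> Idl\<^bsub>x_ring ?B\<^esub> (?in ` ?G)"
  proof
    fix x assume "x \<in> ?in ` (?I - {0})"
    then obtain f where f: "f \<in> ?I" "f \<noteq> 0" "x = ?in f" by blast
    then have fp: "f \<in> x_polys ?B" using toric_ideal_subset by blast
    obtain m where m: "m \<in> keys f" "\<And>m'. m' \<in> keys f \<Longrightarrow> mle m' m" "?in f = single m 1"
      by (rule initial_monomial_exists[OF fp f(2)]) (rule that)
    have mB: "m \<in> xmonoms ?B" using m(1) fp by (auto simp: x_polys_def)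
    obtain m' where m': "m' \<in> keys f" "m' \<noteq> m" "fibre_sum m' = fibre_sum m"
      by (rule toric_ideal_other_monomial[OF f(1) m(1)])
    \<comment> \<open>A standard leading monomial would be the least of its fibre, but
      \<open>f\<close> contains another monomial of that fibre.\<close>
    have "\<not> standard m"
    proof
      assume "standard m"
      then have "mle m m'" by (rule standard_least[rotated]) (use m' fp in \<open>auto simp: x_polys_def\<close>)
      then show False using m(2)[OF m'(1)] m'(2) mle_antisym by blast
    qed
    then obtain l u v where l: "m = l + (single u 1 + single v 1)" "unsorted u v" "u \<in> bases P" "v \<in> bases P"
      "l \<in> xmonoms (bases P)"
      using unsorted_factors mB by blast
    have "?in (sorting_relation (u, v)) \<in> Idl\<^bsub>x_ring ?B\<^esub> (?in ` ?G)"
      by (rule genideal_x_incl[OF subG]) (use l in \<open>auto simp: sorting_relations_def\<close>)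
    then have "single l 1 * single (single u 1 + single v 1) 1 \<in> Idl\<^bsub>x_ring ?B\<^esub> (?in ` ?G)"
      unfolding sorting_relation(4)[OF l(3,4,2)]
      by (intro ideal_x_ringD(3)[OF ideal_genideal_x[OF subG]] x_polys_single l(5))
    then show "x \<in> Idl\<^bsub>x_ring ?B\<^esub> (?in ` ?G)"
      by (simp add: f(3) m(3) l(1) mult_single)
  qed
  then have "Idl\<^bsub>x_ring ?B\<^esub> (?in ` ?G) = Idl\<^bsub>x_ring ?B\<^esub> (?in ` (?I - {0}))"
    using G genideal_x_incl[OF sub]
    by (intro equalityI genideal_x_least ideal_genideal_x sub subG) blast+
  moreover have "finite ?G"
    unfolding sorting_relations_def
    by (intro finite_imageI finite_subset[OF _ finite_cartesian_product[OF finite_bases finite_bases]]) auto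
  ultimately show ?thesis using G by (simp add: groebner_basis_def)
qed

lemma quadratic_sorting_relations: "\<forall>g\<in>sorting_relations. quadratic g"
  using sorting_relation(3) by (auto simp: sorting_relations_def)

end

section \<open>A linear resolution of the residue field\<close>

text \<open>Words carry their last letter first, so the recursion lets the earlier letters, in the
  tail, decide: on words of equal length this is the lexicographic order in reading order. Words of
  different lengths are incomparable.\<close>

fun word_less :: "'x::linorder list \<Rightarrow> 'x list \<Rightarrow> bool" where
  "word_less (z # w) (z' # w') \<longleftrightarrow> word_less w w' \<or> w = w' \<and> z < z'"
| "word_less _ _ \<longleftrightarrow> False"

lemma word_less_irrefl [simp]: "\<not> word_less w w"
  by (induction w) auto

lemma word_less_trans: "word_less u v \<Longrightarrow> word_less v w \<Longrightarrow> word_less u w"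
proof (induction u v arbitrary: w rule: word_less.induct)
  case (1 z u z' v)
  then show ?case by (cases w) auto
qed auto

lemma word_less_linear: "length v = length w \<Longrightarrow> v = w \<or> word_less v w \<or> word_less w v"
  by (induction v w rule: list_induct2) auto

section \<open>Standard representatives, words and the Schreyer order\<close>

context strong_polymatroid
begin

definition multidegrees :: "expvec set" where
  "multidegrees = fibre_sum ` xmonoms (bases P)"

text \<open>The monomials with exponent in \<open>multidegrees\<close> are a basis of the base ring
  over \<open>K\<close>; each has exactly one representative outside the initial ideal.\<close>

definition std :: "expvec \<Rightarrow> xmonom" where
  "std s = (THE m. standard m \<and> fibre_sum m = s)"

lemma std_eq: "standard m \<Longrightarrow> std (fibre_sum m) = m"
  unfolding std_def by (rule the_equality) (use standard_unique in auto)

lemma std: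
  assumes "s \<in> multidegrees"
  shows "standard (std s)" "fibre_sum (std s) = s"
proof -
  obtain m where m: "m \<in> xmonoms (bases P)" "s = fibre_sum m"
    using assms by (auto simp: multidegrees_def)
  obtain m' where "standard m'" "fibre_sum m' = fibre_sum m" by (rule normal_form[OF m(1)])
  with std_eq[of m'] m(2) show "standard (std s)" "fibre_sum (std s) = s" by auto
qed

lemma std_least: "m \<in> xmonoms (bases P) \<Longrightarrow> mle (std (fibre_sum m)) m"
  by (rule standard_least) (auto simp: std multidegrees_def)

lemma standard_xmonoms: "standard m \<Longrightarrow> m \<in> xmonoms (bases P)"
  by (simp add: standard_def)

lemma multidegrees_0 [simp]: "0 \<in> multidegrees"
  unfolding multidegrees_def by (rule image_eqI[of _ _ 0]) auto

lemma multidegrees_add: "s \<in> multidegrees \<Longrightarrow> t \<in> multidegrees \<Longrightarrow> s + t \<in> multidegrees"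
  by (auto simp: multidegrees_def simp flip: fibre_sum_add)

lemma multidegrees_generator: "u \<in> bases P \<Longrightarrow> u + \<epsilon> 0 \<in> multidegrees"
  unfolding multidegrees_def by (rule image_eqI[of _ _ "single u 1"]) auto

text \<open>A product of standard monomials need not be standard, but normalising it can only make
  it smaller. The comparisons of leading terms in the base ring rest on this.\<close>

lemma std_add:
  assumes "s \<in> multidegrees" "t \<in> multidegrees"
  shows "mle (std (s + t)) (std s + std t)"
  using std_least[of "std s + std t"] std[OF assms(1)] std[OF assms(2)]
  by (simp add: fibre_sum_add standard_xmonoms)

lemma standard_0: "standard 0"
  and standard_single: "u \<in> bases P \<Longrightarrow> standard (single u (Suc 0))"
  by (auto simp: standard_def)

lemma std_0 [simp]: "std 0 = 0"
  using std_eq[OF standard_0] by simp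

lemma std_generator [simp]: "u \<in> bases P \<Longrightarrow> std (u + single 0 (Suc 0)) = single u (Suc 0)"
  using std_eq[OF standard_single, of u] by simp

lemma std_add_generator:
  assumes "t \<in> multidegrees" "z \<in> bases P" "\<And>y. y \<in> keys (std t) \<Longrightarrow> \<not> unsorted y z"
  shows "std (t + (z + \<epsilon> 0)) = std t + single z 1"
proof -
  have "standard (std t + single z 1)"
    using std(1)[OF assms(1)] assms(2,3) unsorted_sym by (auto simp: standard_def keys_plus_nat)
  from std_eq[OF this] show ?thesis by (simp add: fibre_sum_add std(2)[OF assms(1)])
qed

lemma std_remove_generator:
  assumes "s \<in> multidegrees" "z \<in> keys (std s)"
  obtains t where "t \<in> multidegrees" "s = t + (z + \<epsilon> 0)" "std s = std t + single z 1" "z \<in> bases P"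
proof -
  obtain m where m: "std s = m + single z (Suc 0)" by (rule keys_split[OF assms(2)])
  have st: "standard m" using std(1)[OF assms(1)] m standard_add by metis
  show ?thesis
  proof (rule that[of "fibre_sum m"])
    show "s = fibre_sum m + (z + \<epsilon> 0)"
      using std(2)[OF assms(1)] by (simp add: m fibre_sum_add)
    show "std s = std (fibre_sum m) + single z 1" by (simp add: m std_eq[OF st])
    show "fibre_sum m \<in> multidegrees" using st by (auto simp: multidegrees_def standard_xmonoms)
    show "z \<in> bases P" using standard_xmonoms[OF std(1)[OF assms(1)]] by (simp add: m)
  qed
qed

text \<open>
  The generators of the \<open>j\<close>-th free module are words of length \<open>j\<close>, written with the last letter
  first: those of Schreyer's resolution of \<open>K\<close> over the polynomial ring modulo the initial ideal,
  where \<open>extensions w\<close> are the variables generating the colon ideal that belongs to \<open>w\<close>.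
\<close>

fun extensions :: "expvec list \<Rightarrow> expvec set" where
  "extensions [] = bases P"
| "extensions (z # w) = {y \<in> extensions w. y < z} \<union> {y \<in> bases P. unsorted y z}"

fun words :: "nat \<Rightarrow> expvec list set" where
  "words 0 = {[]}"
| "words (Suc j) = (\<lambda>(z, w). z # w) ` (SIGMA w:words j. extensions w)\<inverse>"

lemma words_Suc: "v \<in> words (Suc j) \<longleftrightarrow> (\<exists>z w. v = z # w \<and> w \<in> words j \<and> z \<in> extensions w)"
  by force

declare words.simps(2) [simp del]

lemma extensions_bases: "z \<in> extensions w \<Longrightarrow> z \<in> bases P"
  by (induction w) auto

lemma words_length: "w \<in> words j \<Longrightarrow> length w = j"
  by (induction j arbitrary: w) (auto simp: words_Suc)

lemma finite_words: "finite (words j)"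
proof (induction j)
  case (Suc j)
  have "words (Suc j) \<subseteq> (\<lambda>(z, w). z # w) ` (bases P \<times> words j)"
    using extensions_bases by (force simp: words_Suc)
  then show ?case using Suc finite_bases finite_surj finite_cartesian_product by blast
qed simp

fun word_monom :: "expvec list \<Rightarrow> xmonom" where
  "word_monom [] = 0"
| "word_monom (z # w) = single z 1 + word_monom w"

definition word_deg :: "expvec list \<Rightarrow> expvec" where
  "word_deg w = fibre_sum (word_monom w)"

lemma word_deg_Nil [simp]: "word_deg [] = 0"
  and word_deg_Cons: "word_deg (z # w) = word_deg w + (z + \<epsilon> 0)"
  by (simp_all add: word_deg_def fibre_sum_add add_ac)

definition words_at :: "nat \<Rightarrow> expvec \<Rightarrow> expvec list set" where
  "words_at j s = {w \<in> words j. \<exists>t\<in>multidegrees. s = word_deg w + t}"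

lemma words_atE:
  assumes "w \<in> words_at j s"
  obtains t where "w \<in> words j" "t \<in> multidegrees" "s = word_deg w + t" "s - word_deg w = t"
  using assms by (auto simp: words_at_def)

lemma words_at_add: "w \<in> words_at j s \<Longrightarrow> t \<in> multidegrees \<Longrightarrow> w \<in> words_at j (s + t)"
  by (auto simp: words_at_def add.assoc intro!: multidegrees_add)

lemma finite_words_at: "finite (words_at j s)"
  using finite_words[of j] by (simp add: words_at_def)

text \<open>
  In multidegree \<open>s\<close> the module has the basis \<open>words_at j s\<close>, with \<open>w\<close> standing for the multiple of
  the generator \<open>w\<close> by the monomial of exponent \<open>s - word_deg w\<close>. These are ordered as in
  Schreyer's theorem.
\<close>

definition key :: "expvec \<Rightarrow> expvec list \<Rightarrow> xmonom" where
  "key s w = std (s - word_deg w) + word_monom w"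

text \<open>The keys of \<open>words_at j s\<close> all have the same image in the base ring and are
  told apart only as monomials of the polynomial ring; the words break ties.\<close>

definition before :: "expvec \<Rightarrow> expvec list \<Rightarrow> expvec list \<Rightarrow> bool" where
  "before s w w' \<longleftrightarrow> key s w \<noteq> key s w' \<and> mle (key s w) (key s w') \<or> key s w = key s w' \<and> word_less w w'"

lemma before_irrefl [simp]: "\<not> before s w w"
  by (simp add: before_def)

lemma before_linear: "v \<in> words j \<Longrightarrow> w \<in> words j \<Longrightarrow> v = w \<or> before s v w \<or> before s w v"
  unfolding before_def using mle_linear word_less_linear words_length by metis

lemma before_mle: "w = w' \<or> before s w w' \<Longrightarrow> mle (key s w) (key s w')"
  by (auto simp: before_def mle_refl)

lemma before_trans:
  assumes "before s u v" "before s v w"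
  shows "before s u w"
proof -
  have le: "mle (key s u) (key s v)" "mle (key s v) (key s w)"
    using assms by (auto intro: before_mle)
  show ?thesis
  proof (cases "key s u = key s w")
    case True
    then have "key s u = key s v" using le mle_antisym by simp
    with True assms have "word_less u v" "word_less v w" by (auto simp: before_def)
    then have "word_less u w" by (rule word_less_trans)
    with True show ?thesis by (simp add: before_def)
  qed (use mle_trans[OF le] in \<open>simp add: before_def\<close>)
qed

lemma key_shift:
  assumes "w \<in> words_at j s" "t \<in> multidegrees"
  shows "mle (key (s + t) w) (std t + key s w)"
proof -
  obtain r where r: "r \<in> multidegrees" "s = word_deg w + r" "s - word_deg w = r"
    using assms(1) by (rule words_atE)
  have "s + t - word_deg w = r + t" by (simp add: r(2) add.assoc)
  then show ?thesis
    using mle_add[OF std_add[OF r(1) assms(2)]] by (simp add: key_def r(3) add_ac)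
qed

text \<open>Multiplication in the base ring need not respect \<open>before\<close>, as a product may
  have to be sorted again. Sorting only lowers keys, so an upper bound survives; when it is
  attained, nothing was lost and \<open>w'\<close> and \<open>w\<close> have the same key, which
  leaves the comparison of words.\<close>

lemma before_shift:
  assumes "w' \<in> words_at j s" "w' = w \<or> before s w' w" "t \<in> multidegrees"
  shows "mle (key (s + t) w') (std t + key s w)"
    "key (s + t) w' = std t + key s w \<Longrightarrow> w' = w \<or> word_less w' w"
proof -
  have 1: "mle (key (s + t) w') (std t + key s w')" by (rule key_shift[OF assms(1,3)])
  have 2: "mle (std t + key s w') (std t + key s w)"
    using mle_add[OF before_mle[OF assms(2)], of "std t"] by (simp add: add.commute)
  show "mle (key (s + t) w') (std t + key s w)" using 1 2 mle_trans by blast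
  assume "key (s + t) w' = std t + key s w"
  then have "std t + key s w = std t + key s w'" using 1 2 mle_antisym by metis
  then show "w' = w \<or> word_less w' w" using assms(2) by (auto simp: before_def)
qed

lemma key_extension:
  assumes "w \<in> words j" "z \<in> extensions w"
  shows "key (word_deg (z # w)) w = single z 1 + word_monom w"
  using extensions_bases[OF assms(2)] by (simp add: key_def word_deg_Cons)

text \<open>A multigraded submodule of the \<open>j\<close>-th free module, given by its components.
  Multiplication by a monomial shifts the multidegree and keeps the coefficient function, hence the
  inclusion of \<open>Z s\<close> in \<open>Z (s + t)\<close>. The last condition confines the
  leading terms to multiples of \<open>z\<close> times the generator \<open>w\<close> with
  \<open>z\<close> in \<open>extensions w\<close>.\<close>

definition cycle_system :: "nat \<Rightarrow> (expvec \<Rightarrow> (expvec list \<Rightarrow> 'a::field) set) \<Rightarrow> bool" where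
  "cycle_system j Z \<longleftrightarrow>
    (\<forall>s. \<forall>f\<in>Z s. \<forall>w. f w \<noteq> 0 \<longrightarrow> w \<in> words_at j s) \<and>
    (\<forall>s. (\<lambda>_. 0) \<in> Z s) \<and>
    (\<forall>s. \<forall>f\<in>Z s. \<forall>g\<in>Z s. \<forall>c. (\<lambda>w. f w + c * g w) \<in> Z s) \<and>
    (\<forall>s. \<forall>t\<in>multidegrees. Z s \<subseteq> Z (s + t)) \<and>
    (\<forall>s. \<forall>f\<in>Z s. \<forall>w. f w \<noteq> 0 \<and> (\<forall>w'. f w' \<noteq> 0 \<longrightarrow> w' = w \<or> before s w' w) \<longrightarrow>
      (\<exists>z\<in>extensions w. z \<in> keys (std (s - word_deg w))))"

text \<open>Cycles with leading term \<open>z\<close> times \<open>w\<close> and leading coefficient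
  1: a Groebner basis of the module of cycles, indexed by the words of the next length, which will
  be the columns of the next differential.\<close>

definition frame :: "nat \<Rightarrow> (expvec \<Rightarrow> (expvec list \<Rightarrow> 'a::field) set) \<Rightarrow>
    (expvec list \<Rightarrow> expvec list \<Rightarrow> 'a) \<Rightarrow> bool" where
  "frame j Z h \<longleftrightarrow> (\<forall>w\<in>words j. \<forall>z\<in>extensions w. h (z # w) \<in> Z (word_deg (z # w)) \<and> h (z # w) w = 1 \<and>
      (\<forall>w'. h (z # w) w' \<noteq> 0 \<longrightarrow> w' = w \<or> before (word_deg (z # w)) w' w))"

definition chain_space :: "nat \<Rightarrow> expvec \<Rightarrow> (expvec list \<Rightarrow> 'a::field) set" where
  "chain_space j s = {f. \<forall>w. f w \<noteq> 0 \<longrightarrow> w \<in> words_at j s}"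

definition differential :: "nat \<Rightarrow> (expvec list \<Rightarrow> expvec list \<Rightarrow> 'a::field) \<Rightarrow>
    (expvec list \<Rightarrow> 'a) \<Rightarrow> expvec list \<Rightarrow> 'a" where
  "differential j h f = (\<lambda>w. \<Sum>v\<in>words (Suc j). f v * h v w)"

lemma differential_add:
  "differential j h (\<lambda>v. f v + c * g v) w = differential j h f w + c * differential j h g w"
  by (simp add: differential_def sum.distrib sum_distrib_left algebra_simps)

lemma differential_unit:
  assumes "v \<in> words (Suc j)"
  shows "differential j h (\<lambda>v'. if v' = v then c else 0) w = c * h v w"
  using assms finite_words[of "Suc j"]
  by (simp add: differential_def if_distrib[of "\<lambda>x. x * _"] cong: if_cong)

section \<open>Induction step: from one module of cycles to the next\<close>

context
  fixes j and Z :: "expvec \<Rightarrow> (expvec list \<Rightarrow> 'a::field) set" and h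
  assumes Z: "cycle_system j Z" and h: "frame j Z h"
begin

lemma Z_words: "f \<in> Z s \<Longrightarrow> f w \<noteq> 0 \<Longrightarrow> w \<in> words_at j s"
  and Z_zero: "(\<lambda>_. 0) \<in> Z s"
  and Z_add: "f \<in> Z s \<Longrightarrow> g \<in> Z s \<Longrightarrow> (\<lambda>w. f w + c * g w) \<in> Z s"
  and Z_shift: "f \<in> Z s \<Longrightarrow> t \<in> multidegrees \<Longrightarrow> f \<in> Z (s + t)"
  using Z unfolding cycle_system_def by blast+

lemma Z_lead:
  assumes "f \<in> Z s" "f w \<noteq> 0" "\<And>w'. f w' \<noteq> 0 \<Longrightarrow> w' = w \<or> before s w' w"
  obtains z where "z \<in> extensions w" "z \<in> keys (std (s - word_deg w))"
  using Z assms unfolding cycle_system_def by blast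

lemma h_frame:
  assumes "w \<in> words j" "z \<in> extensions w"
  shows "h (z # w) \<in> Z (word_deg (z # w))" "h (z # w) w = 1"
    "h (z # w) w' \<noteq> 0 \<Longrightarrow> w' = w \<or> before (word_deg (z # w)) w' w"
  using h assms unfolding frame_def by blast+

lemma words_at_Suc:
  assumes "v \<in> words_at (Suc j) s"
  obtains z w t where "v = z # w" "w \<in> words j" "z \<in> extensions w" "z \<in> bases P" "t \<in> multidegrees"
    "s = word_deg v + t" "s - word_deg v = t" "s - word_deg w = t + (z + \<epsilon> 0)"
proof -
  from assms obtain t where t: "v \<in> words (Suc j)" "t \<in> multidegrees" "s = word_deg v + t" "s - word_deg v = t"
    by (rule words_atE)
  from t(1) obtain z w where v: "v = z # w" "w \<in> words j" "z \<in> extensions w" by (auto simp: words_Suc)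
  have "s = word_deg w + (t + (z + \<epsilon> 0))" by (simp add: t(3) v(1) word_deg_Cons add_ac)
  then have "s - word_deg w = t + (z + \<epsilon> 0)" by (metis add_diff_cancel_left')
  with that v t extensions_bases show ?thesis by blast
qed

lemma h_in_Z:
  assumes "v \<in> words_at (Suc j) s"
  shows "h v \<in> Z s"
  using assms by (rule words_at_Suc) (use h_frame(1) Z_shift in metis)

lemma differential_in_Z:
  assumes "f \<in> chain_space (Suc j) s"
  shows "differential j h f \<in> Z s"
proof -
  have "(\<lambda>w. \<Sum>v\<in>A. f v * h v w) \<in> Z s" if "finite A" for A
    using that
  proof (induction A rule: finite_induct)
    case (insert v A)
    show ?case
    proof (cases "f v = 0")
      case False
      then have "h v \<in> Z s" using assms h_in_Z by (auto simp: chain_space_def)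
      from Z_add[OF insert.IH this, of "f v"] show ?thesis
        using insert.hyps by (simp add: add.commute)
    qed (use insert in simp)
  qed (simp add: Z_zero)
  then show ?thesis using finite_words by (simp add: differential_def)
qed

text \<open>Division by the frame, from the leading word downwards, leaves no remainder. The lemma
  also records that the words stay at or below those of \<open>f\<close> and that the smallest
  available letter is used each time; \<open>frame_next\<close> needs both.\<close>

lemma reduction:
  assumes "f \<in> Z s"
  shows "\<exists>c\<in>chain_space (Suc j) s. differential j h c = f \<and>
    (\<forall>v. c v \<noteq> 0 \<longrightarrow> (\<exists>z w w0. v = z # w \<and> w \<in> words_at j s \<and> f w0 \<noteq> 0 \<and> (w = w0 \<or> before s w w0) \<and>
      z \<in> keys (std (s - word_deg w)) \<and> (\<forall>y\<in>extensions w. y \<in> keys (std (s - word_deg w)) \<longrightarrow> z \<le> y)))"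
  using assms
\<comment> \<open>The words at or below the support form a finite set, which loses the leading word
  at each division step.\<close>
proof (induction "card {w \<in> words_at j s. \<exists>w0. f w0 \<noteq> 0 \<and> (w = w0 \<or> before s w w0)}" arbitrary: f rule: less_induct)
  case less
  note fZ = less.prems
  show ?case
  proof (cases "\<exists>w. f w \<noteq> 0")
    case False
    then show ?thesis
      by (intro bexI[of _ "\<lambda>_. 0"]) (auto simp: chain_space_def differential_def fun_eq_iff)
  next
    case True
    let ?F = "{w. f w \<noteq> 0}"
    have sub: "?F \<subseteq> words_at j s" using Z_words fZ by blast
    then have "finite ?F" using finite_words_at finite_subset by blast
    moreover have "transp_on ?F (before s)" by (rule transp_onI) (rule before_trans)
    moreover have "asymp_on ?F (before s)"
      by (rule asymp_onI) (metis before_trans before_irrefl)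
    ultimately obtain w where w: "f w \<noteq> 0" "\<And>w'. f w' \<noteq> 0 \<Longrightarrow> w' \<noteq> w \<Longrightarrow> \<not> before s w w'"
      using Finite_Set.bex_max_element[of ?F "before s"] True by blast
    have lead: "w' = w \<or> before s w' w" if "f w' \<noteq> 0" for w'
      using before_linear[of w' j w s] sub w that by (auto simp: words_at_def)
    have wW: "w \<in> words_at j s" using sub w(1) by blast
    then obtain t where t: "w \<in> words j" "t \<in> multidegrees" "s = word_deg w + t" "s - word_deg w = t"
      by (rule words_atE)
    define X where "X = {z \<in> extensions w. z \<in> keys (std t)}"
    have X: "finite X" "X \<noteq> {}"
      unfolding X_def using Z_lead[OF fZ w(1) lead] t(4) by (auto intro: finite_subset[OF _ finite_keys])
    define z where "z = Min X"
    have z: "z \<in> extensions w" "z \<in> keys (std t)" using Min_in[OF X] by (auto simp: z_def X_def)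
    have zmin: "z \<le> y" if "y \<in> extensions w" "y \<in> keys (std t)" for y
      using Min_le[OF X(1), of y] that by (simp add: z_def X_def)
    obtain r where r: "r \<in> multidegrees" "t = r + (z + \<epsilon> 0)" "std t = std r + single z 1"
      by (rule std_remove_generator[OF t(2) z(2)])
    have s: "s = word_deg (z # w) + r" by (simp add: t(3) r(2) word_deg_Cons add_ac)
    have v: "z # w \<in> words (Suc j)" using t(1) z(1) by (auto simp: words_Suc)
    have vs: "z # w \<in> words_at (Suc j) s" using v r(1) s by (auto simp: words_at_def)
    have h_before: "w' = w \<or> before s w' w" if "h (z # w) w' \<noteq> 0" for w'
    proof (rule disjCI)
      assume ne: "\<not> before s w' w"
      note hz = h_frame[OF t(1) z(1)]
      note sh = before_shift[OF Z_words[OF hz(1) that] hz(3)[OF that] r(1), folded s]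
      \<comment> \<open>No sorting occurs at the leading word, since \<open>z\<close> was split off
        from the standard monomial \<open>std t\<close>; so the bound in \<open>before_shift\<close>
        is the key of \<open>w\<close> itself.\<close>
      have "key s w = std r + key (word_deg (z # w)) w"
        unfolding key_extension[OF t(1) z(1)] by (simp add: key_def t(4) r(3) add_ac)
      with sh ne show "w' = w" by (auto simp: before_def)
    qed
    define f' where "f' = (\<lambda>w'. f w' + (- f w) * h (z # w) w')"
    have f'Z: "f' \<in> Z s" unfolding f'_def by (rule Z_add[OF fZ h_in_Z[OF vs]])
    have "f' w = 0" by (simp add: f'_def h_frame(2)[OF t(1) z(1)])
    then have f'_before: "before s w' w" if "f' w' \<noteq> 0" for w'
    proof -
      have "w' \<noteq> w" using that \<open>f' w = 0\<close> by auto
      moreover have "f w' \<noteq> 0 \<or> h (z # w) w' \<noteq> 0" using that by (auto simp: f'_def)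
      ultimately show ?thesis using lead h_before by blast
    qed
    let ?below = "\<lambda>f. {w \<in> words_at j s. \<exists>w0. f w0 \<noteq> 0 \<and> (w = w0 \<or> before s w w0)}"
    have "?below f' \<subseteq> ?below f - {w}"
      using f'_before before_trans before_irrefl w(1) by blast
    moreover have "w \<in> ?below f" using wW w(1) by blast
    ultimately have "?below f' \<subset> ?below f" by blast
    then have "card (?below f') < card (?below f)"
      by (rule psubset_card_mono[rotated]) (simp add: finite_words_at)
    from less.hyps[OF this f'Z] obtain c where c: "c \<in> chain_space (Suc j) s" "differential j h c = f'"
      "\<And>v. c v \<noteq> 0 \<Longrightarrow> (\<exists>z w w0. v = z # w \<and> w \<in> words_at j s \<and> f' w0 \<noteq> 0 \<and> (w = w0 \<or> before s w w0) \<and>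
      z \<in> keys (std (s - word_deg w)) \<and> (\<forall>y\<in>extensions w. y \<in> keys (std (s - word_deg w)) \<longrightarrow> z \<le> y))"
      by blast
    define c' where "c' = (\<lambda>v. c v + f w * (if v = z # w then 1 else 0))"
    show ?thesis
    proof (intro bexI conjI allI impI)
      show "c' \<in> chain_space (Suc j) s" using c(1) vs by (auto simp: chain_space_def c'_def)
      show "differential j h c' = f"
        unfolding c'_def fun_eq_iff differential_add differential_unit[OF v] c(2) by (simp add: f'_def)
      fix v assume "c' v \<noteq> 0"
      then consider "v = z # w" | "c v \<noteq> 0" by (auto simp: c'_def split: if_splits)
      then show "\<exists>z w w0. v = z # w \<and> w \<in> words_at j s \<and> f w0 \<noteq> 0 \<and> (w = w0 \<or> before s w w0) \<and>
          z \<in> keys (std (s - word_deg w)) \<and> (\<forall>y\<in>extensions w. y \<in> keys (std (s - word_deg w)) \<longrightarrow> z \<le> y)"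
      proof cases
        case 1
        then show ?thesis using wW w(1) z(2) zmin t(4) by blast
      next
        case 2
        from c(3)[OF this] obtain z' w' w0 where *: "v = z' # w'" "w' \<in> words_at j s" "f' w0 \<noteq> 0"
          "w' = w0 \<or> before s w' w0" "z' \<in> keys (std (s - word_deg w'))"
          "\<forall>y\<in>extensions w'. y \<in> keys (std (s - word_deg w')) \<longrightarrow> z' \<le> y" by blast
        have "before s w' w" using *(4) f'_before[OF *(3)] before_trans by blast
        with * w(1) show ?thesis by blast
      qed
    qed
  qed
qed

lemma differential_image: "differential j h ` chain_space (Suc j) s = Z s"
  using differential_in_Z reduction by blast

definition next_cycles :: "expvec \<Rightarrow> (expvec list \<Rightarrow> 'a) set" where
  "next_cycles s = {f \<in> chain_space (Suc j) s. differential j h f = (\<lambda>_. 0)}"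

text \<open>If no extension of \<open>v = z # w\<close> divided its coefficient, the product with
  \<open>z\<close> would need no sorting, and the term of \<open>v\<close> would survive in the
  differential at \<open>w\<close>: any other word contributing there would tie with
  \<open>v\<close> and be \<open>z' # w\<close> with \<open>z' < z\<close>, and then
  \<open>z'\<close> would be an extension of \<open>v\<close> dividing the coefficient.\<close>

lemma next_lead:
  assumes f: "f \<in> next_cycles s" and v: "f v \<noteq> 0" "\<And>v'. f v' \<noteq> 0 \<Longrightarrow> v' = v \<or> before s v' v"
  shows "\<exists>y\<in>extensions v. y \<in> keys (std (s - word_deg v))"
proof (rule ccontr)
  assume none: "\<not> ?thesis"
  have fs: "v' \<in> words_at (Suc j) s" if "f v' \<noteq> 0" for v'
    using f that by (auto simp: next_cycles_def chain_space_def)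
  from fs[OF v(1)] obtain z w t where
    zw: "v = z # w" "w \<in> words j" "z \<in> extensions w" "z \<in> bases P" "t \<in> multidegrees"
    "s = word_deg v + t" "s - word_deg v = t" "s - word_deg w = t + (z + \<epsilon> 0)"
    by (rule words_at_Suc)
  have "\<not> unsorted y z" if "y \<in> keys (std t)" for y
  proof
    assume "unsorted y z"
    moreover have "y \<in> bases P" using that std(1)[OF zw(5)] by (auto simp: standard_def xmonoms_def)
    ultimately show False using none that zw(1,7) by auto
  qed
  then have std: "std (s - word_deg w) = std t + single z 1"
    unfolding zw(8) by (rule std_add_generator[OF zw(5,4)])
  then have key: "key s w = key s v" by (simp add: key_def zw(1) zw(7)[unfolded zw(1)] add_ac)
  have "h v' w = 0" if v': "f v' \<noteq> 0" "v' \<noteq> v" for v'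
  proof (rule ccontr)
    assume hw: "h v' w \<noteq> 0"
    from fs[OF v'(1)] obtain z' w' t' where
      zw': "v' = z' # w'" "w' \<in> words j" "z' \<in> extensions w'" "z' \<in> bases P" "t' \<in> multidegrees"
      "s = word_deg v' + t'" "s - word_deg v' = t'" "s - word_deg w' = t' + (z' + \<epsilon> 0)"
      by (rule words_at_Suc)
    note hv = h_frame[OF zw'(2,3), folded zw'(1)]
    note sh = before_shift[OF Z_words[OF hv(1) hw] hv(3)[OF hw] zw'(5), folded zw'(6)]
    have key': "std t' + key (word_deg v') w' = key s v'"
      unfolding zw'(1) key_extension[OF zw'(2,3)] by (simp add: key_def zw'(7)[unfolded zw'(1)])
    have bv: "before s v' v" using v(2)[OF v'(1)] v'(2) by simp
    then have "mle (key s v') (key s v)" by (simp add: before_mle)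
    with sh(1) key key' have keq: "key s v' = key s v" using mle_antisym by metis
    \<comment> \<open>The tie in the keys leaves comparisons of words in both directions, so the
      tails coincide.\<close>
    then have "w = w' \<or> word_less w w'" using sh(2) key key' by simp
    moreover have "word_less v' v" using bv keq by (simp add: before_def)
    ultimately have "w' = w" "z' < z"
      using word_less_trans[of w w' w] word_less_irrefl by (auto simp: zw(1) zw'(1))
    have "std t' + single z' 1 = std t + single z 1"
      using keq zw(7)[unfolded zw(1)] zw'(7)[unfolded zw'(1) \<open>w' = w\<close>]
      by (simp add: key_def zw(1) zw'(1) \<open>w' = w\<close> flip: add.assoc)
    then have "z' \<in> keys (std t + single z 1)" by (metis keys_plus_nat UnI2 keys_single insertI1 one_neq_zero)
    then have "z' \<in> keys (std t)" using \<open>z' < z\<close> by (auto simp: keys_plus_nat)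
    moreover have "z' \<in> extensions v" using zw'(3) \<open>w' = w\<close> \<open>z' < z\<close> by (simp add: zw(1))
    ultimately show False using none zw(7) by blast
  qed
  then have "differential j h f w = (\<Sum>v'\<in>words (Suc j). if v' = v then f v * h v w else 0)"
    unfolding differential_def by (intro sum.cong) auto
  also have "\<dots> = f v"
    using finite_words[of "Suc j"] fs[OF v(1)] h_frame(2)[OF zw(2,3)] by (simp add: words_at_def zw(1))
  finally show False using f v(1) by (simp add: next_cycles_def)
qed

lemma cycle_system_next: "cycle_system (Suc j) next_cycles"
  unfolding cycle_system_def
proof (intro conjI allI ballI impI)
  show "\<exists>z\<in>extensions w. z \<in> keys (std (s - word_deg w))"
    if "f \<in> next_cycles s" "f w \<noteq> 0 \<and> (\<forall>w'. f w' \<noteq> 0 \<longrightarrow> w' = w \<or> before s w' w)" for s f w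
    using next_lead that by blast
  show "(\<lambda>w. f w + c * g w) \<in> next_cycles s" if "f \<in> next_cycles s" "g \<in> next_cycles s" for s f g c
    using that by (auto simp: next_cycles_def chain_space_def fun_eq_iff differential_add) force
  show "next_cycles s \<subseteq> next_cycles (s + t)" if "t \<in> multidegrees" for s t
    using that words_at_add by (auto simp: next_cycles_def chain_space_def)
qed (auto simp: next_cycles_def chain_space_def differential_def)

text \<open>The analogue of reducing an S-polynomial: multiply \<open>h v\<close> by
  \<open>y\<close>, divide by the frame, and subtract the quotient from \<open>y\<close> times
  \<open>v\<close>. The point is that every word of the quotient comes before
  \<open>v\<close>.\<close>

lemma frame_next: "\<exists>h'. frame (Suc j) next_cycles h'"
proof -
  have "\<exists>g. g \<in> next_cycles (word_deg (y # v)) \<and> g v = 1 \<and>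
      (\<forall>v'. g v' \<noteq> 0 \<longrightarrow> v' = v \<or> before (word_deg (y # v)) v' v)"
    if v: "v \<in> words (Suc j)" and y: "y \<in> extensions v" for v y
  proof -
    let ?s = "word_deg (y # v)"
    have yB: "y \<in> bases P" using y by (rule extensions_bases)
    have t: "y + \<epsilon> 0 \<in> multidegrees" using multidegrees_generator[OF yB] .
    have s: "?s = word_deg v + (y + \<epsilon> 0)" by (rule word_deg_Cons)
    obtain z w where zw: "v = z # w" "w \<in> words j" "z \<in> extensions w" using v by (auto simp: words_Suc)
    have zB: "z \<in> bases P" using zw(3) by (rule extensions_bases)
    note hv = h_frame[OF zw(2,3), folded zw(1)]
    have vs: "v \<in> words_at (Suc j) ?s" using v t s by (auto simp: words_at_def)
    obtain c where c: "c \<in> chain_space (Suc j) ?s" "differential j h c = h v"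
      "\<And>v'. c v' \<noteq> 0 \<Longrightarrow> (\<exists>z w w0. v' = z # w \<and> w \<in> words_at j ?s \<and> h v w0 \<noteq> 0 \<and> (w = w0 \<or> before ?s w w0) \<and>
      z \<in> keys (std (?s - word_deg w)) \<and> (\<forall>y\<in>extensions w. y \<in> keys (std (?s - word_deg w)) \<longrightarrow> z \<le> y))"
      using reduction[OF h_in_Z[OF vs]] by blast
    have c_before: "before ?s v' v" if cv: "c v' \<noteq> 0" for v'
    proof -
      from c(3)[OF cv] obtain z' w' w0 where *: "v' = z' # w'" "w' \<in> words_at j ?s" "h v w0 \<noteq> 0"
        "w' = w0 \<or> before ?s w' w0" "z' \<in> keys (std (?s - word_deg w'))"
        "\<forall>y\<in>extensions w'. y \<in> keys (std (?s - word_deg w')) \<longrightarrow> z' \<le> y" by blast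
      obtain r where r: "w' \<in> words j" "r \<in> multidegrees" "?s = word_deg w' + r" "?s - word_deg w' = r"
        using *(2) by (rule words_atE)
      obtain q where q: "q \<in> multidegrees" "r = q + (z' + \<epsilon> 0)" "std r = std q + single z' 1"
        using std_remove_generator[OF r(2)] *(5) r(4) by metis
      have "word_deg w' + r = word_deg v' + q"
        unfolding q(2) *(1) word_deg_Cons by (simp only: add_ac)
      then have "?s = word_deg v' + q" using r(3) by simp
      then have "?s - word_deg v' = q" by simp
      then have kv': "key ?s v' = key ?s w'" by (simp add: key_def r(4) q(3) *(1) add_ac)
      have "?s - word_deg v = y + \<epsilon> 0" by (simp add: s)
      then have kv: "key ?s v = std (y + \<epsilon> 0) + key (word_deg v) w"
        using yB key_extension[OF zw(2,3)] by (simp add: key_def zw(1))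
      note sh = before_shift[OF Z_words[OF hv(1) *(3)] hv(3)[OF *(3)] t, folded s kv]
      have m1: "mle (key ?s w') (key ?s w0)" using *(4) by (rule before_mle)
      have m: "mle (key ?s v') (key ?s v)" unfolding kv' using m1 sh(1) by (rule mle_trans)
      show ?thesis
      proof (cases "key ?s v' = key ?s v")
        case True
        then have keq: "key ?s w' = key ?s w0" "key ?s w0 = key ?s v"
          using m1 sh(1) kv' mle_antisym by metis+
        have "w' = w0 \<or> word_less w' w0" using *(4) keq(1) by (auto simp: before_def)
        then have "w' = w \<or> word_less w' w" using sh(2)[OF keq(2)] word_less_trans by blast
        \<comment> \<open>Here \<open>y\<close> and \<open>z\<close> are factors of one standard
          monomial, so \<open>y\<close> can extend \<open>v\<close> only as an extension of
          \<open>w\<close> smaller than \<open>z\<close>. The division chose the smallest letter,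
          hence \<open>z' \<le> y < z\<close>.\<close>
        moreover have "z' < z" if "w' = w"
        proof -
          have "key ?s w' = single y 1 + single z 1 + word_monom w"
            using keq kv yB key_extension[OF zw(2,3)] by (simp add: zw(1) add.assoc)
          then have "std r + word_monom w' = single y 1 + single z 1 + word_monom w"
            unfolding key_def r(4) .
          then have sr: "std r = single y 1 + single z 1" using that by simp
          then have "\<not> unsorted y z" using std(1)[OF r(2)] by (auto simp: standard_def keys_plus_nat)
          then have "y \<in> extensions w" "y < z" using y by (auto simp: zw(1))
          moreover have "y \<in> keys (std r)" unfolding sr by (simp add: keys_plus_nat)
          ultimately show ?thesis using *(6) r(4) that by fastforce
        qed
        ultimately have "word_less v' v" by (auto simp: *(1) zw(1))
        with True show ?thesis by (simp add: before_def)
      qed (use m in \<open>simp add: before_def\<close>)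
    qed
    define g where "g = (\<lambda>v'. (if v' = v then 1 else 0) + (- 1) * c v')"
    have "c v = 0" using c_before[of v] by auto
    moreover have "g \<in> next_cycles ?s"
      unfolding next_cycles_def g_def mem_Collect_eq fun_eq_iff differential_add differential_unit[OF v] c(2)
      using vs c(1) by (auto simp: chain_space_def)
    ultimately show ?thesis
      using c_before by (intro exI[of _ g]) (auto simp: g_def)
  qed
  then have "\<exists>g. \<forall>v\<in>words (Suc j). \<forall>y\<in>extensions v. g v y \<in> next_cycles (word_deg (y # v)) \<and> g v y v = 1 \<and>
      (\<forall>v'. g v y v' \<noteq> 0 \<longrightarrow> v' = v \<or> before (word_deg (y # v)) v' v)"
    by metis
  then obtain g where "\<forall>v\<in>words (Suc j). \<forall>y\<in>extensions v. g v y \<in> next_cycles (word_deg (y # v)) \<and> g v y v = 1 \<and>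
      (\<forall>v'. g v y v' \<noteq> 0 \<longrightarrow> v' = v \<or> before (word_deg (y # v)) v' v)"
    by blast
  then show ?thesis
    by (intro exI[of _ "\<lambda>v. g (tl v) (hd v)"]) (simp add: frame_def)
qed

end

text \<open>The kernel of the augmentation, spanned by the monomials other than 1; the empty word is
  the only generator in this place.\<close>

definition augmented_cycles :: "expvec \<Rightarrow> (expvec list \<Rightarrow> 'a::field) set" where
  "augmented_cycles s = {f \<in> chain_space 0 s. s = 0 \<longrightarrow> f [] = 0}"

lemma cycle_system_augmented: "cycle_system 0 (augmented_cycles :: expvec \<Rightarrow> (expvec list \<Rightarrow> 'a::field) set)"
  unfolding cycle_system_def
proof (intro conjI allI ballI impI)
  fix s w and f :: "expvec list \<Rightarrow> 'a"
  assume f: "f \<in> augmented_cycles s" "f w \<noteq> 0 \<and> (\<forall>w'. f w' \<noteq> 0 \<longrightarrow> w' = w \<or> before s w' w)"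
  then have "w \<in> words_at 0 s" by (auto simp: augmented_cycles_def chain_space_def)
  then have w: "w = []" "s \<in> multidegrees" by (auto simp: words_at_def)
  then have "s \<noteq> 0" using f by (auto simp: augmented_cycles_def)
  then have "std s \<noteq> 0" using std(2)[OF w(2)] by auto
  then obtain z where "z \<in> keys (std s)"
    by (metis in_keys_iff lookup_zero poly_mapping_eqI)
  moreover have "keys (std s) \<subseteq> bases P" using std(1)[OF w(2)] by (simp add: standard_def xmonoms_def)
  ultimately show "\<exists>z\<in>extensions w. z \<in> keys (std (s - word_deg w))" by (auto simp: w)
next
  fix s t assume t: "t \<in> multidegrees"
  have "s = 0" if "s + t = 0"
    using arg_cong[OF that, of modulus] by (simp add: modulus_add)
  then show "(augmented_cycles s :: (expvec list \<Rightarrow> 'a) set) \<subseteq> augmented_cycles (s + t)"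
    using words_at_add[OF _ t] by (auto simp: augmented_cycles_def chain_space_def)
next
  fix s c and f g :: "expvec list \<Rightarrow> 'a"
  assume "f \<in> augmented_cycles s" "g \<in> augmented_cycles s"
  then show "(\<lambda>w. f w + c * g w) \<in> augmented_cycles s"
    by (auto simp: augmented_cycles_def chain_space_def) force+
qed (auto simp: augmented_cycles_def chain_space_def)

text \<open>The first differential sends the word \<open>[z]\<close> to the generator of the base
  ring belonging to \<open>z\<close>; in the multidegree of \<open>[z]\<close> this is the
  coefficient 1 at the empty word.\<close>

lemma frame_augmented: "frame 0 augmented_cycles (\<lambda>v w. if w = [] then 1 else 0)"
proof -
  have "z + single 0 (Suc 0) \<noteq> 0" for z :: expvec
  proof
    assume "z + single 0 (Suc 0) = 0"
    from arg_cong[OF this, of modulus] show False by (simp add: modulus_add)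
  qed
  then show ?thesis
    by (auto simp: frame_def augmented_cycles_def chain_space_def words_at_def word_deg_Cons
        intro!: bexI[of _ "_ + _"] multidegrees_generator[simplified])
qed

theorem exact_frame:
  obtains h :: "nat \<Rightarrow> expvec list \<Rightarrow> expvec list \<Rightarrow> 'a::field"
  where "\<And>s. differential 0 (h 0) ` chain_space 1 s = augmented_cycles s"
    "\<And>j s. differential (Suc j) (h (Suc j)) ` chain_space (Suc (Suc j)) s =
      {f \<in> chain_space (Suc j) s. differential j (h j) f = (\<lambda>_. 0)}"
    "\<And>j v w. v \<in> words (Suc j) \<Longrightarrow> h j v w \<noteq> 0 \<Longrightarrow> w \<in> words_at j (word_deg v)"
proof -
  define good where "good j x \<longleftrightarrow> (case x of (Z, h) \<Rightarrow> cycle_system j Z \<and> frame j Z h)"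
    for j and x :: "(expvec \<Rightarrow> (expvec list \<Rightarrow> 'a) set) \<times> (expvec list \<Rightarrow> expvec list \<Rightarrow> 'a)"
  have "\<exists>y. good (Suc j) y \<and> fst y = (\<lambda>s. {f \<in> chain_space (Suc j) s. differential j (snd x) f = (\<lambda>_. 0)})"
    if "good j x" for j x
  proof -
    obtain Z h where x: "x = (Z, h)" by (cases x)
    with that have Zh: "cycle_system j Z" "frame j Z h" by (auto simp: good_def)
    obtain h' where h': "frame (Suc j) (next_cycles j h) h'" using frame_next[OF Zh] by blast
    show ?thesis
      by (rule exI[of _ "(next_cycles j h, h')"])
        (use h' cycle_system_next[OF Zh] in \<open>auto simp: good_def x next_cycles_def[OF Zh]\<close>)
  qed
  \<comment> \<open>The choice runs over pairs, because the cycles of the next stage are those of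
    the differential defined by the chosen frame.\<close>
  then have "\<exists>F. \<forall>j. (good j (F j) \<and> (j = 0 \<longrightarrow> F j = (augmented_cycles, \<lambda>v w. if w = [] then 1 else 0))) \<and>
      fst (F (Suc j)) = (\<lambda>s. {f \<in> chain_space (Suc j) s. differential j (snd (F j)) f = (\<lambda>_. 0)})"
    using cycle_system_augmented frame_augmented
    by (intro dependent_nat_choice) (auto simp: good_def)
  then obtain F where F: "\<And>j. good j (F j)" "F 0 = (augmented_cycles, \<lambda>v w. if w = [] then 1 else 0)"
    "\<And>j. fst (F (Suc j)) = (\<lambda>s. {f \<in> chain_space (Suc j) s. differential j (snd (F j)) f = (\<lambda>_. 0)})"
    by blast
  have F': "cycle_system j (fst (F j))" "frame j (fst (F j)) (snd (F j))" for j
    using F(1)[of j] by (auto simp: good_def split: prod.splits)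
  note image = differential_image[OF F']
  show ?thesis
  proof (rule that[of "\<lambda>j. snd (F j)"])
    show "differential 0 (snd (F 0)) ` chain_space 1 s = augmented_cycles s" for s
      using image[of 0 s] F(2) by simp
    show "differential (Suc j) (snd (F (Suc j))) ` chain_space (Suc (Suc j)) s =
        {f \<in> chain_space (Suc j) s. differential j (snd (F j)) f = (\<lambda>_. 0)}" for j s
      using image[of "Suc j" s] F(3) by simp
    show "w \<in> words_at j (word_deg v)" if "v \<in> words (Suc j)" "snd (F j) v w \<noteq> 0" for j v w
    proof -
      obtain z u where "v = z # u" "u \<in> words j" "z \<in> extensions u" using \<open>v \<in> words (Suc j)\<close> by (auto simp: words_Suc)
      with h_frame(1)[OF F'] Z_words[OF F'] that(2) show ?thesis by metis
    qed
  qed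
qed

end

section \<open>Translation into matrices over the base ring\<close>

context strong_polymatroid
begin

definition base_carrier :: "'a::field ts_poly set" where
  "base_carrier = {f. keys f \<subseteq> multidegrees}"

lemma base_carrier_0: "0 \<in> base_carrier"
  and base_carrier_add: "f \<in> base_carrier \<Longrightarrow> g \<in> base_carrier \<Longrightarrow> f + g \<in> base_carrier"
  and base_carrier_uminus: "f \<in> base_carrier \<Longrightarrow> - f \<in> base_carrier"
  and base_carrier_single: "s \<in> multidegrees \<Longrightarrow> single s c \<in> base_carrier"
  using keys_add[of f g] by (auto simp: base_carrier_def in_keys_iff)

lemma base_carrier_mult: "f \<in> base_carrier \<Longrightarrow> g \<in> base_carrier \<Longrightarrow> f * g \<in> base_carrier"
  using keys_mult[of f g] multidegrees_add by (fastforce simp: base_carrier_def)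

lemma base_carrier_sum: "(\<And>x. x \<in> A \<Longrightarrow> f x \<in> base_carrier) \<Longrightarrow> sum f A \<in> base_carrier"
  by (induction A rule: infinite_finite_induct) (auto simp: base_carrier_0 base_carrier_add)

lemma carrier_base_ring: "carrier (base_ring (bases P)) = (base_carrier :: 'a::field ts_poly set)"
proof -
  let ?X = "range (single 0) \<union> tu_s ` bases P :: 'a ts_poly set"
  let ?G = "generate_ring (ring_on UNIV) ?X"
  have cr: "cring (ring_on (UNIV :: 'a ts_poly set))"
    by (rule cring_ring_on) auto
  have "f \<in> base_carrier" if "f \<in> ?G" for f
    using that
  proof (induction f rule: generate_ring.induct)
    case one
    then show ?case by (simp add: base_carrier_def)
  next
    case (incl f)
    then show ?case
      by (auto simp: tu_s_def intro!: base_carrier_single multidegrees_generator[simplified])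
  qed (simp_all add: a_inv_ring_on[OF cr] base_carrier_add base_carrier_mult base_carrier_uminus)
  moreover have "f \<in> ?G" if "f \<in> base_carrier" for f
  proof -
    have add: "x + y \<in> ?G" if "x \<in> ?G" "y \<in> ?G" for x y
      using generate_ring.eng_add[OF that] by simp
    have mult: "x * y \<in> ?G" if "x \<in> ?G" "y \<in> ?G" for x y
      using generate_ring.eng_mult[OF that] by simp
    have const: "single 0 c \<in> ?G" for c by (rule generate_ring.incl) simp
    have "single (fibre_sum m) c \<in> ?G" if "m \<in> xmonoms (bases P)" for m c
      using that
    proof (induction m rule: exponent_induct)
      case (add m u)
      have "tu_s u \<in> ?G" by (rule generate_ring.incl) (use add in auto)
      then have "single (fibre_sum m) c * tu_s u \<in> ?G" by (intro mult) (use add in auto)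
      then show ?case by (simp add: tu_s_def mult_single fibre_sum_add)
    qed (simp add: const)
    then have monom: "single s c \<in> ?G" if "s \<in> multidegrees" for s c
      using that by (auto simp: multidegrees_def)
    have "(\<Sum>s\<in>T. single s (lookup f s)) \<in> ?G" if "finite T" "T \<subseteq> multidegrees" for T
      using that const[of 0] by (induction T rule: finite_induct) (auto intro: add monom)
    from this[of "keys f"] show "f \<in> ?G"
      using that poly_mapping_sum_single[of f] by (simp add: base_carrier_def)
  qed
  ultimately show ?thesis by (auto simp: base_ring_def)
qed

lemma free_module_eq: "free_module (bases P) k = {f \<in> carrier_vec k. \<forall>i<k. f $ i \<in> base_carrier}"
  by (auto simp: free_module_def carrier_base_ring vec_set_def)

lemma lookup_fibre_sum_0: "m \<in> xmonoms (bases P) \<Longrightarrow> lookup (fibre_sum m) 0 = modulus m"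
  using vsum_keys[of m] by (auto simp: fibre_sum_eq lookup_add in_keys_iff subset_iff)

lemma word_monom_xmonoms: "w \<in> words j \<Longrightarrow> word_monom w \<in> xmonoms (bases P)"
  by (induction j arbitrary: w) (auto simp: words_Suc extensions_bases)

text \<open>The source of linearity: each letter contributes one factor \<open>s\<close>, so a
  nonzero matrix entry between words of consecutive lengths has degree 1.\<close>

lemma lookup_word_deg_0:
  assumes "w \<in> words j"
  shows "lookup (word_deg w) 0 = j"
proof -
  have "modulus (word_monom w) = length w" by (induction w) (auto simp: modulus_add)
  then show ?thesis
    using lookup_fibre_sum_0[OF word_monom_xmonoms[OF assms]] words_length[OF assms]
    by (simp add: word_deg_def)
qed

definition word_list :: "nat \<Rightarrow> expvec list list" where
  "word_list j = (SOME ws. set ws = words j \<and> distinct ws)"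

lemma word_list: "set (word_list j) = words j" "distinct (word_list j)"
  using someI_ex[OF finite_distinct_list[OF finite_words[of j]]] by (simp_all add: word_list_def)

definition rank :: "nat \<Rightarrow> nat" where
  "rank j = length (word_list j)"

definition word_index :: "nat \<Rightarrow> expvec list \<Rightarrow> nat" where
  "word_index j w = (THE p. p < rank j \<and> word_list j ! p = w)"

lemma word_index_nth: "p < rank j \<Longrightarrow> word_index j (word_list j ! p) = p"
  unfolding word_index_def rank_def by (rule the_equality) (auto simp: nth_eq_iff_index_eq[OF word_list(2)])

lemma nth_word: "p < rank j \<Longrightarrow> word_list j ! p \<in> words j"
  using word_list(1)[of j] nth_mem by (auto simp: rank_def)

lemma word_index: "w \<in> words j \<Longrightarrow> word_index j w < rank j \<and> word_list j ! word_index j w = w"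
  using word_list(1)[of j] word_index_nth by (metis in_set_conv_nth rank_def)

lemma sum_words: "(\<Sum>p\<in>{0..<rank j}. g (word_list j ! p)) = (\<Sum>w\<in>words j. g w)"
  by (rule sum.reindex_bij_betw, rule bij_betw_nth) (auto simp: word_list rank_def)

text \<open>The part of \<open>f\<close> in multidegree \<open>s\<close>, where the generator
  \<open>w\<close> sits in multidegree \<open>word_deg w\<close>. It passes from vectors of
  polynomials to the coefficient functions used so far.\<close>

definition component :: "nat \<Rightarrow> 'a::field ts_poly vec \<Rightarrow> expvec \<Rightarrow> expvec list \<Rightarrow> 'a" where
  "component j f s w =
    (if w \<in> words_at j s then lookup (f $ word_index j w) (s - word_deg w) else 0)"

lemma component_chain_space: "component j f s \<in> chain_space j s"
  by (auto simp: chain_space_def component_def)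

lemma component_zero: "component j (0\<^sub>v (rank j)) s = (\<lambda>_. 0)"
  using word_index by (auto simp: component_def words_at_def fun_eq_iff)

lemma component_inject:
  assumes "f \<in> free_module (bases P) (rank j)" "g \<in> free_module (bases P) (rank j)"
    and eq: "\<And>s. component j f s = component j g s"
  shows "f = g"
proof (rule eq_vecI)
  show "dim_vec f = dim_vec g" using assms by (auto simp: free_module_eq)
  fix p assume "p < dim_vec g"
  then have p: "p < rank j" using assms by (auto simp: free_module_eq)
  show "f $ p = g $ p"
  proof (rule poly_mapping_eqI)
    fix t
    show "lookup (f $ p) t = lookup (g $ p) t"
    proof (cases "t \<in> multidegrees")
      case True
      let ?w = "word_list j ! p"
      have "?w \<in> words_at j (word_deg ?w + t)" using True nth_word[OF p] by (auto simp: words_at_def)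
      then show ?thesis
        using fun_cong[OF eq[of "word_deg ?w + t"], of ?w] by (simp add: component_def word_index_nth[OF p])
    next
      case False
      then have "t \<notin> keys (f $ p)" "t \<notin> keys (g $ p)"
        using assms p by (auto simp: free_module_eq base_carrier_def)
      then show ?thesis by (simp add: in_keys_iff)
    qed
  qed
qed

text \<open>Only finitely many nonzero components can be assembled into one vector, since its
  entries have finite support.\<close>

lemma component_surj:
  assumes c: "\<And>s. c s \<in> chain_space j s" and fin: "finite T" "\<And>s. s \<notin> T \<Longrightarrow> c s = (\<lambda>_. 0)"
  obtains g where "g \<in> free_module (bases P) (rank j)" "\<And>s. component j g s = c s"
proof
  define g where "g = vec (rank j) (\<lambda>p. \<Sum>s\<in>T. single (s - word_deg (word_list j ! p)) (c s (word_list j ! p)))"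
  have cw: "w \<in> words_at j s" if "c s w \<noteq> 0" for s w
    using c[of s] that by (auto simp: chain_space_def)
  have "single (s - word_deg w) (c s w) \<in> base_carrier" for s w
  proof (cases "c s w = 0")
    case False
    then show ?thesis using cw[OF False] by (auto simp: words_at_def intro: base_carrier_single)
  qed (simp add: base_carrier_0)
  then show "g \<in> free_module (bases P) (rank j)"
    by (auto simp: free_module_eq g_def intro!: base_carrier_sum)
  show "component j g s = c s" for s
  proof
    fix w show "component j g s w = c s w"
    proof (cases "w \<in> words_at j s")
      case False
      then show ?thesis using cw[of s w] by (auto simp: component_def)
    next
      case True
      then have w: "w \<in> words j" by (simp add: words_at_def)
      have "component j g s w = (\<Sum>s'\<in>T. lookup (single (s' - word_deg w) (c s' w)) (s - word_deg w))"
        using True word_index[OF w] by (simp add: component_def g_def lookup_sum)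
      also have "\<dots> = (\<Sum>s'\<in>T. if s' = s then c s w else 0)"
      proof (rule sum.cong[OF refl])
        fix s'
        have "s' = s" if "c s' w \<noteq> 0" "s' - word_deg w = s - word_deg w"
          using cw[OF that(1)] True that(2) by (auto simp: words_at_def)
        then show "lookup (single (s' - word_deg w) (c s' w)) (s - word_deg w) = (if s' = s then c s w else 0)"
          by (cases "c s' w = 0") (auto simp: lookup_single when_def)
      qed
      also have "\<dots> = c s w" using fin by auto
      finally show ?thesis .
    qed
  qed
qed

lemma finite_components: "finite {s. component j f s \<noteq> (\<lambda>_. 0)}"
proof (rule finite_subset)
  show "{s. component j f s \<noteq> (\<lambda>_. 0)} \<subseteq>
      (\<Union>w\<in>words j. (\<lambda>t. word_deg w + t) ` keys (f $ word_index j w))"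
  proof
    fix s assume "s \<in> {s. component j f s \<noteq> (\<lambda>_. 0)}"
    then obtain w where w: "component j f s w \<noteq> 0" by (auto simp: fun_eq_iff)
    then have "w \<in> words_at j s" "lookup (f $ word_index j w) (s - word_deg w) \<noteq> 0"
      by (auto simp: component_def split: if_splits)
    moreover from this(1) obtain t where "w \<in> words j" "s = word_deg w + t" "s - word_deg w = t"
      by (rule words_atE)
    ultimately show "s \<in> (\<Union>w\<in>words j. (\<lambda>t. word_deg w + t) ` keys (f $ word_index j w))"
      by (auto simp: in_keys_iff intro!: bexI[of _ w])
  qed
  show "finite (\<Union>w\<in>words j. (\<lambda>t. word_deg w + t) ` keys (f $ word_index j w))"
    by (intro finite_UN_I finite_words finite_imageI finite_keys)
qed

lemma lookup_single_mult:
  fixes g :: "'m::cancel_comm_monoid_add \<Rightarrow>\<^sub>0 'a::comm_ring_1"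
  shows "lookup (single e c * g) (e + t) = c * lookup g t"
proof -
  have "single e c * g = (\<Sum>q\<in>keys g. single (e + q) (c * lookup g q))"
    by (subst poly_mapping_sum_single[of g]) (simp add: sum_distrib_left mult_single)
  then have "lookup (single e c * g) (e + t) = (\<Sum>q\<in>keys g. if q = t then c * lookup g t else 0)"
    by (auto simp: lookup_sum lookup_single when_def intro!: sum.cong)
  then show ?thesis by (auto simp: in_keys_iff)
qed

text \<open>The subtraction in the exponent is truncated. This is harmless for the \<open>h\<close>
  considered below: a nonzero coefficient puts the row word into \<open>words_at j\<close> of the
  degree of the column word, and for coefficient 0 the entry is 0.\<close>

definition boundary :: "nat \<Rightarrow> (expvec list \<Rightarrow> expvec list \<Rightarrow> 'a::field) \<Rightarrow> 'a ts_poly mat" where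
  "boundary j h = mat (rank j) (rank (Suc j)) (\<lambda>(p, q).
    single (word_deg (word_list (Suc j) ! q) - word_deg (word_list j ! p)) (h (word_list (Suc j) ! q) (word_list j ! p)))"

context
  fixes j and h :: "expvec list \<Rightarrow> expvec list \<Rightarrow> 'a::field"
  assumes h: "\<And>v w. v \<in> words (Suc j) \<Longrightarrow> h v w \<noteq> 0 \<Longrightarrow> w \<in> words_at j (word_deg v)"
begin

lemma boundary_entries: "elements_mat (boundary j h) \<subseteq> base_ring_degree (bases P) 1"
proof
  fix x assume "x \<in> elements_mat (boundary j h)"
  then obtain p q where pq: "p < rank j" "q < rank (Suc j)"
    and x: "x = boundary j h $$ (p, q)"
    by (auto simp: elements_mat_def boundary_def)
  let ?v = "word_list (Suc j) ! q" and ?w = "word_list j ! p"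
  have x: "x = single (word_deg ?v - word_deg ?w) (h ?v ?w)" using x pq by (simp add: boundary_def)
  show "x \<in> base_ring_degree (bases P) 1"
  proof (cases "h ?v ?w = 0")
    case True
    then show ?thesis by (simp add: x base_ring_degree_def carrier_base_ring base_carrier_0)
  next
    case False
    from h[OF nth_word[OF pq(2)] False] obtain e where
      e: "e \<in> multidegrees" "word_deg ?v = word_deg ?w + e" "word_deg ?v - word_deg ?w = e"
      by (rule words_atE)
    have "lookup e 0 = 1"
      using arg_cong[OF e(2), of "\<lambda>s. lookup s 0"] lookup_word_deg_0[OF nth_word[OF pq(1)]]
        lookup_word_deg_0[OF nth_word[OF pq(2)]] by (simp add: lookup_add)
    then show ?thesis
      using base_carrier_single[OF e(1), of "h ?v ?w"]
      by (auto simp: x e(3) base_ring_degree_def carrier_base_ring)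
  qed
qed

lemma boundary_index:
  assumes f: "f \<in> free_module (bases P) (rank (Suc j))" and p: "p < rank j"
  shows "(boundary j h *\<^sub>v f) $ p = (\<Sum>v\<in>words (Suc j).
    single (word_deg v - word_deg (word_list j ! p)) (h v (word_list j ! p)) * f $ word_index (Suc j) v)"
proof -
  have d: "dim_vec f = rank (Suc j)" using f by (auto simp: free_module_eq)
  have "(boundary j h *\<^sub>v f) $ p = (\<Sum>q\<in>{0..<rank (Suc j)}. boundary j h $$ (p, q) * f $ q)"
    using p by (simp add: boundary_def scalar_prod_def d)
  also have "\<dots> = (\<Sum>q\<in>{0..<rank (Suc j)}.
      single (word_deg (word_list (Suc j) ! q) - word_deg (word_list j ! p))
        (h (word_list (Suc j) ! q) (word_list j ! p)) * f $ word_index (Suc j) (word_list (Suc j) ! q))"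
    using p by (intro sum.cong) (auto simp: boundary_def word_index_nth)
  also have "\<dots> = (\<Sum>v\<in>words (Suc j).
    single (word_deg v - word_deg (word_list j ! p)) (h v (word_list j ! p)) * f $ word_index (Suc j) v)"
    by (rule sum_words)
  finally show ?thesis .
qed

lemma boundary_free_module:
  assumes f: "f \<in> free_module (bases P) (rank (Suc j))"
  shows "boundary j h *\<^sub>v f \<in> free_module (bases P) (rank j)"
proof -
  have "(boundary j h *\<^sub>v f) $ p \<in> base_carrier" if p: "p < rank j" for p
    unfolding boundary_index[OF f p]
  proof (intro base_carrier_sum base_carrier_mult)
    fix v assume v: "v \<in> words (Suc j)"
    show "f $ word_index (Suc j) v \<in> base_carrier"
      using f word_index[OF v] by (auto simp: free_module_eq)
    show "single (word_deg v - word_deg (word_list j ! p)) (h v (word_list j ! p)) \<in> base_carrier"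
      using h[OF v, of "word_list j ! p"]
      by (cases "h v (word_list j ! p) = 0") (auto simp: base_carrier_0 words_at_def intro: base_carrier_single)
  qed
  moreover have "boundary j h *\<^sub>v f \<in> carrier_vec (rank j)"
    by (rule carrier_vecI) (simp add: boundary_def)
  ultimately show ?thesis by (simp add: free_module_eq)
qed

lemma component_boundary:
  assumes f: "f \<in> free_module (bases P) (rank (Suc j))"
  shows "component j (boundary j h *\<^sub>v f) s = differential j h (component (Suc j) f s)"
proof
  fix w
  show "component j (boundary j h *\<^sub>v f) s w = differential j h (component (Suc j) f s) w"
  proof (cases "w \<in> words_at j s")
    case True
    then obtain r where r: "w \<in> words j" "r \<in> multidegrees" "s = word_deg w + r" "s - word_deg w = r"
      by (rule words_atE)
    have p: "word_index j w < rank j" "word_list j ! word_index j w = w" using word_index[OF r(1)] by auto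
    have "component j (boundary j h *\<^sub>v f) s w = (\<Sum>v\<in>words (Suc j).
        lookup (single (word_deg v - word_deg w) (h v w) * f $ word_index (Suc j) v) r)"
      using True by (simp add: component_def boundary_index[OF f p(1)] p(2) r(4) lookup_sum)
    also have "\<dots> = (\<Sum>v\<in>words (Suc j). component (Suc j) f s v * h v w)"
    proof (rule sum.cong[OF refl])
      fix v assume v: "v \<in> words (Suc j)"
      let ?g = "f $ word_index (Suc j) v"
      have g: "keys ?g \<subseteq> multidegrees"
        using f word_index[OF v] by (auto simp: free_module_eq base_carrier_def)
      show "lookup (single (word_deg v - word_deg w) (h v w) * ?g) r = component (Suc j) f s v * h v w"
      proof (cases "h v w = 0")
        case False
        from h[OF v False] obtain e where
          e: "e \<in> multidegrees" "word_deg v = word_deg w + e" "word_deg v - word_deg w = e"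
          by (rule words_atE)
        show ?thesis
        proof (cases "v \<in> words_at (Suc j) s")
          case True
          then obtain t where t: "s = word_deg v + t" "s - word_deg v = t" by (rule words_atE)
          have "r = e + t" using t(1) r(3) e(2) by (simp add: add.assoc)
          then show ?thesis
            using True unfolding e(3) by (simp add: lookup_single_mult component_def t(2))
        next
          case False
          \<comment> \<open>A term of the product at \<open>r\<close> would come from an exponent of
            \<open>?g\<close>, and that exponent would witness that \<open>v\<close> lies in
            \<open>words_at (Suc j) s\<close>.\<close>
          have "lookup (single e (h v w) * ?g) r = 0"
          proof (rule ccontr)
            assume "\<not> ?thesis"
            then have "r \<in> keys (single e (h v w) * ?g)" by (simp add: in_keys_iff)
            then obtain t where "t \<in> keys ?g" "r = e + t"
              using keys_mult[of "single e (h v w)" ?g] by (auto split: if_splits)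
            then have "v \<in> words_at (Suc j) s"
              using v g by (auto simp: words_at_def r(3) e(2) add.assoc)
            with False show False ..
          qed
          with False show ?thesis unfolding e(3) by (simp add: component_def)
        qed
      qed simp
    qed
    finally show ?thesis by (simp add: differential_def)
  next
    case False
    have "component (Suc j) f s v * h v w = 0" if v: "v \<in> words (Suc j)" for v
    proof (rule ccontr)
      assume ne: "\<not> ?thesis"
      then have "v \<in> words_at (Suc j) s" by (auto simp: component_def split: if_splits)
      then obtain t where t: "t \<in> multidegrees" "s = word_deg v + t" by (rule words_atE)
      have "w \<in> words_at j s"
        unfolding t(2) using h[OF v] ne t(1) words_at_add by simp
      with False show False ..
    qed
    then have "differential j h (component (Suc j) f s) w = 0"
      unfolding differential_def by (intro sum.neutral) auto
    with False show ?thesis by (simp add: component_def)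
  qed
qed

text \<open>Reduces exactness over the base ring to exactness in each multidegree. The predicate
  \<open>Q\<close> serves both ends: vanishing of the augmentation at the start, vanishing of the
  previous boundary map later on.\<close>

lemma boundary_image:
  assumes Q: "\<And>f. f \<in> free_module (bases P) (rank j) \<Longrightarrow> Q f \<longleftrightarrow> (\<forall>s. component j f s \<in> Z s)"
    and Z: "\<And>s. differential j h ` chain_space (Suc j) s = Z s"
  shows "{f \<in> free_module (bases P) (rank j). Q f} = (\<lambda>g. boundary j h *\<^sub>v g) ` free_module (bases P) (rank (Suc j))"
proof (intro equalityI subsetI)
  fix f assume "f \<in> (\<lambda>g. boundary j h *\<^sub>v g) ` free_module (bases P) (rank (Suc j))"
  then obtain g where g: "g \<in> free_module (bases P) (rank (Suc j))" "f = boundary j h *\<^sub>v g" by blast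
  have "component j f s \<in> Z s" for s
    using Z[of s] component_chain_space[of "Suc j" g s] by (auto simp: g(2) component_boundary[OF g(1)])
  then show "f \<in> {f \<in> free_module (bases P) (rank j). Q f}"
    using Q[OF boundary_free_module[OF g(1)]] boundary_free_module[OF g(1)] g(2) by simp
next
  fix f assume "f \<in> {f \<in> free_module (bases P) (rank j). Q f}"
  then have f: "f \<in> free_module (bases P) (rank j)" "\<And>s. component j f s \<in> Z s" using Q by auto
  \<comment> \<open>The preimage is chosen as 0 wherever the component is 0, so that only finitely
    many preimages are nonzero and they can be assembled into a vector.\<close>
  have "\<exists>c. c \<in> chain_space (Suc j) s \<and> differential j h c = component j f s \<and>
      (component j f s = (\<lambda>_. 0) \<longrightarrow> c = (\<lambda>_. 0))" for s
  proof (cases "component j f s = (\<lambda>_. 0)")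
    case True
    then show ?thesis by (intro exI[of _ "\<lambda>_. 0"]) (auto simp: chain_space_def differential_def)
  next
    case False
    then show ?thesis using f(2)[of s] Z[of s] by (metis imageE)
  qed
  then obtain c where c: "\<And>s. c s \<in> chain_space (Suc j) s" "\<And>s. differential j h (c s) = component j f s"
    "\<And>s. component j f s = (\<lambda>_. 0) \<Longrightarrow> c s = (\<lambda>_. 0)"
    by metis
  obtain g where g: "g \<in> free_module (bases P) (rank (Suc j))" "\<And>s. component (Suc j) g s = c s"
    by (rule component_surj[OF c(1) finite_components[of j f]]) (use c(3) in auto)
  have "boundary j h *\<^sub>v g = f"
    by (rule component_inject[OF boundary_free_module[OF g(1)] f(1)])
      (simp add: component_boundary[OF g(1)] g(2) c(2))
  then show "f \<in> (\<lambda>g. boundary j h *\<^sub>v g) ` free_module (bases P) (rank (Suc j))" using g(1) by blast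
qed

end

theorem koszul: "koszul_base_ring TYPE('a::field) (bases P)"
proof -
  obtain h :: "nat \<Rightarrow> expvec list \<Rightarrow> expvec list \<Rightarrow> 'a" where
    h0: "\<And>s. differential 0 (h 0) ` chain_space 1 s = augmented_cycles s" and
    hS: "\<And>j s. differential (Suc j) (h (Suc j)) ` chain_space (Suc (Suc j)) s =
      {f \<in> chain_space (Suc j) s. differential j (h j) f = (\<lambda>_. 0)}" and
    h: "\<And>j v w. v \<in> words (Suc j) \<Longrightarrow> h j v w \<noteq> 0 \<Longrightarrow> w \<in> words_at j (word_deg v)"
    by (rule exact_frame) (rule that)
  define e where "e = vec 1 (\<lambda>_. 1 :: 'a)"
  define A where "A j = boundary j (h j)" for j
  have rank0: "rank 0 = 1"
    using distinct_card[OF word_list(2), of 0] by (simp add: rank_def word_list(1))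
  have idx0: "word_index 0 [] = 0" using word_index[of "[]" 0] by (simp add: rank0)
  have aug: "augmentation e f = lookup (f $ 0) 0" if "f \<in> free_module (bases P) (rank 0)" for f
  proof -
    have "dim_vec f = 1" using that by (simp add: free_module_eq rank0)
    then show ?thesis by (simp add: augmentation_def e_def scalar_prod_def)
  qed
  have "linear_resolution (bases P) rank e A"
    unfolding linear_resolution_def
  proof (intro conjI allI)
    show "e \<in> carrier_vec (rank 0)" by (simp add: e_def rank0)
    show "A i \<in> carrier_mat (rank i) (rank (Suc i))" for i by (simp add: A_def boundary_def)
    show "elements_mat (A i) \<subseteq> base_ring_degree (bases P) 1" for i
      unfolding A_def by (rule boundary_entries[OF h])
    show "augmentation e ` free_module (bases P) (rank 0) = UNIV"
    proof (intro equalityI subsetI)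
      fix a :: 'a
      have f: "vec 1 (\<lambda>_. single 0 a) \<in> free_module (bases P) (rank 0)"
        by (simp add: free_module_eq rank0 base_carrier_single)
      show "a \<in> augmentation e ` free_module (bases P) (rank 0)"
        by (rule image_eqI[OF _ f]) (subst aug[OF f], simp)
    qed simp
    show "{f \<in> free_module (bases P) (rank 0). augmentation e f = 0} =
        (\<lambda>g. A 0 *\<^sub>v g) ` free_module (bases P) (rank 1)"
      unfolding A_def One_nat_def
    proof (rule boundary_image[OF h])
      show "differential 0 (h 0) ` chain_space (Suc 0) s = augmented_cycles s" for s
        using h0 by simp
      fix f :: "'a ts_poly vec" assume f: "f \<in> free_module (bases P) (rank 0)"
      have "[] \<in> words_at 0 0" by (simp add: words_at_def)
      then show "augmentation e f = 0 \<longleftrightarrow> (\<forall>s. component 0 f s \<in> augmented_cycles s)"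
        using component_chain_space[of 0 f] by (auto simp: aug[OF f] augmented_cycles_def component_def idx0)
    qed
    show "{f \<in> free_module (bases P) (rank (Suc i)). A i *\<^sub>v f = 0\<^sub>v (rank i)} =
        (\<lambda>g. A (Suc i) *\<^sub>v g) ` free_module (bases P) (rank (Suc (Suc i)))" for i
      unfolding A_def
    proof (rule boundary_image[OF h _ hS])
      fix f :: "'a ts_poly vec" assume f: "f \<in> free_module (bases P) (rank (Suc i))"
      have z: "0\<^sub>v (rank i) \<in> free_module (bases P) (rank i)"
        by (simp add: free_module_eq base_carrier_0)
      have "boundary i (h i) *\<^sub>v f = 0\<^sub>v (rank i) \<longleftrightarrow>
          (\<forall>s. component i (boundary i (h i) *\<^sub>v f) s = component i (0\<^sub>v (rank i)) s)"
        using component_inject[OF boundary_free_module[OF h f] z] by auto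
      then show "boundary i (h i) *\<^sub>v f = 0\<^sub>v (rank i) \<longleftrightarrow>
          (\<forall>s. component (Suc i) f s \<in> {f \<in> chain_space (Suc i) s. differential i (h i) f = (\<lambda>_. 0)})"
        by (simp add: component_boundary[OF h f] component_zero component_chain_space)
    qed
  qed
  then show ?thesis unfolding koszul_base_ring_def by blast
qed

end

theorem theorem5p3:
  shows
    "((\<forall>n M. matroid n M \<longrightarrow>
         (toric_ideal (bases M) :: 'a::field x_poly set) =
           Idl\<^bsub>x_ring (bases M)\<^esub> (symmetric_exchange_relations (bases M))) \<longrightarrow>
      (\<forall>n P. discrete_polymatroid n P \<longrightarrow>
         (toric_ideal (bases P) :: 'a x_poly set) =
           Idl\<^bsub>x_ring (bases P)\<^esub> (symmetric_exchange_relations (bases P)))) \<and>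
     (\<forall>n P. discrete_polymatroid n P \<and> strong_exchange_property (bases P) \<longrightarrow>
        (sortable (bases P) \<and>
         (\<exists>r G. monomial_order (bases P) r \<and>
            groebner_basis (bases P) r (toric_ideal (bases P) :: 'a x_poly set) G \<and>
            (\<forall>g\<in>G. quadratic g)) \<and>
         koszul_base_ring TYPE('a) (bases P)) \<and>
        (toric_ideal (bases P) :: 'a x_poly set) =
          Idl\<^bsub>x_ring (bases P)\<^esub> (symmetric_exchange_relations (bases P)))"
proof (intro conjI impI allI)
  fix n P
  assume *: "\<forall>n M. matroid n M \<longrightarrow> (toric_ideal (bases M) :: 'a x_poly set) =
      Idl\<^bsub>x_ring (bases M)\<^esub> (symmetric_exchange_relations (bases M))"
    and "discrete_polymatroid n P"
  then interpret polymatroid n P by unfold_locales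
  show "(toric_ideal (bases P) :: 'a x_poly set) =
      Idl\<^bsub>x_ring (bases P)\<^esub> (symmetric_exchange_relations (bases P))"
    by (rule toric_ideal_from_matroids) (use * in blast)
next
  fix n P assume "discrete_polymatroid n P \<and> strong_exchange_property (bases P)"
  then interpret strong_polymatroid n P by unfold_locales auto
  show "sortable (bases P)" by (rule sortable_bases)
  show "\<exists>r G. monomial_order (bases P) r \<and>
      groebner_basis (bases P) r (toric_ideal (bases P) :: 'a x_poly set) G \<and> (\<forall>g\<in>G. quadratic g)"
    using monomial_order_mon_order groebner_basis_sorting_relations quadratic_sorting_relations by blast
  show "koszul_base_ring TYPE('a) (bases P)" by (rule koszul)
  show "(toric_ideal (bases P) :: 'a x_poly set) =
      Idl\<^bsub>x_ring (bases P)\<^esub> (symmetric_exchange_relations (bases P))"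
    by (rule toric_ideal_strong)
qed

end
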